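(* Let $0<|q|<1$. For any Young diagrams $\lambda$ and $\mu$, $${}_{\mathcal S}\langle\lambda|\mu\rangle={}_{\mathcal S}\langle\mu|\lambda\rangle,\qquad \langle\lambda|\mu\rangle_{\mathcal S}=\langle\mu|\lambda\rangle_{\mathcal S},\qquad \langle\mu|\lambda\rangle_{\mathcal S}=(-q)^{-|\lambda|-|\mu|}\;{}_{\mathcal S}\langle\lambda'|\mu'\rangle .$$
   Context: For a partition $\lambda$: $\lambda'$ is the conjugate, $|\lambda|$ the size, $\kappa_\lambda=\sum_i\lambda_i(\lambda_i-2i+1)$. Standard basis: free fermion modes $\psi_r,\psi_r^\dagger$ ($r\in\mathbb Z+\frac12$) with $\{\psi_r,\psi^\dagger_s\}=\delta_{r+s,0}$, other anticommutators zero, vacuum $\psi_r|0\rangle=\psi^\dagger_r|0\rangle=0$ for $r>0$. Bosons $a_n=-\sum_r:\psi_r\psi^\dagger_{n-r}:$ satisfy $[a_m,a_n]=m\delta_{m+n,0}$. With $\mathrm{diag}(\lambda)=\#\{i:i\le\lambda_i\}$, $$|\lambda\rangle=\prod_{i=1}^{\mathrm{diag}(\lambda)}\big[(-1)^{-\lambda_i+i}\psi_{-\lambda'_i+i-1/2}\psi^\dagger_{-\lambda_i+i-1/2}\big]|0\rangle ,$$ a basis of the charge-zero sector; $\langle\lambda|$ is the dual basis, $\langle\lambda|\mu\rangle=\delta_{\lambda\mu}$, $\langle0|=\langle\varnothing|$. S-dual basis (kets and bras in the graded completions): $$|\lambda\rangle_{\mathcal S}=\mathcal N_\lambda\exp\Big[-\sum_{n>0}\tfrac{a_{-n}}{n}\sum_{l>0}q^{(-\lambda'_l+l-1)n}\Big]|0\rangle,\quad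 {}_{\mathcal S}\langle\lambda|=\mathcal N'_\lambda\langle0|\exp\Big[\sum_{n>0}\tfrac{a_n}{n}\sum_{l>0}q^{(-\lambda_l+l)n}\Big],$$ $$\mathcal N_\lambda=\Big[(-1)^{|\lambda|}q^{\frac12\kappa_\lambda-|\lambda|}\prod_{i,j>0}(1-q^{-\lambda_i-\lambda'_j+i+j-1})^{-1}\Big]^{1/2},$$ $$\mathcal N'_\lambda=(-1)^{|\lambda|}\Big[(-1)^{|\lambda|}q^{-\frac12\kappa_\lambda+|\lambda|}\prod_{i,j>0}(1-q^{-\lambda_i-\lambda'_j+i+j-1})^{-1}\Big]^{1/2}.$$ The square roots are the holomorphic ones in $|q|<1$ that are positive for $0<q<1$. Here ${}_{\mathcal S}\langle\lambda|\mu\rangle$ pairs the S-dual bra of $\lambda$ with the standard ket of $\mu$, and $\langle\lambda|\mu\rangle_{\mathcal S}$ pairs the standard bra of $\lambda$ with the S-dual ket of $\mu$. *)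

theory Defs
  imports "HOL-Complex_Analysis.Complex_Analysis" "HOL-Library.Groups_Big_Fun"
begin

section \<open>Partitions\<close>

text \<open>A partition is the list of its nonzero parts in weakly decreasing order. As in the
  mathematical notation, the parts \<^term>\<open>part lam i\<close> are numbered from \<^term>\<open>i = (1::nat)\<close>, and
  vanish beyond the length.\<close>

definition is_partition :: "nat list \<Rightarrow> bool" where
  "is_partition lam \<longleftrightarrow> sorted_wrt (\<ge>) lam \<and> 0 \<notin> set lam"

definition part :: "nat list \<Rightarrow> nat \<Rightarrow> nat" where
  "part lam i = (if 1 \<le> i \<and> i \<le> length lam then lam ! (i - 1) else 0)"

definition conjugate :: "nat list \<Rightarrow> nat list" where
  "conjugate lam = map (\<lambda>j. length (filter (\<lambda>x. j \<le> x) lam)) [1..<Suc (part lam 1)]"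

definition psize :: "nat list \<Rightarrow> nat" where
  "psize lam = sum_list lam"

definition kappa :: "nat list \<Rightarrow> int" where
  "kappa lam = (\<Sum>i=1..length lam. int (part lam i) * (int (part lam i) - 2 * int i + 1))"

definition diag :: "nat list \<Rightarrow> nat" where
  "diag lam = card {i. 1 \<le> i \<and> i \<le> part lam i}"

lemma even_kappa: "even (kappa lam)"
  unfolding kappa_def by (rule dvd_sum) simp

section \<open>Fermionic Fock space and its completion\<close>

text \<open>The half-integer \<open>r = k + 1/2\<close> is represented by the integer \<open>k\<close>; thus \<open>r > 0\<close> means
  \<open>k \<ge> 0\<close>, and \<open>r + s = 0\<close> means \<open>k + l + 1 = 0\<close>.

  We use the semi-infinite wedge model. A set \<open>S\<close> of modes which differs from \<open>{0..}\<close> in finitely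
  many elements stands for the wedge product of the \<open>e\<^sub>k\<close>, \<open>k \<in> S\<close>, in increasing order. A ket is
  the function of its coefficients in this basis, so kets of infinite support are elements of the
  graded completion (every energy level is finite-dimensional). The function should vanish on all
  sets that do not satisfy \<open>maya\<close>, which is the case for all kets constructed below.\<close>

type_synonym ket = "int set \<Rightarrow> complex"
type_synonym bra = "ket \<Rightarrow> complex"

definition maya :: "int set \<Rightarrow> bool" where
  "maya S \<longleftrightarrow> finite (S - {0..}) \<and> finite ({0..} - S)"

definition vac :: ket where
  "vac = (\<lambda>S. if S = {0..} then 1 else 0)"

definition below_sign :: "int \<Rightarrow> int set \<Rightarrow> complex" where
  "below_sign k S = (-1) ^ card {s \<in> S. s < k}"

text \<open>The mode \<open>\<psi>\<^bsub>k+1/2\<^esub>\<close> is the exterior product with \<open>e\<^sub>k\<close>, and \<open>\<psi>\<close>-dagger of index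
  \<open>l + 1/2\<close> is the contraction with \<open>e\<close> of index \<open>- l - 1\<close> (the half-integer \<open>-(l + 1/2)\<close>).\<close>

definition psi :: "int \<Rightarrow> ket \<Rightarrow> ket" where
  "psi k v = (\<lambda>S. if k \<in> S then below_sign k S * v (S - {k}) else 0)"

definition psid :: "int \<Rightarrow> ket \<Rightarrow> ket" where
  "psid l v = (\<lambda>S. if - l - 1 \<notin> S
     then below_sign (- l - 1) S * v (insert (- l - 1) S) else 0)"

lemma finite_below: "maya S \<Longrightarrow> finite {s \<in> S. s < k}"
  by (rule finite_subset[of _ "(S - {0..}) \<union> {0..<k}"]) (auto simp: maya_def)

lemma below_sign_insert:
  assumes "maya S" "m \<notin> S"
  shows "below_sign k (insert m S) = (if m < k then - below_sign k S else below_sign k S)"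
proof -
  have "{s \<in> insert m S. s < k} = (if m < k then insert m {s \<in> S. s < k} else {s \<in> S. s < k})"
    by auto
  then show ?thesis using assms finite_below[OF assms(1), of k] by (simp add: below_sign_def)
qed

lemma below_sign_remove:
  assumes "maya S" "m \<in> S"
  shows "below_sign k (S - {m}) = (if m < k then - below_sign k S else below_sign k S)"
proof -
  have "maya (S - {m})" using assms(1)
    by (auto simp: maya_def intro: finite_subset[of _ "insert m ({0..} - S)"]
        finite_subset[of _ "S - {0..}"])
  from below_sign_insert[OF this, of m k] assms(2) show ?thesis by (auto simp: insert_absorb)
qed

lemma below_sign_square: "below_sign k S * below_sign k S = 1"
  by (simp add: below_sign_def flip: power_mult_distrib)

lemma psi_psid_anticommutator:
  assumes "maya S"
  shows "psi k (psid l v) S + psid l (psi k v) S = (if k + l + 1 = 0 then v S else 0)"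
proof (cases "k = - l - 1")
  case True
  define m where "m = - l - 1"
  have k: "k = m" using True by (simp add: m_def)
  show ?thesis
    using assms
    by (cases "m \<in> S")
      (simp_all add: psi_def psid_def k m_def[symmetric] below_sign_remove below_sign_insert
        insert_absorb mult.assoc[symmetric] below_sign_square, simp_all add: m_def)
next
  case False
  define m where "m = - l - 1"
  have km: "k \<noteq> m" "k + l + 1 \<noteq> 0" using False by (auto simp: m_def)
  have "insert m (S - {k}) = insert m S - {k}" using km by auto
  then show ?thesis
    using assms km
    by (auto simp: psi_def psid_def m_def[symmetric] below_sign_remove below_sign_insert)
qed

lemma psi_psi_anticommutator:
  assumes "maya S"
  shows "psi k (psi l v) S + psi l (psi k v) S = 0"
proof (cases "k = l")
  case False
  have "S - {k} - {l} = S - {l} - {k}" by auto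
  then show ?thesis using assms False by (auto simp: psi_def below_sign_remove)
qed (simp add: psi_def)

lemma psid_psid_anticommutator:
  assumes "maya S"
  shows "psid k (psid l v) S + psid l (psid k v) S = 0"
proof (cases "k = l")
  case False
  have "insert (- k - 1) (insert (- l - 1) S) = insert (- l - 1) (insert (- k - 1) S)" by auto
  then show ?thesis using assms False by (auto simp: psid_def below_sign_insert)
qed (simp add: psid_def)

lemma psi_vac: "k \<ge> 0 \<Longrightarrow> psi k vac = (\<lambda>_. 0)"
  by (auto simp: psi_def vac_def fun_eq_iff)

lemma psid_vac: "l \<ge> 0 \<Longrightarrow> psid l vac = (\<lambda>_. 0)"
  by (auto simp: psid_def vac_def fun_eq_iff)

text \<open>Normal ordering of \<open>\<psi>\<close> of index \<open>k + 1/2\<close> and \<open>\<psi>\<close>-dagger of index \<open>l + 1/2\<close>: annihilators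
  are moved to the right. If both are annihilators, the two orders agree.\<close>

definition normal_ordered :: "int \<Rightarrow> int \<Rightarrow> ket \<Rightarrow> ket" where
  "normal_ordered k l v = (if k \<ge> 0 then (\<lambda>S. - psid l (psi k v) S) else psi k (psid l v))"

text \<open>\<^const>\<open>Sum_any\<close> is the sum of a family with finitely many nonzero members. The infinite
  sums of operators below are of this kind in every coefficient. The index \<open>n - k - 1\<close>
  represents \<open>n - r\<close>, where \<open>r = k + 1/2\<close>.\<close>

definition boson :: "int \<Rightarrow> ket \<Rightarrow> ket" where
  "boson n v = (\<lambda>S. - Sum_any (\<lambda>k. normal_ordered k (n - k - 1) v S))"

definition op_exp :: "(ket \<Rightarrow> ket) \<Rightarrow> ket \<Rightarrow> ket" where
  "op_exp A v = (\<lambda>S. Sum_any (\<lambda>k. (A ^^ k) v S / fact k))"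

section \<open>The standard basis\<close>

definition std_ket :: "nat list \<Rightarrow> ket" where
  "std_ket lam = foldr
     (\<lambda>i v. (\<lambda>S. (-1) powi (- int (part lam i) + int i) *
        psi (- int (part (conjugate lam) i) + int i - 1)
          (psid (- int (part lam i) + int i - 1) v) S))
     [1..<Suc (diag lam)] vac"

text \<open>The dual basis: the bra of \<open>lam\<close> maps \<open>v\<close>, an element of the completed charge-zero sector,
  to the coefficient of the standard ket of \<open>lam\<close> in the expansion of \<open>v\<close> (an infinite linear
  combination in general).\<close>

definition std_bra :: "nat list \<Rightarrow> bra" where
  "std_bra lam v = (THE x. \<exists>c. x = c lam \<and>
     (\<forall>S. v S = Sum_any (\<lambda>nu. if is_partition nu then c nu * std_ket nu S else 0)))"

section \<open>The S-dual basis\<close>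

definition disc_sqrt :: "(complex \<Rightarrow> complex) \<Rightarrow> complex \<Rightarrow> complex" where
  "disc_sqrt g q = (THE w. \<exists>f. f holomorphic_on ball 0 1 \<and>
     (\<forall>z\<in>ball 0 1 - {0}. (f z)\<^sup>2 = g z) \<and>
     (\<forall>x::real. 0 < x \<and> x < 1 \<longrightarrow> f (of_real x) \<in> \<real> \<and> 0 < Re (f (of_real x))) \<and>
     w = f q)"

text \<open>The indices of \<^const>\<open>prodinf\<close> and \<^const>\<open>suminf\<close> start at \<open>0\<close>, hence the successors.\<close>

definition hook_prod :: "nat list \<Rightarrow> complex \<Rightarrow> complex" where
  "hook_prod lam q = prodinf (\<lambda>i. prodinf (\<lambda>j.
     inverse (1 - q powi (- int (part lam (Suc i)) - int (part (conjugate lam) (Suc j))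
        + int (Suc i) + int (Suc j) - 1))))"

definition norm_ket :: "nat list \<Rightarrow> complex \<Rightarrow> complex" where
  "norm_ket lam = disc_sqrt (\<lambda>q. (-1) ^ psize lam *
     q powi (kappa lam div 2 - int (psize lam)) * hook_prod lam q)"

definition norm_bra :: "nat list \<Rightarrow> complex \<Rightarrow> complex" where
  "norm_bra lam q = (-1) ^ psize lam * disc_sqrt (\<lambda>q. (-1) ^ psize lam *
     q powi (- (kappa lam div 2) + int (psize lam)) * hook_prod lam q) q"

definition sdual_ket :: "complex \<Rightarrow> nat list \<Rightarrow> ket" where
  "sdual_ket q lam = (\<lambda>S. norm_ket lam q * op_exp
     (\<lambda>v T. - Sum_any (\<lambda>n::nat. if n > 0 then boson (- int n) v T / of_nat n *
        suminf (\<lambda>l. q powi ((- int (part (conjugate lam) (Suc l)) + int (Suc l) - 1) * int n))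
        else 0)) vac S)"

definition sdual_bra :: "complex \<Rightarrow> nat list \<Rightarrow> bra" where
  "sdual_bra q lam v = norm_bra lam q * std_bra [] (op_exp
     (\<lambda>v T. Sum_any (\<lambda>n::nat. if n > 0 then boson (int n) v T / of_nat n *
        suminf (\<lambda>l. q powi ((- int (part lam (Suc l)) + int (Suc l)) * int n))
        else 0)) v)"

end

theory Submission
  imports "Jordan_Normal_Form.Determinant" Defs
begin

text \<open>The exponentials of bosons act on the wedge basis by sums over moves of one particle. The vacuum
  coefficient in the basis vector of a partition is therefore a Schur function \<open>s\<close> of the power
  sums in the exponent: a Jacobi--Trudi determinant satisfies the same differential equation.
  Up to sign, the bra pairing is \<open>norm_bra lam q\<close> times \<open>s\<close> of \<open>mu\<close> at the variables
  \<open>q powi (l - lam l)\<close>. The normalization is, up to a sign and a factor independent of \<open>lam\<close>, the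
  principal specialization of \<open>s\<close> of \<open>lam\<close>, because the hook product is computed by
  Frobenius' formula. The first claim is thus the symmetry in \<open>lam\<close> and \<open>mu\<close> of
  \<open>s\<^sub>l\<^sub>a\<^sub>m(q ^ l) * s\<^sub>m\<^sub>u(q powi (l - lam l))\<close>, which the bialternant formula reduces to the
  symmetry of a matrix of exponents. The third claim follows from homogeneity and from the symmetry
  of the hook product under conjugation, and the second one from the other two.\<close>


section \<open>Determinants of numerical families\<close>

text \<open>Wedges, variable sets and hook products are infinite, but everything is reduced to
  determinants of finite size \<open>N\<close>: the identities hold exactly for all large
  \<open>N\<close>, and the limit is harmless because a Schur function is a polynomial in finitely
  many \<open>t n\<close>. The exponentials are defined coefficientwise, so the differential
  equation is read as a recursion for the coefficients of a polynomial in an auxiliary variable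
  \<tau>; no convergence of operators is involved. Since \<open>Sum_any\<close> is 0 on families of
  infinite support, every manipulation of bosons has to be accompanied by the finiteness of the set
  of possible moves. The square roots are singled out by holomorphy and positivity, so an explicit
  root has to be exhibited: apart from the MacMahon factor, which has a logarithm, the radicand is
  the square of a rational function. For this the exponent of \<open>q\<close> must come out even
  and nonnegative, and the terms with \<open>kappa\<close> achieve just that.\<close>

definition ndet :: "nat \<Rightarrow> (nat \<Rightarrow> nat \<Rightarrow> 'a) \<Rightarrow> 'a :: comm_ring_1" where
  "ndet n f = Determinant.det (Matrix.mat n n (\<lambda>(i, j). f i j))"

lemma ndet_leibniz:
  "ndet n f = (\<Sum>p | p permutes {0..<n}. of_int (sign p) * (\<Prod>i = 0..<n. f i (p i)))"
proof -
  have "ndet n f = (\<Sum>p | p permutes {0..<n}. of_int (sign p) *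
      (\<Prod>i = 0..<n. Matrix.mat n n (\<lambda>(i, j). f i j) $$ (i, p i)))"
    unfolding ndet_def by (subst Determinant.det_def'[of _ n]) auto
  also have "\<dots> = (\<Sum>p | p permutes {0..<n}. of_int (sign p) * (\<Prod>i = 0..<n. f i (p i)))"
  proof (intro sum.cong refl arg_cong2[where f = "(*)"] prod.cong)
    fix p i assume "p \<in> {p. p permutes {0..<n}}" "i \<in> {0..<n}"
    then have "p i < n" "i < n" using permutes_in_image[of p "{0..<n}" i] by auto
    then show "Matrix.mat n n (\<lambda>(i, j). f i j) $$ (i, p i) = f i (p i)" by simp
  qed
  finally show ?thesis .
qed

lemma ndet_cong: "(\<And>i j. i < n \<Longrightarrow> j < n \<Longrightarrow> f i j = g i j) \<Longrightarrow> ndet n f = ndet n g"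
  unfolding ndet_def by (intro arg_cong[where f = Determinant.det] cong_mat) auto

lemma ndet_mult: "ndet n (\<lambda>i j. \<Sum>k<n. f i k * g k j) = ndet n f * ndet n g"
proof -
  have "Matrix.mat n n (\<lambda>(i, j). \<Sum>k<n. f i k * g k j) =
      Matrix.mat n n (\<lambda>(i, j). f i j) * Matrix.mat n n (\<lambda>(i, j). g i j)"
    by (rule eq_matI) (auto simp: scalar_prod_def lessThan_atLeast0)
  then show ?thesis
    unfolding ndet_def by (simp add: Determinant.det_mult[of _ n])
qed

lemma ndet_transpose: "ndet n (\<lambda>i j. f j i) = ndet n f"
proof -
  have "Matrix.mat n n (\<lambda>(i, j). f j i) = transpose_mat (Matrix.mat n n (\<lambda>(i, j). f i j))"
    by (rule eq_matI) auto
  then show ?thesis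
    unfolding ndet_def by (simp add: Determinant.det_transpose[of _ n])
qed

lemma ndet_permute_rows:
  assumes "p permutes {0..<n}"
  shows "ndet n (\<lambda>i. f (p i)) = of_int (sign p) * ndet n f"
proof -
  have "Matrix.mat n n (\<lambda>(i, j). f (p i) j) =
      Matrix.mat n n (\<lambda>(i, j). Matrix.mat n n (\<lambda>(i, j). f i j) $$ (p i, j))"
    using permutes_in_image[OF assms] by (intro eq_matI) auto
  then show ?thesis
    unfolding ndet_def using Determinant.det_permute_rows[OF _ assms, of "Matrix.mat n n (\<lambda>(i, j). f i j)"] by simp
qed

lemma ndet_identical_rows:
  assumes "i < n" "j < n" "i \<noteq> j" "\<And>k. k < n \<Longrightarrow> f i k = f j k"
  shows "ndet n f = 0"
  unfolding ndet_def
  by (rule Determinant.det_identical_rows[of _ n i j]) (use assms in \<open>auto intro!: eq_vecI\<close>)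

lemma ndet_zero_row:
  assumes "i < n" "\<And>k. k < n \<Longrightarrow> f i k = 0"
  shows "ndet n f = 0"
  unfolding ndet_leibniz
proof (intro sum.neutral ballI)
  fix p assume "p \<in> {p. p permutes {0..<n}}"
  then have "p i < n" using permutes_in_image[of p "{0..<n}" i] assms(1) by auto
  then have "(\<Prod>i = 0..<n. f i (p i)) = 0"
    using assms by (intro prod_zero bexI[of _ i]) auto
  then show "of_int (sign p) * (\<Prod>i = 0..<n. f i (p i)) = 0" by simp
qed

lemma ndet_scale_rows: "ndet n (\<lambda>i j. c i * f i j) = (\<Prod>i<n. c i) * ndet n f"
  unfolding ndet_leibniz
  by (simp add: prod.distrib sum_distrib_left lessThan_atLeast0 mult_ac)

lemma ndet_scale_columns: "ndet n (\<lambda>i j. c j * f i j) = (\<Prod>j<n. c j) * ndet n f"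
  using ndet_scale_rows[of n c "\<lambda>j i. f i j"] ndet_transpose[of n "\<lambda>j i. c j * f i j"]
    ndet_transpose[of n f] by simp

lemma ndet_upper_triangular:
  assumes "\<And>i j. j < i \<Longrightarrow> i < n \<Longrightarrow> f i j = 0"
  shows "ndet n f = (\<Prod>i<n. f i i)"
proof -
  have "ndet n f = prod_list (diag_mat (Matrix.mat n n (\<lambda>(i, j). f i j)))"
    unfolding ndet_def using assms
    by (intro Determinant.det_upper_triangular[of _ n]) (auto simp: upper_triangular_def)
  also have "diag_mat (Matrix.mat n n (\<lambda>(i, j). f i j)) = map (\<lambda>i. f i i) [0..<n]"
    by (auto simp: diag_mat_def)
  finally show ?thesis
    using prod.distinct_set_conv_list[of "[0..<n]" "\<lambda>i. f i i"] by (simp add: lessThan_atLeast0)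
qed

lemma ndet_lower_triangular:
  assumes "\<And>i j. i < j \<Longrightarrow> j < n \<Longrightarrow> f i j = 0"
  shows "ndet n f = (\<Prod>i<n. f i i)"
  using ndet_upper_triangular[of n "\<lambda>i j. f j i"] assms by (simp add: ndet_transpose[of n f])

text \<open>Only the vanishing of the reversed Vandermonde determinant matters later, so the sign of
  the reversal stays uncomputed; it is 1 or -1.\<close>

lemma ndet_reverse_columns_eq_0_iff:
  fixes f :: "nat \<Rightarrow> nat \<Rightarrow> 'a :: idom"
  shows "ndet n (\<lambda>i j. f i (n - 1 - j)) = 0 \<longleftrightarrow> ndet n f = 0"
proof -
  define r where "r j = (if j < n then n - 1 - j else j)" for j
  have r: "r permutes {0..<n}"
  proof (rule bij_imp_permutes)
    show "bij_betw r {0..<n} {0..<n}"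
      by (rule bij_betw_byWitness[of _ r]) (auto simp: r_def)
  qed (auto simp: r_def)
  have "ndet n (\<lambda>i j. f i (n - 1 - j)) = ndet n (\<lambda>j i. f i (r j))"
    by (subst ndet_transpose[symmetric]) (rule ndet_cong, simp add: r_def)
  also have "\<dots> = of_int (sign r) * ndet n f"
    using ndet_permute_rows[OF r, of "\<lambda>j i. f i j"] by (simp add: ndet_transpose[of n f])
  finally show ?thesis by (simp add: sign_def)
qed

lemma coeff_monic_prod:
  "coeff (\<Prod>k<j. [:- x k, 1:] :: 'a :: idom poly) j = 1"
  "degree (\<Prod>k<j. [:- x k, 1:] :: 'a :: idom poly) = j"
proof -
  have "degree (\<Prod>k<j. [:- x k, 1:] :: 'a poly) = j \<and> lead_coeff (\<Prod>k<j. [:- x k, 1:] :: 'a poly) = 1"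
    by (subst degree_prod_eq_sum_degree) (auto simp: lead_coeff_prod)
  then show "coeff (\<Prod>k<j. [:- x k, 1:] :: 'a poly) j = 1"
    "degree (\<Prod>k<j. [:- x k, 1:] :: 'a poly) = j" by auto
qed

text \<open>Column operations, given by the unitriangular coefficient matrix of the monic
  \<open>P j\<close>, replace the power \<open>j\<close> by \<open>P j\<close>. As
  \<open>P j\<close> vanishes at \<open>x 0\<close>, ..., \<open>x (j - 1)\<close>, the result is
  triangular.\<close>

lemma vandermonde:
  fixes x :: "nat \<Rightarrow> 'a :: idom"
  shows "ndet n (\<lambda>i j. x i ^ j) = (\<Prod>j<n. \<Prod>k<j. x j - x k)"
proof -
  define P where "P j = (\<Prod>k<j. [:- x k, 1:])" for j
  have deg: "degree (P j) = j" and lead: "coeff (P j) j = 1" for j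
    unfolding P_def by (rule coeff_monic_prod)+
  have "ndet n (\<lambda>i j. x i ^ j) = ndet n (\<lambda>i j. x i ^ j) * ndet n (\<lambda>k j. coeff (P j) k)"
  proof -
    have "ndet n (\<lambda>k j. coeff (P j) k) = 1"
      by (subst ndet_upper_triangular) (auto simp: lead deg intro: coeff_eq_0)
    then show ?thesis by simp
  qed
  also have "\<dots> = ndet n (\<lambda>i j. \<Sum>k<n. x i ^ k * coeff (P j) k)"
    by (rule ndet_mult[symmetric])
  also have "\<dots> = ndet n (\<lambda>i j. poly (P j) (x i))"
  proof (rule ndet_cong)
    fix i j assume "i < n" "j < n"
    have "poly (P j) (x i) = (\<Sum>k\<le>j. coeff (P j) k * x i ^ k)"
      by (simp add: poly_altdef deg)
    also have "\<dots> = (\<Sum>k<n. coeff (P j) k * x i ^ k)"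
      by (rule sum.mono_neutral_left) (use \<open>j < n\<close> in \<open>auto intro!: coeff_eq_0 simp: deg\<close>)
    finally show "(\<Sum>k<n. x i ^ k * coeff (P j) k) = poly (P j) (x i)"
      by (simp add: mult_ac)
  qed
  also have "\<dots> = (\<Prod>j<n. poly (P j) (x j))"
    by (rule ndet_lower_triangular) (auto simp: P_def poly_prod intro!: prod_zero)
  finally show ?thesis by (simp add: P_def poly_prod)
qed

section \<open>The shift operator on the fermionic Fock space\<close>

text \<open>The value of \<open>below_sign\<close> is meaningless if infinitely many modes lie
  below, where \<open>card\<close> is 0, and the anticommutators are available on Maya sets only.
  Under this condition the formulas below hold at every set.\<close>

definition maya_supp :: "ket \<Rightarrow> bool" where
  "maya_supp v \<longleftrightarrow> (\<forall>S. v S \<noteq> 0 \<longrightarrow> maya S)"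

definition hops :: "int set \<Rightarrow> (nat \<times> int) set" where
  "hops S = {(n, k). 0 < n \<and> k \<in> S \<and> k + int n \<notin> S}"

definition hop :: "nat \<Rightarrow> int \<Rightarrow> int set \<Rightarrow> int set" where
  "hop n k S = insert (k + int n) (S - {k})"

definition hop_sign :: "nat \<Rightarrow> int \<Rightarrow> int set \<Rightarrow> complex" where
  "hop_sign n k S = (-1) ^ card {s \<in> S. k < s \<and> s < k + int n}"

text \<open>On basis vectors a boson of negative index moves a particle down. Kets are coefficient
  functions, so the coefficient at \<open>S\<close> is read off at sets in which a particle of
  \<open>S\<close> has moved up. \<open>hop_sign\<close> is the sign of passing the particles in
  between.\<close>

definition shift_op :: "(nat \<Rightarrow> complex) \<Rightarrow> ket \<Rightarrow> ket" where
  "shift_op t v = (\<lambda>S. \<Sum>(n, k)\<in>hops S. t n * hop_sign n k S * v (hop n k S))"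

lemma maya_insert [simp]: "maya (insert k S) \<longleftrightarrow> maya S"
proof -
  have "finite (insert k S - {0..}) \<longleftrightarrow> finite (S - {0..})"
    by (simp add: insert_Diff_if)
  moreover have "finite ({0..} - insert k S) \<longleftrightarrow> finite ({0..} - S)"
    by (metis finite_Diff_insert)
  ultimately show ?thesis by (simp add: maya_def)
qed

lemma maya_remove [simp]: "maya (S - {k}) \<longleftrightarrow> maya S"
  by (metis maya_insert insert_Diff_single)

lemma maya_hop [simp]: "maya (hop n k S) \<longleftrightarrow> maya S"
  by (simp add: hop_def)

lemma maya_bounds:
  assumes "maya S"
  obtains b where "b > 0" "S \<subseteq> {-b..}" "{b..} \<subseteq> S"
proof -
  have fin: "finite (S - {0..})" "finite ({0..} - S)" using assms by (auto simp: maya_def)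
  define B where "B = (S - {0..}) \<union> ({0..} - S)"
  have "finite B" using fin by (simp add: B_def)
  define b where "b = Max (insert 0 (abs ` B)) + 1"
  have b: "\<bar>x\<bar> < b" if "x \<in> B" for x
    unfolding b_def using that \<open>finite B\<close> by (auto intro: Max_ge less_le_trans zle_add1_eq_le[THEN iffD2])
  have "b > 0" unfolding b_def using \<open>finite B\<close> by (auto intro: le_less_trans[OF Max_ge])
  moreover have "S \<subseteq> {-b..}"
  proof
    fix x assume "x \<in> S"
    then show "x \<in> {-b..}" using b[of x] \<open>b > 0\<close> by (cases "x \<ge> 0") (auto simp: B_def)
  qed
  moreover have "{b..} \<subseteq> S"
  proof
    fix x assume "x \<in> {b..}"
    then show "x \<in> S" using b[of x] \<open>b > 0\<close> by (cases "x \<in> S") (auto simp: B_def)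
  qed
  ultimately show ?thesis using that by blast
qed

lemma finite_hops:
  assumes "maya S"
  shows "finite (hops S)"
proof -
  obtain b where b: "b > 0" "S \<subseteq> {-b..}" "{b..} \<subseteq> S" using maya_bounds[OF assms] .
  have "hops S \<subseteq> {..nat (2 * b)} \<times> {-b..b}"
  proof
    fix m assume "m \<in> hops S"
    then obtain n k where m: "m = (n, k)" "n > 0" "k \<in> S" "k + int n \<notin> S" by (auto simp: hops_def)
    then have "-b \<le> k" "\<not> k + int n \<ge> b" using b by auto
    then show "m \<in> {..nat (2 * b)} \<times> {-b..b}" using m by auto
  qed
  then show ?thesis by (rule finite_subset) auto
qed

lemma finite_between: "finite {s \<in> S. (a :: int) < s \<and> s < b}"
  by (rule finite_subset[of _ "{a..b}"]) auto

lemma below_sign_between: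
  assumes "maya S" "k < l" "k \<notin> S"
  shows "below_sign l S = below_sign k S * (-1) ^ card {s \<in> S. k < s \<and> s < l}"
proof -
  have "{s \<in> S. s < l} = {s \<in> S. s < k} \<union> {s \<in> S. k < s \<and> s < l}"
    using assms(2,3) by (auto, metis linorder_cases)
  then have "card {s \<in> S. s < l} = card {s \<in> S. s < k} + card {s \<in> S. k < s \<and> s < l}"
    using finite_below[OF assms(1), of k] finite_between[of S k l]
    by (simp add: card_Un_disjoint disjoint_iff)
  then show ?thesis by (simp add: below_sign_def power_add)
qed

lemma between_remove_insert:
  "{s \<in> S - {k}. k < s \<and> s < l} = {s \<in> S. k < s \<and> s < (l :: int)}"
  "{s \<in> insert k S. k < s \<and> s < l} = {s \<in> S. k < s \<and> s < l}"
  "{s \<in> S - {l}. k < s \<and> s < l} = {s \<in> S. k < s \<and> s < l}"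
  by auto

section \<open>Bosons as signed sums over moves of one particle\<close>

lemma hop_sign_psi:
  assumes "maya S" "n > 0" "k \<in> S"
  shows "below_sign k S * below_sign (k + int n) (S - {k}) = hop_sign n k S"
proof -
  have "below_sign k S = below_sign k (S - {k})"
    using assms by (simp add: below_sign_remove)
  moreover have "below_sign (k + int n) (S - {k}) =
      below_sign k (S - {k}) * (-1) ^ card {s \<in> S. k < s \<and> s < k + int n}"
    using assms below_sign_between[of "S - {k}" k "k + int n"]
    unfolding between_remove_insert by simp
  ultimately show ?thesis
    by (simp add: hop_sign_def mult.assoc[symmetric] below_sign_square)
qed

text \<open>The indices of the two modes have sum \<open>m\<close>, so for
  \<open>m \<noteq> 0\<close> they anticommute and the order matters only by its sign, which
  \<open>normal_ordered\<close> includes. Off the Maya sets both orders vanish, since adding and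
  removing a mode never leads to a Maya set.\<close>

lemma normal_ordered_eq:
  assumes "maya_supp v" "m \<noteq> 0"
  shows "normal_ordered k (m - k - 1) v S = psi k (psid (m - k - 1) v) S"
proof (cases "k \<ge> 0 \<and> maya S")
  case True
  then show ?thesis
    using psi_psid_anticommutator[of S k "m - k - 1" v] assms(2)
    by (simp add: normal_ordered_def neg_eq_iff_add_eq_0 add.commute)
next
  case False
  have "v T = 0" if "\<not> maya T" for T
    using assms(1) that by (auto simp: maya_supp_def)
  then have "psi k (psid l v) S = 0 \<and> psid l (psi k v) S = 0" if "\<not> maya S" for l
    using that by (simp add: psi_def psid_def)
  with False show ?thesis by (auto simp: normal_ordered_def)
qed

lemma psi_psid_lower:
  assumes "maya_supp v" "n > 0"
  shows "psi k (psid (- int n - k - 1) v) S =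
    (if (n, k) \<in> hops S then hop_sign n k S * v (hop n k S) else 0)"
proof (cases "maya S")
  case False
  then have "v (hop n k S) = 0" using assms(1) unfolding maya_supp_def by (metis maya_hop)
  then show ?thesis
    by (simp add: psi_def psid_def hop_def algebra_simps)
next
  case True
  have "- (- int n - k - 1) - 1 = k + int n" by simp
  moreover have "k + int n \<in> S - {k} \<longleftrightarrow> k + int n \<in> S" using assms(2) by simp
  ultimately have "psi k (psid (- int n - k - 1) v) S = (if k \<in> S then below_sign k S *
      (if k + int n \<notin> S then below_sign (k + int n) (S - {k}) * v (insert (k + int n) (S - {k}))
       else 0) else 0)"
    unfolding psi_def psid_def by (simp add: add.commute[of "int n" k])
  then show ?thesis
    using hop_sign_psi[OF True assms(2), of k] assms(2)
    by (simp add: hops_def hop_def flip: mult.assoc)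
qed

lemma psi_psid_raise:
  assumes "maya_supp v" "n > 0"
  shows "psi k (psid (int n - k - 1) v) S =
    (if k \<in> S \<and> k - int n \<notin> S
     then hop_sign n (k - int n) (insert (k - int n) (S - {k})) * v (insert (k - int n) (S - {k}))
     else 0)"
proof (cases "maya S")
  case False
  then have "v (insert (k - int n) (S - {k})) = 0"
    using assms(1) unfolding maya_supp_def by (metis maya_insert maya_remove)
  then show ?thesis using assms(2) by (simp add: psi_def psid_def algebra_simps)
next
  case True
  have "below_sign k S * below_sign (k - int n) (S - {k}) =
      hop_sign n (k - int n) (insert (k - int n) (S - {k}))"
    if "k \<in> S" "k - int n \<notin> S"
  proof -
    have "below_sign (k - int n) (S - {k}) = below_sign (k - int n) S"
      using True that assms(2) by (simp add: below_sign_remove)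
    moreover have "below_sign k S =
        below_sign (k - int n) S * (-1) ^ card {s \<in> S. k - int n < s \<and> s < k}"
      using True that assms(2) by (intro below_sign_between) auto
    moreover have "{s \<in> insert (k - int n) (S - {k}). k - int n < s \<and> s < k} =
        {s \<in> S. k - int n < s \<and> s < k}"
      by auto
    moreover have "a * b * a = b" if "a * a = 1" for a b :: complex
      using that by (metis mult.assoc mult.commute mult.right_neutral)
    ultimately show ?thesis
      using below_sign_square[of "k - int n" S] by (simp add: hop_sign_def)
  qed
  with True show ?thesis
    using assms(2) by (auto simp: psi_def psid_def mult.assoc[symmetric])
qed

lemma boson_lower:
  assumes "maya_supp v" "n > 0"
  shows "boson (- int n) v S =
    - Sum_any (\<lambda>k. if (n, k) \<in> hops S then hop_sign n k S * v (hop n k S) else 0)"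
  unfolding boson_def
  using normal_ordered_eq[OF assms(1), of "- int n"] psi_psid_lower[OF assms] assms(2) by simp

lemma Sum_any_Sum_any_eq_sum:
  assumes "finite C" "\<And>a b. g a b \<noteq> 0 \<Longrightarrow> (a, b) \<in> C"
  shows "Sum_any (\<lambda>a. Sum_any (g a)) = (\<Sum>(a, b)\<in>C. g a b)"
proof -
  have "Sum_any (\<lambda>a. Sum_any (g a)) = Sum_any (\<lambda>(a, b). g a b)"
  proof (rule Sum_any.cartesian_product)
    show "finite (fst ` C \<times> snd ` C)" using assms(1) by auto
    show "{a. \<exists>b. g a b \<noteq> 0} \<times> {b. \<exists>a. g a b \<noteq> 0} \<subseteq> fst ` C \<times> snd ` C"
      using assms(2) by force
  qed
  also have "\<dots> = (\<Sum>(a, b)\<in>C. g a b)"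
    using assms by (intro Sum_any.expand_superset) auto
  finally show ?thesis .
qed

text \<open>At a Maya set both sums have their support in the finite set \<open>hops S\<close>,
  which allows them to be merged for arbitrary coefficients \<open>p n\<close>. The sign in front
  cancels the one in \<open>boson\<close>.\<close>

lemma shift_op_boson:
  assumes "maya_supp v"
  shows "- Sum_any (\<lambda>n::nat. if n > 0 then boson (- int n) v S / of_nat n * p n else 0) =
    shift_op (\<lambda>n. p n / of_nat n) v S"
proof (cases "maya S")
  case False
  then have "v (hop n k S) = 0" for n k using assms(1) unfolding maya_supp_def by (metis maya_hop)
  then show ?thesis using boson_lower[OF assms, of _ S] 
    by (simp add: shift_op_def cong: if_cong)
next
  case True
  have "(if n > 0 then boson (- int n) v S / of_nat n * p n else 0) =
     - Sum_any (\<lambda>k. if (n, k) \<in> hops S then p n / of_nat n * hop_sign n k S * v (hop n k S) else 0)"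
    for n
  proof (cases "n > 0")
    case True
    have fin: "finite {k. (if (n, k) \<in> hops S then hop_sign n k S * v (hop n k S) else 0) \<noteq> 0}"
      by (rule finite_subset[of _ "snd ` hops S"])
        (auto split: if_splits intro: rev_image_eqI finite_hops[OF \<open>maya S\<close>])
    have "boson (- int n) v S / of_nat n * p n = - (p n / of_nat n *
        Sum_any (\<lambda>k. if (n, k) \<in> hops S then hop_sign n k S * v (hop n k S) else 0))"
      using boson_lower[OF assms True, of S] by simp
    also have "\<dots> = - Sum_any (\<lambda>k. p n / of_nat n *
        (if (n, k) \<in> hops S then hop_sign n k S * v (hop n k S) else 0))"
      by (subst Sum_any_right_distrib[OF fin]) simp
    finally show ?thesis using True by (simp add: if_distrib mult.assoc cong: if_cong)
  qed (simp add: hops_def)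
  then have "- Sum_any (\<lambda>n::nat. if n > 0 then boson (- int n) v S / of_nat n * p n else 0) =
    - Sum_any (\<lambda>n. - Sum_any (\<lambda>k. if (n, k) \<in> hops S
        then p n / of_nat n * hop_sign n k S * v (hop n k S) else 0))"
    by simp
  also have "\<dots> = Sum_any (\<lambda>n. Sum_any (\<lambda>k. if (n, k) \<in> hops S
        then p n / of_nat n * hop_sign n k S * v (hop n k S) else 0))"
    by (simp add: Sum_any.expand_set sum_negf)
  also have "\<dots> = (\<Sum>(n, k)\<in>hops S. if (n, k) \<in> hops S
        then p n / of_nat n * hop_sign n k S * v (hop n k S) else 0)"
    by (rule Sum_any_Sum_any_eq_sum[OF finite_hops[OF True]]) (auto split: if_splits)
  finally show ?thesis by (simp add: shift_op_def case_prod_unfold)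
qed

lemma maya_supp_shift_op:
  assumes "maya_supp v"
  shows "maya_supp (shift_op t v)"
  unfolding maya_supp_def
proof (intro allI impI)
  fix S assume "shift_op t v S \<noteq> 0"
  then obtain n k where "v (hop n k S) \<noteq> 0"
    unfolding shift_op_def by (force elim!: sum.not_neutral_contains_not_neutral)
  then show "maya S" using assms unfolding maya_supp_def by (metis maya_hop)
qed

lemma maya_supp_vac: "maya_supp vac"
  by (auto simp: maya_supp_def vac_def maya_def)

lemma maya_supp_shift_op_pow: "maya_supp v \<Longrightarrow> maya_supp ((shift_op t ^^ m) v)"
  by (induction m) (auto intro: maya_supp_shift_op)

text \<open>Agreement is required along the iterates of \<open>v\<close> only, because the operators
  compared below agree on kets with \<open>maya_supp\<close> and not in general.\<close>

lemma op_exp_cong: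
  assumes "\<And>m. (A ^^ m) v = (B ^^ m) v"
  shows "op_exp A v = op_exp B v"
  using assms by (simp add: op_exp_def)

lemma op_exp_ket:
  "op_exp (\<lambda>v T. - Sum_any (\<lambda>n::nat. if n > 0 then boson (- int n) v T / of_nat n * p n else 0)) vac
     = op_exp (shift_op (\<lambda>n. p n / of_nat n)) vac" (is "op_exp ?A vac = op_exp ?B vac")
proof (rule op_exp_cong)
  fix m show "(?A ^^ m) vac = (?B ^^ m) vac"
  proof (induction m)
    case (Suc m)
    have "(?A ^^ Suc m) vac = ?A ((?B ^^ m) vac)"
      by (simp only: funpow.simps o_apply Suc)
    also have "\<dots> = ?B ((?B ^^ m) vac)"
      by (intro ext shift_op_boson maya_supp_shift_op_pow maya_supp_vac)
    finally show ?case by simp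
  qed simp
qed


subsection \<open>The adjoint of the shift operator\<close>

definition raise_op :: "(nat \<Rightarrow> complex) \<Rightarrow> ket \<Rightarrow> ket" where
  "raise_op t v = (\<lambda>S. Sum_any (\<lambda>n::nat. if n > 0 then boson (int n) v S / of_nat n * t n else 0))"

lemma hop_unhop:
  assumes "n > 0" "k \<in> S" "k - int n \<notin> S"
  shows "(n, k - int n) \<in> hops (insert (k - int n) (S - {k}))"
    "hop n (k - int n) (insert (k - int n) (S - {k})) = S"
  using assms by (auto simp: hops_def hop_def)

lemma unhop_hop:
  assumes "(n, k) \<in> hops T"
  shows "k + int n \<in> hop n k T" "k \<notin> hop n k T" "insert k (hop n k T - {k + int n}) = T"
  using assms by (auto simp: hops_def hop_def)

text \<open>Finite support keeps the sum over \<open>n\<close> finite; for a general ket infinitely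
  many \<open>n\<close> may contribute at one set. Each nonzero term is a move
  \<open>(T, n, k)\<close> that ends in \<open>S\<close>, and \<open>k + int n\<close> is the mode
  over which the sum in \<open>boson\<close> runs.\<close>

lemma raise_op_eq:
  assumes "finite F" "F \<subseteq> Collect maya" "{T. v T \<noteq> 0} \<subseteq> F"
  shows "raise_op p v S =
    (\<Sum>T\<in>F. \<Sum>(n, k)\<in>hops T. if hop n k T = S then - p n / of_nat n * hop_sign n k T * v T else 0)"
proof -
  have supp: "maya_supp v" using assms(2,3) by (auto simp: maya_supp_def)
  define U where "U n k = insert (k - int n) (S - {k})" for n and k :: int
  define g where "g n k = (if 0 < n \<and> k \<in> S \<and> k - int n \<notin> S
      then p n / of_nat n * hop_sign n (k - int n) (U n k) * v (U n k) else 0)" for n k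
  define Z where "Z = (SIGMA T:F. {(n, k) \<in> hops T. hop n k T = S})"
  have "finite Z" unfolding Z_def
    using assms(1,2) by (intro finite_SigmaI) (auto intro: finite_subset[OF _ finite_hops])
  define C where "C = (\<lambda>(T, n, k). (n, k + int n)) ` Z"
  have "finite C" using \<open>finite Z\<close> by (simp add: C_def)
  have gC: "(n, k) \<in> C" if "g n k \<noteq> 0" for n k
  proof -
    from that have h: "n > 0" "k \<in> S" "k - int n \<notin> S" "v (U n k) \<noteq> 0"
      by (auto simp: g_def split: if_splits)
    from hop_unhop[OF h(1-3)] assms(3) h(4) have "(U n k, n, k - int n) \<in> Z"
      by (auto simp: Z_def U_def)
    then have "(\<lambda>(T, n, k). (n, k + int n)) (U n k, n, k - int n) \<in> C"
      unfolding C_def by (rule imageI)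
    then show ?thesis by simp
  qed
  have "raise_op p v S = Sum_any (\<lambda>n. - Sum_any (g n))"
    unfolding raise_op_def
  proof (rule Sum_any.cong)
    fix n
    show "(if n > 0 then boson (int n) v S / of_nat n * p n else 0) = - Sum_any (g n)"
    proof (cases "n > 0")
      case True
      have "finite {k. g n k \<noteq> 0}"
        by (rule finite_subset[of _ "snd ` C"]) (use \<open>finite C\<close> gC in \<open>force+\<close>)
      moreover have psi: "psi k (psid (int n - k - 1) v) S = (if k \<in> S \<and> k - int n \<notin> S
          then hop_sign n (k - int n) (U n k) * v (U n k) else 0)" for k
        unfolding U_def by (rule psi_psid_raise[OF supp True])
      show ?thesis
      \<comment> \<open>Finiteness is known for the family \<open>g n\<close>, which contains the
        factor \<open>p n\<close>. It passes to the family without this factor if the factor is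
        nonzero.\<close>
      proof (cases "p n = 0")
        case False
        define c where "c = p n / of_nat n"
        have "c \<noteq> 0" using False True by (simp add: c_def)
        have geq: "g n = (\<lambda>k. c * psi k (psid (int n - k - 1) v) S)"
          using True by (intro ext) (simp add: g_def psi c_def)
        have "finite {k. psi k (psid (int n - k - 1) v) S \<noteq> 0}"
          using \<open>finite {k. g n k \<noteq> 0}\<close> \<open>c \<noteq> 0\<close> by (simp add: geq)
        then have "Sum_any (g n) = c * Sum_any (\<lambda>k. psi k (psid (int n - k - 1) v) S)"
          unfolding geq by (rule Sum_any_right_distrib[symmetric])
        moreover have "boson (int n) v S = - Sum_any (\<lambda>k. psi k (psid (int n - k - 1) v) S)"
          unfolding boson_def using normal_ordered_eq[OF supp, of "int n"] True by simp
        ultimately show ?thesis using \<open>n > 0\<close> by (simp add: c_def)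
      next
        case True
        then have "g n = (\<lambda>_. 0)" by (simp add: g_def fun_eq_iff)
        with True show ?thesis by simp
      qed
    next
      case False
      then have "g n = (\<lambda>_. 0)" by (simp add: g_def fun_eq_iff)
      with False show ?thesis by simp
    qed
  qed
  also have "\<dots> = - Sum_any (\<lambda>n. Sum_any (g n))"
    by (simp add: Sum_any.expand_set sum_negf)
  also have "Sum_any (\<lambda>n. Sum_any (g n)) = (\<Sum>(n, k)\<in>C. g n k)"
    by (rule Sum_any_Sum_any_eq_sum[OF \<open>finite C\<close>]) (use gC in auto)
  also have "\<dots> = (\<Sum>(T, n, k)\<in>Z. g n (k + int n))"
  proof -
    have "inj_on (\<lambda>(T, n, k). (n, k + int n)) Z"
    proof (rule inj_onI, clarify)
      fix T n k T' n' k'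
      assume "(T, n, k) \<in> Z" "(T', n, k') \<in> Z" "k + int n = k' + int n"
      then show "T = T' \<and> (n, k) = (n, k')"
        using unhop_hop(3)[of n k T] unhop_hop(3)[of n k' T'] by (auto simp: Z_def)
    qed
    then show ?thesis
      unfolding C_def by (subst sum.reindex) (auto simp: case_prod_unfold)
  qed
  also have "\<dots> = (\<Sum>(T, n, k)\<in>Z. p n / of_nat n * hop_sign n k T * v T)"
  proof (rule sum.cong[OF refl], clarify)
    fix T n k assume "(T, n, k) \<in> Z"
    then have h: "(n, k) \<in> hops T" "hop n k T = S" by (auto simp: Z_def)
    from unhop_hop[OF h(1)] h show "g n (k + int n) = p n / of_nat n * hop_sign n k T * v T"
      by (simp add: g_def U_def hops_def)
  qed
  also have "\<dots> = (\<Sum>T\<in>F. \<Sum>(n, k)\<in>{(n, k) \<in> hops T. hop n k T = S}.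
      p n / of_nat n * hop_sign n k T * v T)"
    unfolding Z_def using assms(1,2)
    by (subst sum.Sigma) (auto intro: finite_subset[OF _ finite_hops])
  also have "- \<dots> = (\<Sum>T\<in>F. \<Sum>(n, k)\<in>hops T.
      if hop n k T = S then - p n / of_nat n * hop_sign n k T * v T else 0)"
    unfolding sum_negf[symmetric]
    by (rule sum.cong[OF refl], rule sum.mono_neutral_cong_left)
      (use assms(2) finite_hops in \<open>auto split: if_splits\<close>)
  finally show ?thesis .
qed

definition hop_image :: "int set set \<Rightarrow> int set set" where
  "hop_image F = (\<Union>T\<in>F. (\<lambda>(n, k). hop n k T) ` hops T)"

lemma finite_hop_image:
  assumes "finite F" "F \<subseteq> Collect maya"
  shows "finite (hop_image F)" "hop_image F \<subseteq> Collect maya"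
  using assms by (auto simp: hop_image_def finite_hops)

text \<open>For the bilinear pairing \<open>\<Sum>S. v S * w S\<close>, moving particles up in
  \<open>v\<close> is transposed to reading \<open>w\<close> at the moved set. The finite set
  \<open>hop_image F\<close> carries the support of the new ket, so the argument can be
  iterated.\<close>

lemma raise_op_adjoint:
  assumes "finite F" "F \<subseteq> Collect maya" "{T. v T \<noteq> 0} \<subseteq> F"
  shows "{S. raise_op p v S \<noteq> 0} \<subseteq> hop_image F"
    "(\<Sum>S\<in>hop_image F. raise_op p v S * w S) =
      (\<Sum>T\<in>F. v T * shift_op (\<lambda>n. - p n / of_nat n) w T)"
proof -
  note eq = raise_op_eq[OF assms, where p = p]
  show "{S. raise_op p v S \<noteq> 0} \<subseteq> hop_image F"
  proof (rule subsetI, rule ccontr)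
    fix S assume "S \<in> {S. raise_op p v S \<noteq> 0}" "S \<notin> hop_image F"
    then have "hop n k T \<noteq> S" if "T \<in> F" "(n, k) \<in> hops T" for T n k
      using that by (auto simp: hop_image_def)
    then have "raise_op p v S = 0"
      by (subst eq, intro sum.neutral ballI) auto
    with \<open>S \<in> {S. raise_op p v S \<noteq> 0}\<close> show False by simp
  qed
  have "(\<Sum>S\<in>hop_image F. raise_op p v S * w S) = (\<Sum>T\<in>F. \<Sum>S\<in>hop_image F. \<Sum>(n, k)\<in>hops T.
      if S = hop n k T then - p n / of_nat n * hop_sign n k T * v T * w S else 0)"
    unfolding eq sum_distrib_right by (subst sum.swap) (intro sum.cong refl, auto)
  also have "\<dots> = (\<Sum>T\<in>F. \<Sum>(n, k)\<in>hops T. \<Sum>S\<in>hop_image F.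
      if S = hop n k T then - p n / of_nat n * hop_sign n k T * v T * w S else 0)"
    by (rule sum.cong[OF refl]) (simp only: case_prod_unfold sum.swap[of _ "hops _"])
  also have "\<dots> = (\<Sum>T\<in>F. \<Sum>(n, k)\<in>hops T.
      - p n / of_nat n * hop_sign n k T * v T * w (hop n k T))"
  proof (intro sum.cong refl, clarify)
    fix T n k assume "T \<in> F" "(n, k) \<in> hops T"
    then have "hop n k T \<in> hop_image F" by (force simp: hop_image_def)
    with finite_hop_image(1)[OF assms(1,2)]
    show "(\<Sum>S\<in>hop_image F.
      if S = hop n k T then - p n / of_nat n * hop_sign n k T * v T * w S else 0) =
      - p n / of_nat n * hop_sign n k T * v T * w (hop n k T)"
      by (subst sum.delta) auto
  qed
  also have "\<dots> = (\<Sum>T\<in>F. v T * shift_op (\<lambda>n. - p n / of_nat n) w T)"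
    unfolding shift_op_def sum_distrib_left
    by (intro sum.cong refl) (auto simp: mult_ac)
  finally show "(\<Sum>S\<in>hop_image F. raise_op p v S * w S) = \<dots>" .
qed

lemma raise_op_pow_adjoint:
  assumes "finite F" "F \<subseteq> Collect maya" "{T. v T \<noteq> 0} \<subseteq> F"
  shows "\<exists>G. finite G \<and> {T. (raise_op p ^^ m) v T \<noteq> 0} \<subseteq> G \<and>
    (\<forall>w. (\<Sum>S\<in>G. (raise_op p ^^ m) v S * w S) =
      (\<Sum>T\<in>F. v T * (shift_op (\<lambda>n. - p n / of_nat n) ^^ m) w T))"
  using assms
proof (induction m arbitrary: v F)
  case 0
  then show ?case by auto
next
  case (Suc m)
  note adj = raise_op_adjoint[OF Suc.prems, where p = p]
  from Suc.IH[OF finite_hop_image[OF Suc.prems(1,2)] adj(1)]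
  obtain G where G: "finite G" "{T. (raise_op p ^^ m) (raise_op p v) T \<noteq> 0} \<subseteq> G"
    "\<And>w. (\<Sum>S\<in>G. (raise_op p ^^ m) (raise_op p v) S * w S) =
      (\<Sum>T\<in>hop_image F. raise_op p v T * (shift_op (\<lambda>n. - p n / of_nat n) ^^ m) w T)"
    by blast
  show ?case
    using G(1,2) G(3)[unfolded adj(2)]
    by (intro exI[of _ G]) (simp add: funpow_swap1)
qed

definition ket_of :: "int set \<Rightarrow> ket" where
  "ket_of S = (\<lambda>T. if T = S then 1 else 0)"

lemma vac_eq: "vac = ket_of {0..}"
  by (simp add: vac_def ket_of_def fun_eq_iff)

text \<open>Transposition turns the vacuum coefficient taken by the S-dual bra into a coefficient of
  an iterate applied to the vacuum, so that both pairings become values of the same function. The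
  minus sign is that of \<open>boson\<close>; nothing cancels it here.\<close>

lemma raise_op_pow_vacuum:
  assumes "maya S"
  shows "(raise_op p ^^ m) (ket_of S) {0..} = (shift_op (\<lambda>n. - p n / of_nat n) ^^ m) vac S"
proof -
  obtain G where G: "finite G" "{T. (raise_op p ^^ m) (ket_of S) T \<noteq> 0} \<subseteq> G"
    "\<And>w. (\<Sum>T\<in>G. (raise_op p ^^ m) (ket_of S) T * w T) =
      (\<Sum>T\<in>{S}. ket_of S T * (shift_op (\<lambda>n. - p n / of_nat n) ^^ m) w T)"
  proof -
    have "{T. ket_of S T \<noteq> 0} \<subseteq> {S}" by (auto simp: ket_of_def)
    then show ?thesis using raise_op_pow_adjoint[of "{S}" "ket_of S" m p] assms that by blast
  qed
  have "(\<Sum>T\<in>G. (raise_op p ^^ m) (ket_of S) T * vac T) =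
      (\<Sum>T\<in>G. if T = {0..} then (raise_op p ^^ m) (ket_of S) T else 0)"
    by (intro sum.cong) (auto simp: vac_def)
  also have "\<dots> = (raise_op p ^^ m) (ket_of S) {0..}"
    using G(1,2) by (auto simp: sum.delta)
  finally show ?thesis using G(3)[of vac] by (simp add: ket_of_def)
qed

lemma op_exp_raise_op_vacuum:
  assumes "maya S"
  shows "op_exp (raise_op p) (ket_of S) {0..} = op_exp (shift_op (\<lambda>n. - p n / of_nat n)) vac S"
  by (simp add: op_exp_def raise_op_pow_vacuum[OF assms])

section \<open>Maya diagrams of partitions\<close>

text \<open>Because of the conventions for \<open>\<psi>\<close> and \<open>\<psi>\<close>-dagger, the standard ket of \<open>lam\<close> is the basis
  vector of the shape of the conjugate of \<open>lam\<close>.\<close>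

definition shape :: "nat list \<Rightarrow> int set" where
  "shape lam = range (\<lambda>i. int i - int (part lam (Suc i)))"

section \<open>Parts, conjugation, size and contents of Young diagrams\<close>

lemma part_antimono:
  assumes "is_partition lam" "1 \<le> i" "i \<le> j"
  shows "part lam j \<le> part lam i"
proof (cases "i = j \<or> j > length lam")
  case False
  then have "i - 1 < j - 1" "j - 1 < length lam" using assms by auto
  then have "lam ! (i - 1) \<ge> lam ! (j - 1)"
    using assms(1) sorted_wrt_nth_less[of "(\<ge>)" lam "i - 1" "j - 1"] by (simp add: is_partition_def)
  with False assms show ?thesis by (auto simp: part_def)
qed (auto simp: part_def)

lemma part_pos:
  assumes "is_partition lam" "1 \<le> i" "i \<le> length lam"
  shows "part lam i > 0"
proof -
  have "lam ! (i - 1) \<in> set lam" using assms by auto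
  then have "lam ! (i - 1) \<noteq> 0" using assms(1) unfolding is_partition_def by metis
  with assms show ?thesis by (simp add: part_def)
qed

lemma part_eq_0: "i > length lam \<Longrightarrow> part lam i = 0"
  by (simp add: part_def)

text \<open>Parts decrease, so the rows of length at least \<open>j\<close> form an initial segment,
  in which membership is comparison with the cardinality.\<close>

lemma less_part_iff:
  assumes "is_partition lam" "1 \<le> i" "1 \<le> j"
  shows "j \<le> part lam i \<longleftrightarrow> i \<le> card {k. 1 \<le> k \<and> j \<le> part lam k}"
proof -
  define A where "A = {k. 1 \<le> k \<and> j \<le> part lam k}"
  have sub: "A \<subseteq> {1..length lam}"
  proof
    fix k assume "k \<in> A"
    then show "k \<in> {1..length lam}"
      using assms(3) part_eq_0[of lam k] by (cases "k \<le> length lam") (auto simp: A_def)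
  qed
  then have fin: "finite A" by (rule finite_subset) simp
  show ?thesis
  proof
    assume "j \<le> part lam i"
    then have "k \<in> A" if "k \<in> {1..i}" for k
      using that part_antimono[OF assms(1), of k i] by (auto simp: A_def)
    then have "{1..i} \<subseteq> A" by blast
    then have "card {1..i} \<le> card A" using fin by (rule card_mono[rotated])
    then show "i \<le> card {k. 1 \<le> k \<and> j \<le> part lam k}" by (simp add: A_def)
  next
    assume le: "i \<le> card {k. 1 \<le> k \<and> j \<le> part lam k}"
    show "j \<le> part lam i"
    proof (rule ccontr)
      assume "\<not> j \<le> part lam i"
      then have "k \<in> {1..<i}" if "k \<in> A" for k
        using that part_antimono[OF assms(1,2), of k] by (cases "i \<le> k") (auto simp: A_def)
      then have "A \<subseteq> {1..<i}" by blast
      then have "card A \<le> card {1..<i}" by (rule card_mono[rotated]) simp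
      with le assms(2) show False by (simp add: A_def)
    qed
  qed
qed

text \<open>The case distinction reflects that the list \<open>conjugate lam\<close> ends at
  \<open>part lam 1\<close>; for a partition the cardinality is 0 beyond.\<close>

lemma part_conjugate_card:
  assumes "1 \<le> j"
  shows "part (conjugate lam) j = (if j \<le> part lam 1 then card {k. 1 \<le> k \<and> j \<le> part lam k} else 0)"
proof (cases "j \<le> part lam 1")
  case True
  have "length (conjugate lam) = part lam 1" by (simp add: conjugate_def)
  moreover have "conjugate lam ! (j - 1) = length (filter (\<lambda>x. j \<le> x) lam)"
  proof -
    have "[1..<Suc (part lam 1)] ! (j - 1) = j"
      using assms True nth_upt[of 1 "j - 1" "Suc (part lam 1)"] by simp
    moreover have "j - 1 < length [1..<Suc (part lam 1)]"
      using assms True unfolding length_upt by linarith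
    ultimately show ?thesis unfolding conjugate_def by (simp only: nth_map)
  qed
  ultimately have "part (conjugate lam) j = length (filter (\<lambda>x. j \<le> x) lam)"
    unfolding part_def[of "conjugate lam"] using assms True by presburger
  also have "\<dots> = card {i. i < length lam \<and> j \<le> lam ! i}"
    by (rule length_filter_conv_card)
  also have "\<dots> = card (Suc ` {i. i < length lam \<and> j \<le> lam ! i})"
    by (simp add: card_image)
  also have "Suc ` {i. i < length lam \<and> j \<le> lam ! i} = {k. 1 \<le> k \<and> j \<le> part lam k}"
  proof (intro equalityI subsetI)
    fix k assume k: "k \<in> {k. 1 \<le> k \<and> j \<le> part lam k}"
    have "k \<le> length lam"
      using k assms part_eq_0[of lam k] by (cases "k \<le> length lam") (simp_all add: not_le)
    with k have "k - 1 \<in> {i. i < length lam \<and> j \<le> lam ! i}" "k = Suc (k - 1)"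
      by (auto simp: part_def)
    then show "k \<in> Suc ` {i. i < length lam \<and> j \<le> lam ! i}" by blast
  next
    fix k assume "k \<in> Suc ` {i. i < length lam \<and> j \<le> lam ! i}"
    then obtain i where "k = Suc i" "i < length lam" "j \<le> lam ! i" by blast
    then show "k \<in> {k. 1 \<le> k \<and> j \<le> part lam k}" by (simp add: part_def)
  qed
  finally show ?thesis using True by simp
next
  case False
  have "length (conjugate lam) = part lam 1" by (simp add: conjugate_def)
  with False show ?thesis using part_eq_0[of "conjugate lam" j] by simp
qed

lemma le_part_conjugate_iff:
  assumes "is_partition lam" "1 \<le> i" "1 \<le> j"
  shows "i \<le> part (conjugate lam) j \<longleftrightarrow> j \<le> part lam i"
proof (cases "j \<le> part lam 1")
  case True
  then show ?thesis using less_part_iff[OF assms] part_conjugate_card[OF assms(3), of lam] by simp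
next
  case False
  then show ?thesis
    using part_antimono[OF assms(1) _ assms(2)] assms part_conjugate_card[OF assms(3), of lam] by simp
qed

lemma is_partition_conjugate:
  assumes "is_partition lam"
  shows "is_partition (conjugate lam)"
proof -
  have len: "length (conjugate lam) = part lam 1" by (simp add: conjugate_def)
  have nth: "conjugate lam ! i = part (conjugate lam) (Suc i)" if "i < part lam 1" for i
    using that by (simp add: part_def len)
  have "conjugate lam ! i \<ge> conjugate lam ! j" if "i < j" "j < part lam 1" for i j
  proof (cases "conjugate lam ! j")
    case (Suc n)
    then have "Suc j \<le> part lam (conjugate lam ! j)"
      using le_part_conjugate_iff[OF assms, of "conjugate lam ! j" "Suc j"] nth[OF that(2)] by simp
    then have "conjugate lam ! j \<le> part (conjugate lam) (Suc i)"
      using le_part_conjugate_iff[OF assms, of "conjugate lam ! j" "Suc i"] Suc that by simp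
    then show ?thesis using nth[of i] that by simp
  qed simp
  moreover have "conjugate lam ! i \<noteq> 0" if "i < part lam 1" for i
    using le_part_conjugate_iff[OF assms, of 1 "Suc i"] nth[OF that] that by simp
  ultimately show ?thesis
    unfolding is_partition_def sorted_wrt_iff_nth_less by (auto simp: len in_set_conv_nth)
qed

lemma partition_eqI:
  assumes "is_partition lam" "is_partition mu" "\<And>i. 1 \<le> i \<Longrightarrow> part lam i = part mu i"
  shows "lam = mu"
proof -
  have "length lam \<le> length mu" if "is_partition lam" "\<And>i. 1 \<le> i \<Longrightarrow> part lam i = part mu i" for lam mu
  proof (cases "length lam = 0")
    case False
    then have "part mu (length lam) > 0" using part_pos[OF that(1), of "length lam"] that(2)[of "length lam"]
      by (simp add: Suc_le_eq)
    then show ?thesis using part_eq_0[of mu "length lam"] by (cases "length lam \<le> length mu") auto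
  qed simp
  from this[OF assms(1,3)] this[of mu lam] assms have len: "length lam = length mu"
    by (simp add: le_antisym)
  show ?thesis
  proof (rule nth_equalityI[OF len])
    fix i assume "i < length lam"
    then show "lam ! i = mu ! i" using assms(3)[of "Suc i"] len by (simp add: part_def)
  qed
qed

lemma conjugate_conjugate:
  assumes "is_partition lam"
  shows "conjugate (conjugate lam) = lam"
proof (rule partition_eqI)
  fix i :: nat assume i: "1 \<le> i"
  have "j \<le> part (conjugate (conjugate lam)) i \<longleftrightarrow> j \<le> part lam i" if "1 \<le> j" for j
    using i that le_part_conjugate_iff[OF is_partition_conjugate[OF assms]] le_part_conjugate_iff[OF assms] by simp
  then have "j \<le> part (conjugate (conjugate lam)) i \<longleftrightarrow> j \<le> part lam i" for j
    by (cases j) auto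
  then show "part (conjugate (conjugate lam)) i = part lam i"
    by (metis le_antisym order_refl)
qed (rule is_partition_conjugate[OF is_partition_conjugate[OF assms]], rule assms)

definition boxes :: "nat list \<Rightarrow> (nat \<times> nat) set" where
  "boxes lam = {(i, j). 1 \<le> i \<and> 1 \<le> j \<and> j \<le> part lam i}"

lemma boxes_Sigma: "boxes lam = (SIGMA i:{1..length lam}. {1..part lam i})"
proof -
  have "i \<le> length lam" if "1 \<le> j" "j \<le> part lam i" for i j
    using that part_eq_0[of lam i] by (cases "i \<le> length lam") (simp_all add: not_le)
  then show ?thesis by (auto simp: boxes_def)
qed

lemma sum_boxes: "(\<Sum>(i, j)\<in>boxes lam. f i j) = (\<Sum>i=1..length lam. \<Sum>j=1..part lam i. f i j)"
  unfolding boxes_Sigma by (rule sum.Sigma[symmetric]) auto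

lemma sum_boxes_conjugate:
  assumes "is_partition lam"
  shows "(\<Sum>(i, j)\<in>boxes (conjugate lam). f i j) = (\<Sum>(i, j)\<in>boxes lam. f j i)"
proof -
  have "boxes (conjugate lam) = prod.swap ` boxes lam"
    using le_part_conjugate_iff[OF assms] by (auto simp: boxes_def image_iff)
  then show ?thesis
    by (simp add: sum.reindex case_prod_unfold)
qed

lemma psize_sum: "psize lam = (\<Sum>i=1..length lam. part lam i)"
proof -
  have "sum_list lam = (\<Sum>i = 0..<length lam. lam ! i)" by (rule sum_list_sum_nth)
  also have "\<dots> = (\<Sum>i=1..length lam. part lam i)"
    by (rule sum.reindex_bij_witness[of _ "\<lambda>i. i - 1" Suc]) (auto simp: part_def)
  finally show ?thesis by (simp add: psize_def)
qed

lemma psize_boxes: "psize lam = (\<Sum>(i, j)\<in>boxes lam. 1)"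
  unfolding sum_boxes psize_sum by simp

lemma psize_conjugate: "is_partition lam \<Longrightarrow> psize (conjugate lam) = psize lam"
  using sum_boxes_conjugate[of lam "\<lambda>_ _. 1 :: nat"] by (simp add: psize_boxes)

text \<open>In row \<open>i\<close> the contents \<open>j - i\<close> form an arithmetic progression
  whose doubled sum is the summand of \<open>kappa\<close>. Transposition negates contents, hence
  also \<open>kappa\<close>.\<close>

lemma kappa_boxes: "kappa lam = 2 * (\<Sum>(i, j)\<in>boxes lam. int j - int i)"
proof -
  have "2 * (\<Sum>j=1..n. int j - int i) = int n * (int n - 2 * int i + 1)" for n i
    by (induction n) (auto simp: algebra_simps)
  then show ?thesis
    unfolding kappa_def sum_boxes sum_distrib_left by simp
qed

lemma kappa_conjugate:
  assumes "is_partition lam"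
  shows "kappa (conjugate lam) = - kappa lam"
proof -
  have "(\<Sum>(i, j)\<in>boxes (conjugate lam). int j - int i) = - (\<Sum>(i, j)\<in>boxes lam. int j - int i)"
    using sum_boxes_conjugate[OF assms, of "\<lambda>i j. int j - int i"]
    by (simp add: sum_negf[symmetric] case_prod_unfold)
  then show ?thesis by (simp add: kappa_boxes)
qed

lemma shape_strict_mono:
  assumes "is_partition lam" "i < j"
  shows "int i - int (part lam (Suc i)) < int j - int (part lam (Suc j))"
  using part_antimono[OF assms(1), of "Suc i" "Suc j"] assms(2) by simp

text \<open>The shape records one kind of step on the boundary path of the diagram and its
  complement the other kind; transposition exchanges them. For \<open>disj\<close>: either
  \<open>Suc j \<le> part lam (Suc i)\<close> and
  \<open>Suc i \<le> part (conjugate lam) (Suc j)\<close> hold together or both fail, so the sum of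
  these two parts is at least \<open>i + j + 2\<close> or at most \<open>i + j\<close>.\<close>

lemma shape_conjugate:
  assumes "is_partition lam"
  shows "shape (conjugate lam) = {- 1 - k | k. k \<notin> shape lam}"
proof -
  have disj: "int j - int (part (conjugate lam) (Suc j)) \<noteq> - 1 - (int i - int (part lam (Suc i)))" for i j
  proof
    assume "int j - int (part (conjugate lam) (Suc j)) = - 1 - (int i - int (part lam (Suc i)))"
    then have eq: "i + j + 1 = part lam (Suc i) + part (conjugate lam) (Suc j)" by simp
    have "Suc i \<le> part (conjugate lam) (Suc j) \<longleftrightarrow> Suc j \<le> part lam (Suc i)"
      by (rule le_part_conjugate_iff[OF assms]) auto
    with eq show False by linarith
  qed
  have cover: "k \<in> shape lam \<or> - 1 - k \<in> shape (conjugate lam)" for k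
  proof -
    define A where "A = {i. int i - int (part lam (Suc i)) \<ge> k}"
    have "nat \<bar>k\<bar> + length lam \<in> A" using part_eq_0[of lam] by (auto simp: A_def)
    define i where "i = (LEAST i. i \<in> A)"
    have iA: "i \<in> A" unfolding i_def by (rule LeastI) fact
    have below: "i' \<notin> A" if "i' < i" for i' using that unfolding i_def by (rule not_less_Least)
    show ?thesis
    proof (cases "k \<in> shape lam")
      case False
      with iA have gt: "int i - int (part lam (Suc i)) > k"
        by (auto simp: A_def shape_def order.strict_iff_order)
      \<comment> \<open>Exactly \<open>i\<close> elements of the shape lie below \<open>k\<close>.
        The goal \<open>- 1 - k = int j - int i\<close> forces the value of \<open>j\<close>; it
        remains to see that column \<open>Suc j\<close> has height \<open>i\<close>.\<close>
      define j where "j = nat (int i - 1 - k)"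
      have j: "int j = int i - 1 - k"
      proof -
        have "k < int i" using gt by simp
        then show ?thesis by (simp add: j_def)
      qed
      have "\<not> Suc j \<le> part lam (Suc i)" using gt j by linarith
      then have "\<not> Suc i \<le> part (conjugate lam) (Suc j)"
        using le_part_conjugate_iff[OF assms] by simp
      moreover have "i \<le> part (conjugate lam) (Suc j)"
      proof (cases i)
        case (Suc i')
        then have "int i' - int (part lam (Suc i')) < k" using below[of i'] by (simp add: A_def)
        then have "Suc j \<le> part lam i" unfolding Suc using j Suc by linarith
        then show ?thesis using le_part_conjugate_iff[OF assms, of i "Suc j"] Suc by simp
      qed simp
      ultimately have "part (conjugate lam) (Suc j) = i" by simp
      then have "- 1 - k = int j - int (part (conjugate lam) (Suc j))" using j by simp
      then show ?thesis unfolding shape_def by blast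
    qed simp
  qed
  show ?thesis
  proof (intro equalityI subsetI)
    fix x assume "x \<in> shape (conjugate lam)"
    then obtain j where "x = int j - int (part (conjugate lam) (Suc j))" by (auto simp: shape_def)
    then have "- 1 - x \<noteq> int i - int (part lam (Suc i))" for i using disj[of j i] by linarith
    then have "- 1 - x \<notin> shape lam" by (auto simp: shape_def)
    then show "x \<in> {- 1 - k | k. k \<notin> shape lam}" by (auto intro!: exI[of _ "- 1 - x"])
  next
    fix x assume "x \<in> {- 1 - k | k. k \<notin> shape lam}"
    then obtain k where "x = - 1 - k" "k \<notin> shape lam" by auto
    then show "x \<in> shape (conjugate lam)" using cover[of k] by simp
  qed
qed

section \<open>Jacobi--Trudi determinants\<close>

text \<open>With constant term 0 the power \<open>k\<close> starts in degree \<open>k\<close>, so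
  every coefficient of the exponential is a finite sum.\<close>

definition gen_fps :: "(nat \<Rightarrow> complex) \<Rightarrow> complex fps" where
  "gen_fps t = Abs_fps (\<lambda>n. if n = 0 then 0 else t n)"

text \<open>The coefficient of \<open>z ^ m\<close> in \<open>exp (\<tau> * (\<Sum>n>0. t n * z ^ n))\<close>, as a polynomial
  in \<open>\<tau>\<close>.\<close>

definition h_poly :: "(nat \<Rightarrow> complex) \<Rightarrow> int \<Rightarrow> complex poly" where
  "h_poly t m = (if m < 0 then 0
     else \<Sum>k\<le>nat m. monom (fps_nth (gen_fps t ^ k) (nat m) / fact k) k)"

definition jt :: "nat \<Rightarrow> (nat \<Rightarrow> complex) \<Rightarrow> (nat \<Rightarrow> int) \<Rightarrow> complex poly" where
  "jt N t s = ndet N (\<lambda>i j. h_poly t (int j - s i))"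

section \<open>The differential equation in \<tau>\<close>

lemma gen_fps_power_nth_eq_0: "m < k \<Longrightarrow> fps_nth (gen_fps t ^ k) m = 0"
  by (rule startsby_zero_power_prefix[rule_format]) (simp_all add: gen_fps_def)

lemma coeff_h_poly:
  "coeff (h_poly t m) k = (if m < 0 then 0 else fps_nth (gen_fps t ^ k) (nat m) / fact k)"
proof -
  have "coeff (\<Sum>k\<le>n. monom (fps_nth (gen_fps t ^ k) n / fact k) k) k =
      fps_nth (gen_fps t ^ k) n / fact k" for n
    by (cases "k \<le> n") (simp_all add: coeff_sum coeff_monom sum.delta gen_fps_power_nth_eq_0)
  then show ?thesis by (simp add: h_poly_def)
qed

lemma h_poly_neg [simp]: "m < 0 \<Longrightarrow> h_poly t m = 0"
  by (simp add: h_poly_def)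

text \<open>Differentiating the exponential of \<tau> times \<open>gen_fps t\<close> multiplies it
  by \<open>gen_fps t\<close>. The terms with \<open>n > m\<close> vanish, so every bound
  \<open>B\<close> from \<open>m\<close> on gives the same sum.\<close>

lemma pderiv_h_poly:
  assumes "m \<le> int B"
  shows "pderiv (h_poly t m) = (\<Sum>n=1..B. Polynomial.smult (t n) (h_poly t (m - int n)))"
proof (rule poly_eqI)
  fix k
  show "coeff (pderiv (h_poly t m)) k = coeff (\<Sum>n=1..B. Polynomial.smult (t n) (h_poly t (m - int n))) k"
  proof (cases "m < 0")
    case False
    define M where "M = nat m"
    have m: "m = int M" and "M \<le> B" using False assms by (auto simp: M_def)
    have "coeff (pderiv (h_poly t m)) k = of_nat (Suc k) * (fps_nth (gen_fps t ^ Suc k) M / fact (Suc k))"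
      by (simp add: coeff_pderiv coeff_h_poly m)
    also have "\<dots> = fps_nth (gen_fps t * gen_fps t ^ k) M / fact k"
      by (simp add: field_simps del: of_nat_Suc)
    also have "fps_nth (gen_fps t * gen_fps t ^ k) M =
        (\<Sum>n=0..M. (if n = 0 then 0 else t n) * fps_nth (gen_fps t ^ k) (M - n))"
      by (simp add: fps_mult_nth gen_fps_def)
    also have "\<dots> = (\<Sum>n=1..B. if n \<le> M then t n * fps_nth (gen_fps t ^ k) (M - n) else 0)"
      by (rule sum.mono_neutral_cong) (use \<open>M \<le> B\<close> in auto)
    also have "\<dots> / fact k = (\<Sum>n=1..B. t n * coeff (h_poly t (m - int n)) k)"
      unfolding sum_divide_distrib
      by (rule sum.cong) (auto simp: coeff_h_poly m nat_diff_distrib)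
    finally show ?thesis by (simp add: coeff_sum)
  qed (simp add: coeff_sum)
qed

lemma pderiv_ndet:
  fixes f :: "nat \<Rightarrow> nat \<Rightarrow> complex poly"
  shows "pderiv (ndet N f) = (\<Sum>i<N. ndet N (f(i := \<lambda>j. pderiv (f i j))))"
proof -
  have pd: "pderiv (of_int c * P) = of_int c * pderiv P" for c and P :: "complex poly"
    by (simp add: of_int_poly pderiv_smult)
  have psum: "pderiv (sum g A) = (\<Sum>p\<in>A. pderiv (g p))" for g :: "'z \<Rightarrow> complex poly" and A
    by (induction A rule: infinite_finite_induct) (simp_all add: pderiv_add)
  have pp: "pderiv (\<Prod>i = 0..<N. f i (p i)) =
      (\<Sum>i<N. \<Prod>i' = 0..<N. (f(i := \<lambda>j. pderiv (f i j))) i' (p i'))" for p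
    unfolding pderiv_prod lessThan_atLeast0
  proof (rule sum.cong[OF refl])
    fix i assume "i \<in> {0..<N}"
    then have "(\<Prod>i' = 0..<N. (f(i := \<lambda>j. pderiv (f i j))) i' (p i')) =
        pderiv (f i (p i)) * (\<Prod>i'\<in>{0..<N} - {i}. (f(i := \<lambda>j. pderiv (f i j))) i' (p i'))"
      by (subst prod.remove[of _ i]) auto
    also have "(\<Prod>i'\<in>{0..<N} - {i}. (f(i := \<lambda>j. pderiv (f i j))) i' (p i')) =
        (\<Prod>i'\<in>{0..<N} - {i}. f i' (p i'))"
      by (rule prod.cong) auto
    finally show "(\<Prod>a\<in>{0..<N} - {i}. f a (p a)) * pderiv (f i (p i)) =
        (\<Prod>i' = 0..<N. (f(i := \<lambda>j. pderiv (f i j))) i' (p i'))" by simp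
  qed
  have "pderiv (ndet N f) = (\<Sum>p | p permutes {0..<N}. of_int (sign p) *
      (\<Sum>i<N. \<Prod>i' = 0..<N. (f(i := \<lambda>j. pderiv (f i j))) i' (p i')))"
    unfolding ndet_leibniz psum pd pp ..
  also have "\<dots> = (\<Sum>i<N. ndet N (f(i := \<lambda>j. pderiv (f i j))))"
    unfolding ndet_leibniz sum_distrib_left by (rule sum.swap)
  finally show ?thesis .
qed

lemma ndet_row_sum:
  fixes f :: "nat \<Rightarrow> nat \<Rightarrow> 'a :: comm_ring_1"
  assumes "i < N" "finite A"
  shows "ndet N (f(i := \<lambda>j. \<Sum>n\<in>A. c n * g n j)) = (\<Sum>n\<in>A. c n * ndet N (f(i := g n)))"
proof -
  have pr: "(\<Prod>i' = 0..<N. (f(i := r)) i' (p i')) = r (p i) * (\<Prod>i'\<in>{0..<N} - {i}. f i' (p i'))" for p r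
  proof -
    have "(\<Prod>i' = 0..<N. (f(i := r)) i' (p i')) = r (p i) * (\<Prod>i'\<in>{0..<N} - {i}. (f(i := r)) i' (p i'))"
      using assms(1) by (subst prod.remove[of _ i]) auto
    also have "(\<Prod>i'\<in>{0..<N} - {i}. (f(i := r)) i' (p i')) = (\<Prod>i'\<in>{0..<N} - {i}. f i' (p i'))"
      by (rule prod.cong) auto
    finally show ?thesis .
  qed
  have "ndet N (f(i := \<lambda>j. \<Sum>n\<in>A. c n * g n j)) =
    (\<Sum>p | p permutes {0..<N}. \<Sum>n\<in>A. c n * (of_int (sign p) * (g n (p i) * (\<Prod>i'\<in>{0..<N} - {i}. f i' (p i')))))"
    unfolding ndet_leibniz pr sum_distrib_left sum_distrib_right by (simp add: mult_ac)
  also have "\<dots> = (\<Sum>n\<in>A. c n * ndet N (f(i := g n)))"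
    unfolding ndet_leibniz pr sum_distrib_left by (rule sum.swap)
  finally show ?thesis .
qed

lemma pderiv_jt:
  assumes "\<And>i j. i < N \<Longrightarrow> j < N \<Longrightarrow> int j - s i \<le> int B"
  shows "pderiv (jt N t s) = (\<Sum>i<N. \<Sum>n=1..B. Polynomial.smult (t n) (jt N t (s(i := s i + int n))))"
proof -
  have "ndet N ((\<lambda>i j. h_poly t (int j - s i))(i := \<lambda>j. pderiv (h_poly t (int j - s i)))) =
      (\<Sum>n=1..B. Polynomial.smult (t n) (jt N t (s(i := s i + int n))))" if "i < N" for i
  proof -
    have "ndet N ((\<lambda>i j. h_poly t (int j - s i))(i := \<lambda>j. pderiv (h_poly t (int j - s i)))) =
      ndet N ((\<lambda>i j. h_poly t (int j - s i))(i := \<lambda>j. \<Sum>n=1..B. [:t n:] * h_poly t (int j - s i - int n)))"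
      using assms[OF that] by (intro ndet_cong) (auto simp: pderiv_h_poly[where B = B])
    also have "\<dots> = (\<Sum>n=1..B. [:t n:] *
        ndet N ((\<lambda>i j. h_poly t (int j - s i))(i := \<lambda>j. h_poly t (int j - s i - int n))))"
      by (rule ndet_row_sum[OF that]) simp
    also have "\<dots> = (\<Sum>n=1..B. Polynomial.smult (t n) (jt N t (s(i := s i + int n))))"
      unfolding jt_def
      by (intro sum.cong refl) (auto intro!: arg_cong[where f = "Polynomial.smult _"] ndet_cong simp: algebra_simps)
    finally show ?thesis .
  qed
  then show ?thesis unfolding jt_def pderiv_ndet by simp
qed

text \<open>The sign of the permutation that sorts the first \<open>N\<close> entries, and 0 if a
  value repeats. Written with differences, it can be followed pair by pair when one entry
  changes.\<close>

definition perm_sgn :: "nat \<Rightarrow> (nat \<Rightarrow> int) \<Rightarrow> int" where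
  "perm_sgn N s = (\<Prod>j<N. \<Prod>k<j. sgn (s j - s k))"

lemma perm_sgn_eq_sgn: "perm_sgn N s = sgn (\<Prod>j<N. \<Prod>k<j. s j - s k)"
proof -
  have "sgn (prod f A) = (\<Prod>x\<in>A. sgn (f x))" for f :: "nat \<Rightarrow> int" and A
    by (induction A rule: infinite_finite_induct) (simp_all add: sgn_mult)
  then show ?thesis by (simp add: perm_sgn_def)
qed

lemma perm_sgn_strict_mono:
  assumes "\<And>i j. i < j \<Longrightarrow> j < N \<Longrightarrow> s i < s j"
  shows "perm_sgn N s = 1"
  unfolding perm_sgn_def by (intro prod.neutral ballI) (use assms in auto)

text \<open>Permuting the rows of the Vandermonde matrix of 0, ..., \<open>N - 1\<close> multiplies
  its determinant, which is positive, by the sign of \<open>p\<close>.\<close>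

lemma perm_sgn_permutation:
  assumes "p permutes {0..<N}"
  shows "perm_sgn N (\<lambda>i. int (p i)) = sign p"
proof -
  have "(\<Prod>j<N. \<Prod>k<j. int (p j) - int (p k)) = sign p * (\<Prod>j<N. \<Prod>k<j. int j - int k)"
    using ndet_permute_rows[OF assms, of "\<lambda>i j. int i ^ j"] vandermonde[of N "\<lambda>i. int (p i)"]
      vandermonde[of N int] by simp
  moreover have "(\<Prod>j<N. \<Prod>k<j. int j - int k) > 0" by (intro prod_pos ballI) auto
  ultimately show ?thesis
    unfolding perm_sgn_eq_sgn by (simp add: sgn_mult sign_def)
qed

text \<open>Only factors that involve \<open>i\<close> can change, and the one with index
  \<open>a\<close> does so exactly if \<open>s a\<close> is passed over; \<open>e a\<close> records
  this. Multiplication by the old sign, which is 1 or -1, takes the place of division.\<close>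

lemma perm_sgn_update:
  assumes "inj_on s {..<N}" "i < N" "n > 0" "\<And>j. j < N \<Longrightarrow> s j \<noteq> s i + n"
  shows "perm_sgn N (s(i := s i + n)) * perm_sgn N s = (-1) ^ card {j. j < N \<and> s i < s j \<and> s j < s i + n}"
proof -
  define e where "e a = (if s i < s a \<and> s a < s i + n then -1 else (1 :: int))" for a
  define s' where "s' = s(i := s i + n)"
  have ee: "sgn (s i + n - s a) * sgn (s i - s a) = e a" "sgn (s a - (s i + n)) * sgn (s a - s i) = e a"
    if "a < N" "a \<noteq> i" for a
  proof -
    have "s a \<noteq> s i" using assms(1,2) that by (auto dest: inj_onD)
    then show "sgn (s i + n - s a) * sgn (s i - s a) = e a" "sgn (s a - (s i + n)) * sgn (s a - s i) = e a"
      using assms(3) assms(4)[OF that(1)] by (auto simp: e_def sgn_if)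
  qed
  have pair: "sgn (s' j - s' k) * sgn (s j - s k) = (if j = i then e k else if k = i then e j else 1)"
    if "k < j" "j < N" for j k
  proof -
    have "s j \<noteq> s k" using assms(1) that by (auto dest: inj_onD)
    then show ?thesis using that ee[of j] ee[of k] by (auto simp: s'_def sgn_if)
  qed
  have "perm_sgn N s' * perm_sgn N s =
      (\<Prod>j<N. \<Prod>k<j. if j = i then e k else if k = i then e j else 1)"
    unfolding perm_sgn_def prod.distrib[symmetric] by (intro prod.cong refl) (use pair in auto)
  also have "\<dots> = (\<Prod>j<N. if j = i then (\<Prod>k<i. e k) else if i < j then e j else 1)"
  proof (intro prod.cong refl)
    fix j show "(\<Prod>k<j. if j = i then e k else if k = i then e j else 1) =
        (if j = i then (\<Prod>k<i. e k) else if i < j then e j else 1)"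
      by (cases "j = i") (simp_all add: prod.delta)
  qed
  also have "\<dots> = (\<Prod>k<i. e k) * (\<Prod>j\<in>{..<N} - {i}. if i < j then e j else 1)"
    using assms(2) by (subst prod.remove[of _ i]) auto
  also have "(\<Prod>j\<in>{..<N} - {i}. if i < j then e j else 1) = (\<Prod>j\<in>{i<..<N}. e j)"
    by (rule prod.mono_neutral_cong_right) (use assms(2) in auto)
  also have "(\<Prod>k<i. e k) * (\<Prod>j\<in>{i<..<N}. e j) = (\<Prod>j\<in>{..<i} \<union> {i<..<N}. e j)"
    by (rule prod.union_disjoint[symmetric]) auto
  also have "\<dots> = (\<Prod>j\<in>{j. j < N \<and> s i < s j \<and> s j < s i + n}. -1)"
  proof (rule prod.mono_neutral_cong_right)
    show "{j. j < N \<and> s i < s j \<and> s j < s i + n} \<subseteq> {..<i} \<union> {i<..<N}"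
    proof
      fix x assume "x \<in> {j. j < N \<and> s i < s j \<and> s j < s i + n}"
      then show "x \<in> {..<i} \<union> {i<..<N}" by (cases x i rule: linorder_cases) simp_all
    qed
  qed (use assms(2) in \<open>auto simp: e_def\<close>)
  finally show ?thesis unfolding s'_def by (simp only: prod_constant)
qed


text \<open>The Maya diagram whose modes below \<open>N\<close> are listed by \<open>s\<close> in
  any order. Order is left open because a move changes one entry in place.\<close>

definition window :: "nat \<Rightarrow> (nat \<Rightarrow> int) \<Rightarrow> int set" where
  "window N s = s ` {..<N} \<union> {int N..}"

lemma window_update:
  assumes "inj_on s {..<N}" "i < N" "s i < int N" "s i + int n < int N"
  shows "window N (s(i := s i + int n)) = hop n (s i) (window N s)"
proof -
  have "(s(i := s i + int n)) ` {..<N} = insert (s i + int n) (s ` ({..<N} - {i}))"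
    using assms(2) by auto
  also have "s ` ({..<N} - {i}) = s ` {..<N} - {s i}"
    using assms(1,2) by (auto dest: inj_onD)
  finally show ?thesis using assms(3) by (auto simp: window_def hop_def)
qed

lemma coeff_0_ndet: "coeff (ndet N f) 0 = ndet N (\<lambda>i j. coeff (f i j) 0 :: complex)"
proof -
  have "poly (of_int c) 0 = (of_int c :: complex)" for c by (simp add: of_int_poly)
  then show ?thesis
    unfolding ndet_leibniz poly_0_coeff_0[symmetric] by (simp add: poly_sum poly_prod)
qed

text \<open>At \<tau> = 0 only \<open>h_poly t 0\<close> survives, with value 1. Distinct values
  below \<open>N\<close> are either all nonnegative, and then they permute 0, ...,
  \<open>N - 1\<close> and the window is the vacuum, or one of them is negative and its row
  vanishes.\<close>

lemma coeff_0_jt: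
  assumes "inj_on s {..<N}" "\<And>i. i < N \<Longrightarrow> s i < int N"
  shows "coeff (jt N t s) 0 = of_int (perm_sgn N s) * vac (window N s)"
proof -
  define d where "d i j = (if int j = s i then 1 else 0 :: complex)" for i j :: nat
  have "coeff (jt N t s) 0 = ndet N d"
    unfolding jt_def coeff_0_ndet
    by (rule ndet_cong) (auto simp: coeff_h_poly d_def nat_eq_iff2)
  also have "\<dots> = of_int (perm_sgn N s) * vac (window N s)"
  proof (cases "\<forall>i<N. 0 \<le> s i")
    case True
    define p where "p i = (if i < N then nat (s i) else i)" for i
    have sp: "s i = int (p i)" if "i < N" for i using True that by (simp add: p_def)
    have "inj_on p {0..<N}" 
    proof (rule inj_onI)
      fix x y assume "x \<in> {0..<N}" "y \<in> {0..<N}" "p x = p y"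
      then have "s x = s y" "x < N" "y < N" by (simp_all add: sp)
      then show "x = y" using assms(1) by (auto dest: inj_onD)
    qed
    moreover have "p i \<in> {0..<N}" if "i \<in> {0..<N}" for i
      using that assms(2)[of i] sp[of i] by simp
    then have "p ` {0..<N} \<subseteq> {0..<N}" by blast
    ultimately have "bij_betw p {0..<N} {0..<N}"
      using endo_inj_surj[of "{0..<N}" p] by (auto simp: bij_betw_def)
    then have p: "p permutes {0..<N}" by (rule bij_imp_permutes) (simp add: p_def)
    have "ndet N d = ndet N (\<lambda>i. (\<lambda>i j. if j = i then 1 else 0) (p i))"
      by (rule ndet_cong) (auto simp: d_def sp)
    also have "\<dots> = of_int (sign p) * ndet N (\<lambda>i j. if j = i then 1 else 0)"
      by (rule ndet_permute_rows[OF p])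
    also have "ndet N (\<lambda>i j. if j = i then 1 else 0) = (1 :: complex)"
      by (subst ndet_upper_triangular) auto
    also have "sign p = perm_sgn N (\<lambda>i. int (p i))" by (simp add: perm_sgn_permutation[OF p])
    also have "perm_sgn N (\<lambda>i. int (p i)) = perm_sgn N s"
      unfolding perm_sgn_def by (intro prod.cong refl) (auto simp: sp)
    finally have "ndet N d = of_int (perm_sgn N s)" by simp
    moreover have "window N s = {0..}"
    proof -
      have "s ` {..<N} = int ` p ` {0..<N}" using sp by (auto simp: image_iff lessThan_atLeast0)
      also have "\<dots> = int ` {0..<N}" using permutes_image[OF p] by simp
      also have "\<dots> = {0..<int N}" by (rule image_int_atLeastLessThan[of 0, simplified])
      finally show ?thesis by (auto simp: window_def)
    qed
    ultimately show ?thesis by (simp add: vac_def)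
  next
    case False
    then obtain i where i: "i < N" "s i < 0" by force
    then have "s i \<in> window N s" "s i \<notin> {0..}" by (auto simp: window_def)
    then have "window N s \<noteq> {0..}" by metis
    moreover have "ndet N d = 0" by (rule ndet_zero_row[OF i(1)]) (use i(2) in \<open>auto simp: d_def\<close>)
    ultimately show ?thesis by (simp add: vac_def)
  qed
  finally show ?thesis .
qed

text \<open>The determinant satisfies the differential equation \<open>\<partial>D\<^sub>s/\<partial>\<tau> = \<Sum> t n D\<^sub>s\<^sub>'\<close>, the sum over
  all ways to increase one entry by \<open>n\<close>; after sorting, this is the action of the shift operator.\<close>

lemma coeff_jt:
  assumes "inj_on s {..<N}" "\<And>i. i < N \<Longrightarrow> s i < int N"
  shows "coeff (jt N t s) k * fact k =
    of_int (perm_sgn N s) * (shift_op t ^^ k) vac (window N s)"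
  using assms
proof (induction k arbitrary: s)
  case 0
  then show ?case by (simp add: coeff_0_jt)
next
  case (Suc k)
  note inj = Suc.prems(1) and bound = Suc.prems(2)
  define B where "B = nat (int N + (\<Sum>i<N. \<bar>s i\<bar>))"
  have B: "int j - s i \<le> int B" if "i < N" "j < N" for i j
  proof -
    have "\<bar>s i\<bar> \<le> (\<Sum>i<N. \<bar>s i\<bar>)" using that by (intro member_le_sum) auto
    then show ?thesis using that by (simp add: B_def)
  qed
  let ?S = "window N s"
  let ?w = "(shift_op t ^^ k) vac"
  let ?up = "\<lambda>i n. s(i := s i + int n)"
  \<comment> \<open>Forbidden moves contribute nothing: beyond \<open>N\<close> all indices in the
    row are negative, and an occupied position produces two equal rows.\<close>
  have jt0: "jt N t (?up i n) = 0" if "i < N" "1 \<le> n" "s i + int n \<in> ?S" for i n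
  proof (cases "s i + int n \<ge> int N")
    case True
    show ?thesis unfolding jt_def by (rule ndet_zero_row[OF that(1)]) (use True in simp)
  next
    case False
    with that(3) obtain j where j: "j < N" "s j = s i + int n" by (auto simp: window_def)
    then have "j \<noteq> i" using that(2) by auto
    with j show ?thesis
      unfolding jt_def by (intro ndet_identical_rows[OF that(1) j(1)]) auto
  qed
  have jt1: "coeff (jt N t (?up i n)) k * fact k =
      of_int (perm_sgn N s) * (hop_sign n (s i) ?S * ?w (hop n (s i) ?S))"
    if i: "i < N" and n: "1 \<le> n" and notin: "s i + int n \<notin> ?S" for i n
  proof -
    have lt: "s i + int n < int N" and ne: "\<And>j. j < N \<Longrightarrow> s j \<noteq> s i + int n"
    proof -
      show "s i + int n < int N" using notin by (auto simp: window_def)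
      show "s j \<noteq> s i + int n" if "j < N" for j
      proof
        assume "s j = s i + int n"
        then have "s i + int n \<in> s ` {..<N}" using that by (metis imageI lessThan_iff)
        with notin show False by (simp add: window_def)
      qed
    qed
    have inj': "inj_on (?up i n) {..<N}"
      using inj ne by (intro inj_on_fun_updI) force+
    have "coeff (jt N t (?up i n)) k * fact k = of_int (perm_sgn N (?up i n)) * ?w (window N (?up i n))"
      by (rule Suc.IH[OF inj']) (use bound lt in auto)
    also have "window N (?up i n) = hop n (s i) ?S"
      by (rule window_update[OF inj i bound[OF i] lt])
    also have "of_int (perm_sgn N (?up i n)) = of_int (perm_sgn N s) * hop_sign n (s i) ?S"
    proof -
      have "{\<sigma> \<in> ?S. s i < \<sigma> \<and> \<sigma> < s i + int n} = s ` {j. j < N \<and> s i < s j \<and> s j < s i + int n}"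
        using lt by (auto simp: window_def)
      moreover have "inj_on s {j. j < N \<and> s i < s j \<and> s j < s i + int n}"
        by (rule inj_on_subset[OF inj]) auto
      ultimately have "card {\<sigma> \<in> ?S. s i < \<sigma> \<and> \<sigma> < s i + int n} =
          card {j. j < N \<and> s i < s j \<and> s j < s i + int n}"
        by (simp add: card_image)
      then have "hop_sign n (s i) ?S = of_int (perm_sgn N (?up i n) * perm_sgn N s)"
        using perm_sgn_update[OF inj i _ ne] n by (simp add: hop_sign_def)
      \<comment> \<open>By injectivity the sign is its own inverse, which solves the relation of
        \<open>perm_sgn_update\<close> for the new sign.\<close>
      moreover have "perm_sgn N s * perm_sgn N s = 1"
      proof -
        have "(\<Prod>j<N. \<Prod>k<j. s j - s k) \<noteq> 0"
          using inj by (auto dest: inj_onD)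
        then show ?thesis by (simp add: perm_sgn_eq_sgn sgn_if)
      qed
      ultimately show ?thesis
        by (metis (no_types, lifting) mult.commute mult.assoc mult.right_neutral of_int_mult)
    qed
    finally show ?thesis by (simp only: mult.assoc)
  qed
  have "coeff (jt N t s) (Suc k) * fact (Suc k) = coeff (pderiv (jt N t s)) k * fact k"
    by (simp add: coeff_pderiv mult_ac)
  also have "\<dots> = (\<Sum>i<N. \<Sum>n=1..B. t n * (coeff (jt N t (?up i n)) k * fact k))"
    by (simp add: pderiv_jt[OF B] coeff_sum sum_distrib_left mult_ac)
  also have "\<dots> = (\<Sum>(i, n)\<in>{..<N} \<times> {1..B}. t n * (coeff (jt N t (?up i n)) k * fact k))"
    by (simp add: sum.cartesian_product)
  also have "\<dots> = (\<Sum>(i, n)\<in>{(i, n). i < N \<and> 1 \<le> n \<and> s i + int n \<notin> ?S}.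
      t n * (coeff (jt N t (?up i n)) k * fact k))"
  proof (rule sum.mono_neutral_right)
    show "{(i, n). i < N \<and> 1 \<le> n \<and> s i + int n \<notin> ?S} \<subseteq> {..<N} \<times> {1..B}"
    proof clarify
      fix i n assume h: "i < N" "1 \<le> n" "s i + int n \<notin> ?S"
      then have "s i + int n < int N" by (auto simp: window_def)
      then have "n \<le> B" using B[OF h(1), of "N - 1"] h by linarith
      with h show "i \<in> {..<N} \<and> n \<in> {1..B}" by simp
    qed
  qed (auto simp: jt0)
  also have "\<dots> = (\<Sum>(i, n)\<in>{(i, n). i < N \<and> 1 \<le> n \<and> s i + int n \<notin> ?S}.
      of_int (perm_sgn N s) * (t n * hop_sign n (s i) ?S * ?w (hop n (s i) ?S)))"
    by (intro sum.cong refl) (auto simp: jt1)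
  also have "\<dots> = (\<Sum>(n, x)\<in>hops ?S.
      of_int (perm_sgn N s) * (t n * hop_sign n x ?S * ?w (hop n x ?S)))"
  \<comment> \<open>Rows with an admissible increment correspond to the moves in the window: a mode
    from \<open>N\<close> on cannot move, since everything above it is occupied.\<close>
  proof (rule sum.reindex_bij_betw[symmetric, of "\<lambda>(i, n). (n, s i)", THEN trans, OF _ _, symmetric])
    show "bij_betw (\<lambda>(i, n). (n, s i)) {(i, n). i < N \<and> 1 \<le> n \<and> s i + int n \<notin> ?S} (hops ?S)"
    proof (rule bij_betwI')
      fix y assume "y \<in> hops ?S"
      then obtain n x where y: "y = (n, x)" "0 < n" "x \<in> ?S" "x + int n \<notin> ?S" by (auto simp: hops_def)
      then have "x < int N" by (auto simp: window_def)
      with y obtain i where "i < N" "x = s i" by (auto simp: window_def)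
      with y show "\<exists>z\<in>{(i, n). i < N \<and> 1 \<le> n \<and> s i + int n \<notin> ?S}. y = (\<lambda>(i, n). (n, s i)) z"
        by (intro bexI[of _ "(i, n)"]) auto
    next
      fix y z assume "y \<in> {(i, n). i < N \<and> 1 \<le> n \<and> s i + int n \<notin> ?S}"
        "z \<in> {(i, n). i < N \<and> 1 \<le> n \<and> s i + int n \<notin> ?S}"
      then show "((\<lambda>(i, n). (n, s i)) y = (\<lambda>(i, n). (n, s i)) z) = (y = z)"
        using inj by (auto dest: inj_onD)
    qed (auto simp: hops_def window_def)
  qed (auto simp: case_prod_unfold)
  also have "\<dots> = of_int (perm_sgn N s) * (shift_op t ^^ Suc k) vac ?S"
    by (simp add: shift_op_def sum_distrib_left case_prod_unfold)
  finally show ?case .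
qed


text \<open>The Schur function, as a function of the variables \<open>t n = p\<^sub>n / n\<close>, where \<open>p\<^sub>n\<close> are the power
  sums; \<open>t 0\<close> is irrelevant.\<close>

definition schur :: "(nat \<Rightarrow> complex) \<Rightarrow> nat list \<Rightarrow> complex" where
  "schur t lam = op_exp (shift_op t) vac (shape lam)"

definition shape_seq :: "nat list \<Rightarrow> nat \<Rightarrow> int" where
  "shape_seq lam i = int i - int (part lam (Suc i))"

lemma shape_seq_less: "is_partition lam \<Longrightarrow> i < j \<Longrightarrow> shape_seq lam i < shape_seq lam j"
  unfolding shape_seq_def by (rule shape_strict_mono)

lemma shape_window:
  assumes "length lam \<le> N"
  shows "shape lam = window N (shape_seq lam)"
proof -
  have "int j = shape_seq lam j" if "N \<le> j" for j
    using that assms part_eq_0[of lam "Suc j"] by (simp add: shape_seq_def)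
  then have "shape_seq lam ` {N..} = int ` {N..}" by (auto simp: image_iff)
  also have "int ` {N..} = {int N..}"
  proof (intro equalityI subsetI)
    fix x assume "x \<in> {int N..}"
    then have "x = int (nat x)" "nat x \<in> {N..}" by auto
    then show "x \<in> int ` {N..}" by (rule image_eqI)
  qed auto
  finally have "{int N..} = shape_seq lam ` {N..}" ..
  moreover have "(UNIV :: nat set) = {..<N} \<union> {N..}" by auto
  ultimately show ?thesis
    unfolding shape_def window_def shape_seq_def[symmetric] by (metis image_Un)
qed

lemma poly_1_eq_Sum_any: "poly p (1 :: 'a :: comm_semiring_1) = Sum_any (coeff p)"
proof -
  have "Sum_any (coeff p) = (\<Sum>k\<le>degree p. coeff p k)"
    by (rule Sum_any.expand_superset) (auto simp: le_degree)
  then show ?thesis by (simp add: poly_altdef)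
qed

text \<open>The complete homogeneous symmetric function of degree \<open>m\<close>, expressed in the
  power sums \<open>n * t n\<close>.\<close>

definition hcoef :: "(nat \<Rightarrow> complex) \<Rightarrow> int \<Rightarrow> complex" where
  "hcoef t m = (if m < 0 then 0 else fps_nth (fps_exp 1 oo gen_fps t) (nat m))"

lemma poly_h_poly_1: "poly (h_poly t m) 1 = hcoef t m"
  by (simp add: h_poly_def hcoef_def poly_sum poly_monom fps_compose_nth atMost_atLeast0)

text \<open>The coefficients of the polynomial \<open>jt\<close> are the terms of the exponential
  series, so this series is finite and sums to the value at 1; the sign is 1 because
  \<open>shape_seq\<close> increases. \<open>N\<close> is left free, as the bialternant formula
  needs as many rows as variables.\<close>

theorem jacobi_trudi:
  assumes "is_partition lam" "length lam \<le> N"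
  shows "schur t lam = ndet N (\<lambda>i j. hcoef t (int j - shape_seq lam i))"
proof -
  have inj: "inj_on (shape_seq lam) {..<N}"
    using shape_seq_less[OF assms(1)] by (intro linorder_inj_onI) (auto dest: less_imp_neq)
  have "coeff (jt N t (shape_seq lam)) k = (shift_op t ^^ k) vac (shape lam) / fact k" for k
    using coeff_jt[OF inj, of t k] perm_sgn_strict_mono[of N "shape_seq lam"]
      shape_seq_less[OF assms(1)] shape_window[OF assms(2)]
    by (simp add: shape_seq_def field_simps)
  then have "schur t lam = poly (jt N t (shape_seq lam)) 1"
    by (simp add: schur_def op_exp_def poly_1_eq_Sum_any)
  also have "\<dots> = ndet N (\<lambda>i j. poly (h_poly t (int j - shape_seq lam i)) 1)"
    unfolding jt_def ndet_leibniz by (simp add: poly_sum poly_prod of_int_poly)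
  finally show ?thesis by (simp add: poly_h_poly_1)
qed

section \<open>The bialternant formula\<close>

definition power_sum :: "nat \<Rightarrow> (nat \<Rightarrow> complex) \<Rightarrow> nat \<Rightarrow> complex" where
  "power_sum N x n = (\<Sum>l<N. x l ^ n)"

definition lin_fps :: "complex \<Rightarrow> complex fps" where
  "lin_fps c = 1 - fps_const c * fps_X"

lemma geometric_lin_fps: "Abs_fps (\<lambda>n. c ^ n) * lin_fps c = 1"
proof (rule fps_ext)
  fix n show "fps_nth (Abs_fps (\<lambda>n. c ^ n) * lin_fps c) n = fps_nth 1 n"
    by (cases n) (simp_all add: lin_fps_def algebra_simps)
qed

lemma fps_deriv_prod_lin:
  "fps_deriv (\<Prod>k\<in>A. lin_fps (x k)) = - (\<Sum>l\<in>A. fps_const (x l) * (\<Prod>k\<in>A - {l}. lin_fps (x k)))"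
proof (induction A rule: infinite_finite_induct)
  case (insert a A)
  have "(\<Prod>k\<in>insert a A - {l}. lin_fps (x k)) = lin_fps (x a) * (\<Prod>k\<in>A - {l}. lin_fps (x k))"
    if "l \<in> A" for l
  proof -
    have "insert a A - {l} = insert a (A - {l})" using that insert.hyps by auto
    then show ?thesis using insert.hyps by simp
  qed
  then have "(\<Sum>l\<in>A. fps_const (x l) * (\<Prod>k\<in>insert a A - {l}. lin_fps (x k))) =
      lin_fps (x a) * (\<Sum>l\<in>A. fps_const (x l) * (\<Prod>k\<in>A - {l}. lin_fps (x k)))"
    by (simp add: sum_distrib_left mult_ac)
  moreover have "insert a A - {a} = A" using insert.hyps by auto
  moreover have "fps_deriv (lin_fps (x a)) = - fps_const (x a)" by (simp add: lin_fps_def)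
  ultimately show ?case using insert by (simp add: algebra_simps flip: fps_const_neg)
qed simp_all

text \<open>The generating function of the complete symmetric functions: since
  \<open>T' * P = - P'\<close> and \<open>F' = F * T'\<close>, the derivative of
  \<open>F * P\<close> vanishes, and its constant term is 1.\<close>

lemma exp_power_sums:
  "(fps_exp 1 oo gen_fps (\<lambda>n. power_sum N x n / of_nat n)) * (\<Prod>k<N. lin_fps (x k)) = 1"
proof -
  define T where "T = gen_fps (\<lambda>n. power_sum N x n / of_nat n)"
  define F where "F = fps_exp 1 oo T"
  define P where "P = (\<Prod>k<N. lin_fps (x k))"
  have "fps_deriv T = (\<Sum>l<N. fps_const (x l) * Abs_fps (\<lambda>n. x l ^ n))"
    by (rule fps_ext) (simp add: T_def gen_fps_def power_sum_def fps_sum_nth del: of_nat_Suc)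
  then have "fps_deriv T * P = (\<Sum>l<N. fps_const (x l) * (Abs_fps (\<lambda>n. x l ^ n) * P))"
    by (simp add: sum_distrib_right mult.assoc)
  also have "\<dots> = (\<Sum>l<N. fps_const (x l) * (\<Prod>k\<in>{..<N} - {l}. lin_fps (x k)))"
  proof (rule sum.cong[OF refl])
    fix l assume "l \<in> {..<N}"
    then have "P = lin_fps (x l) * (\<Prod>k\<in>{..<N} - {l}. lin_fps (x k))"
      unfolding P_def by (intro prod.remove) auto
    then show "fps_const (x l) * (Abs_fps (\<lambda>n. x l ^ n) * P) =
        fps_const (x l) * (\<Prod>k\<in>{..<N} - {l}. lin_fps (x k))"
      by (simp add: mult.assoc[symmetric] geometric_lin_fps mult.assoc[of "fps_const (x l)" "Abs_fps (\<lambda>n. x l ^ n)"])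
  qed
  also have "\<dots> = - fps_deriv P" by (simp add: P_def fps_deriv_prod_lin)
  finally have TP: "fps_deriv T * P = - fps_deriv P" .
  have "fps_nth T 0 = 0" by (simp add: T_def gen_fps_def)
  then have "fps_deriv F = F * fps_deriv T" by (simp add: F_def fps_compose_deriv)
  then have "fps_deriv (F * P) = F * (fps_deriv T * P + fps_deriv P)"
    by (simp add: algebra_simps)
  then have "fps_deriv (F * P) = 0" by (simp add: TP)
  then have "F * P = fps_const (fps_nth (F * P) 0)" by (simp only: fps_deriv_eq_0_iff)
  also have "fps_nth (F * P) 0 = 1"
  proof -
    have "fps_nth (\<Prod>k\<in>A. lin_fps (x k)) 0 = 1" for A
      by (induction A rule: infinite_finite_induct) (simp_all add: lin_fps_def)
    then show ?thesis by (simp add: F_def P_def)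
  qed
  finally show ?thesis by (simp add: F_def P_def T_def)
qed

lemma lin_fps_prod_nth_eq_0:
  assumes "finite A" "card A < n"
  shows "fps_nth (\<Prod>k\<in>A. lin_fps (x k)) n = 0"
  using assms
proof (induction A arbitrary: n rule: finite_induct)
  case (insert a A)
  then obtain m where "n = Suc m" "card A < m" by (cases n) auto
  with insert show ?case by (simp add: lin_fps_def algebra_simps)
qed simp

text \<open>The series of powers of \<open>x l\<close> is \<open>F\<close> times the product of the
  linear factors of the other variables. Comparing coefficients factors every alternant into a
  Jacobi-Trudi determinant and the determinant of \<open>C\<close>, whose entries are signed
  elementary symmetric functions of the variables other than \<open>x l\<close>. The empty partition
  identifies \<open>ndet N C\<close>. The product form covers coinciding variables.\<close>

theorem bialternant:
  fixes x :: "nat \<Rightarrow> complex"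
  assumes "is_partition lam" "length lam \<le> N"
  shows "schur (\<lambda>n. power_sum N x n / of_nat n) lam * ndet N (\<lambda>i l. x l ^ (N - 1 - i)) =
    ndet N (\<lambda>i l. x l ^ (N - 1 - i + part lam (Suc i)))"
proof -
  define t where "t = (\<lambda>n. power_sum N x n / of_nat n)"
  define F where "F = fps_exp 1 oo gen_fps t"
  define C where "C j l = fps_nth (\<Prod>k\<in>{..<N} - {l}. lin_fps (x k)) (N - 1 - j)" for j l
  have pw: "x l ^ nat (int N - 1 - s) = (\<Sum>j<N. hcoef t (int j - s) * C j l)"
    if "l < N" "s < int N" for l s
  proof -
    define E where "E = (\<Prod>k\<in>{..<N} - {l}. lin_fps (x k))"
    define M where "M = nat (int N - 1 - s)"
    have "F * (\<Prod>k<N. lin_fps (x k)) = 1" unfolding F_def t_def by (rule exp_power_sums)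
    moreover have "(\<Prod>k<N. lin_fps (x k)) = lin_fps (x l) * E"
      unfolding E_def using that by (intro prod.remove) auto
    ultimately have "Abs_fps (\<lambda>n. x l ^ n) * (F * (lin_fps (x l) * E)) = Abs_fps (\<lambda>n. x l ^ n)"
      by simp
    moreover have "Abs_fps (\<lambda>n. x l ^ n) * (F * (lin_fps (x l) * E)) =
        (Abs_fps (\<lambda>n. x l ^ n) * lin_fps (x l)) * (E * F)"
      by (simp add: mult_ac)
    ultimately have "Abs_fps (\<lambda>n. x l ^ n) = E * F" by (simp add: geometric_lin_fps)
    then have "x l ^ M = fps_nth (E * F) M" by (metis fps_nth_Abs_fps)
    also have "\<dots> = (\<Sum>j=0..M. fps_nth E j * fps_nth F (M - j))" by (simp add: fps_mult_nth)
    also have "\<dots> = (\<Sum>j<N. if j \<le> M then fps_nth E j * fps_nth F (M - j) else 0)"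
    proof (rule sum.mono_neutral_cong)
      \<comment> \<open>\<open>E\<close> is a polynomial of degree at most \<open>N - 1\<close>, so
        the convolution can be cut at \<open>N\<close> even if \<open>M\<close> is larger.\<close>
      fix j assume "j \<in> {0..M} - {..<N}"
      then have "fps_nth E j = 0"
        unfolding E_def using that by (intro lin_fps_prod_nth_eq_0) auto
      then show "fps_nth E j * fps_nth F (M - j) = 0" by simp
    qed auto
    also have "\<dots> = (\<Sum>j<N. hcoef t (int j - s) * C j l)"
    proof (rule sum.reindex_bij_witness[of _ "\<lambda>j. N - 1 - j" "\<lambda>j. N - 1 - j"])
      fix j assume j: "j \<in> {..<N}"
      have "nat (int (N - 1 - j) - s) = M - j" if "j \<le> M"
        using j that \<open>s < int N\<close> by (simp add: M_def of_nat_diff)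
      moreover have "int (N - 1 - j) - s < 0 \<longleftrightarrow> \<not> j \<le> M"
        using j \<open>s < int N\<close> by (simp add: M_def of_nat_diff) linarith
      ultimately show "hcoef t (int (N - 1 - j) - s) * C (N - 1 - j) l =
          (if j \<le> M then fps_nth E j * fps_nth F (M - j) else 0)"
        using j by (auto simp: hcoef_def C_def E_def F_def)
    qed auto
    finally show ?thesis by (simp add: M_def)
  qed
  have alt: "ndet N (\<lambda>i l. x l ^ nat (int N - 1 - s i)) =
      ndet N (\<lambda>i j. hcoef t (int j - s i)) * ndet N C" if "\<And>i. i < N \<Longrightarrow> s i < int N" for s
    unfolding ndet_mult[symmetric] by (rule ndet_cong) (use that pw in simp)
  have "ndet N (\<lambda>i l. x l ^ (N - 1 - i)) = ndet N (\<lambda>i l. x l ^ nat (int N - 1 - int i))"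
    by (rule ndet_cong) (auto intro!: arg_cong[where f = "(^) _"])
  also have "\<dots> = ndet N (\<lambda>i j. hcoef t (int j - int i)) * ndet N C"
    by (rule alt) simp
  also have "ndet N (\<lambda>i j. hcoef t (int j - int i)) = 1"
    by (subst ndet_upper_triangular) (auto simp: hcoef_def)
  finally have "ndet N C = ndet N (\<lambda>i l. x l ^ (N - 1 - i))" by simp
  moreover have "ndet N (\<lambda>i l. x l ^ (N - 1 - i + part lam (Suc i))) =
      ndet N (\<lambda>i l. x l ^ nat (int N - 1 - shape_seq lam i))"
    by (rule ndet_cong) (auto intro!: arg_cong[where f = "(^) _"] simp: shape_seq_def nat_eq_iff2)
  moreover have "\<dots> = ndet N (\<lambda>i j. hcoef t (int j - shape_seq lam i)) * ndet N C"
    by (rule alt) (simp add: shape_seq_def)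
  ultimately show ?thesis
    unfolding jacobi_trudi[OF assms] t_def by simp
qed

section \<open>Charge zero and the standard basis\<close>

text \<open>The vacuum has exactly \<open>N\<close> elements below \<open>N\<close>, so the equality
  of counts means charge 0. It persists for larger \<open>N\<close>, which allows two sets to be
  compared at a common cut.\<close>

definition neutral_at :: "nat \<Rightarrow> int set \<Rightarrow> bool" where
  "neutral_at N S \<longleftrightarrow> {int N..} \<subseteq> S \<and> finite (S \<inter> {..<int N}) \<and> card (S \<inter> {..<int N}) = N"

definition neutral :: "int set \<Rightarrow> bool" where
  "neutral S \<longleftrightarrow> (\<exists>N. neutral_at N S)"

definition neutral_supp :: "ket \<Rightarrow> bool" where
  "neutral_supp v \<longleftrightarrow> (\<forall>S. v S \<noteq> 0 \<longrightarrow> neutral S)"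

lemma neutral_at_mono:
  assumes "neutral_at N S" "N \<le> M"
  shows "neutral_at M S"
proof -
  have "S \<inter> {..<int M} = (S \<inter> {..<int N}) \<union> {int N..<int M}"
    using assms by (auto simp: neutral_at_def)
  moreover have "card ((S \<inter> {..<int N}) \<union> {int N..<int M}) = N + (M - N)"
    using assms by (subst card_Un_disjoint) (auto simp: neutral_at_def)
  ultimately show ?thesis using assms by (auto simp: neutral_at_def)
qed

lemma neutral_at_hop:
  assumes "(n, k) \<in> hops S" "k + int n < int N"
  shows "neutral_at N (hop n k S) \<longleftrightarrow> neutral_at N S"
proof -
  have h: "n > 0" "k \<in> S" "k + int n \<notin> S" using assms(1) by (auto simp: hops_def)
  have eq: "hop n k S \<inter> {..<int N} = insert (k + int n) ((S \<inter> {..<int N}) - {k})"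
    using assms(2) by (auto simp: hop_def)
  have "card (insert (k + int n) ((S \<inter> {..<int N}) - {k})) = card (S \<inter> {..<int N})"
    if "finite (S \<inter> {..<int N})"
  proof -
    have "card (insert (k + int n) ((S \<inter> {..<int N}) - {k})) = Suc (card ((S \<inter> {..<int N}) - {k}))"
      using that h by simp
    also have "\<dots> = card (S \<inter> {..<int N})"
      by (rule card_Suc_Diff1[OF that]) (use h assms(2) in auto)
    finally show ?thesis .
  qed
  moreover have "{int N..} \<subseteq> hop n k S \<longleftrightarrow> {int N..} \<subseteq> S"
    using assms(2) h(1) by (auto simp: hop_def)
  ultimately show ?thesis unfolding neutral_at_def eq by auto
qed

lemma neutral_hop:
  assumes "(n, k) \<in> hops S"
  shows "neutral (hop n k S) \<longleftrightarrow> neutral S"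
proof -
  have "k + int n < int (max N (nat (k + int n + 1)))" for N by simp
  then show ?thesis
    unfolding neutral_def using neutral_at_hop[OF assms] neutral_at_mono max.cobounded1 by metis
qed

lemma neutral_imp_maya:
  assumes "neutral S"
  shows "maya S"
proof -
  obtain N where N: "neutral_at N S" using assms by (auto simp: neutral_def)
  have "S - {0..} \<subseteq> S \<inter> {..<int N}" by auto
  moreover have "{0..} - S \<subseteq> {0..<int N}" using N unfolding neutral_at_def
    by (auto simp: subset_iff not_le[symmetric])
  ultimately show ?thesis
    using N unfolding maya_def neutral_at_def by (meson finite_atLeastLessThan_int finite_subset)
qed

lemma neutral_shape:
  assumes "is_partition lam"
  shows "neutral (shape lam)"
proof -
  define N where "N = length lam"
  have eq: "shape lam \<inter> {..<int N} = shape_seq lam ` {..<N}"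
    unfolding shape_window[of lam N, unfolded N_def, OF order_refl] N_def
    by (auto simp: window_def shape_seq_def)
  have "inj_on (shape_seq lam) {..<N}"
    using shape_seq_less[OF assms] by (intro linorder_inj_onI) (auto dest: less_imp_neq)
  then have "neutral_at N (shape lam)"
    unfolding neutral_at_def eq using shape_window[of lam N]
    by (simp add: card_image window_def N_def)
  then show ?thesis by (auto simp: neutral_def)
qed

text \<open>The elements below \<open>N\<close> are sorted. Their gaps make
  \<open>i - xs ! i\<close> weakly decreasing, and the last one being less than \<open>N\<close>
  makes it nonnegative; these differences are the parts.\<close>

lemma neutral_imp_shape:
  assumes "neutral S"
  obtains lam where "is_partition lam" "S = shape lam"
proof -
  obtain N where N: "neutral_at N S" using assms by (auto simp: neutral_def)
  define xs where "xs = sorted_list_of_set (S \<inter> {..<int N})"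
  have xs: "set xs = S \<inter> {..<int N}" "length xs = N" "sorted_wrt (<) xs"
    using N by (simp_all add: xs_def neutral_at_def)
  have less: "xs ! i < xs ! j" if "i < j" "j < N" for i j
    using xs(2,3) that by (simp add: sorted_wrt_iff_nth_less)
  have gap: "xs ! i + int (j - i) \<le> xs ! j" if "i \<le> j" "j < N" for i j
    using that
  proof (induction j rule: dec_induct)
    case (step m)
    then show ?case using less[of m "Suc m"] by (simp add: Suc_diff_le)
  qed simp
  have le: "xs ! i \<le> int i" if "i < N" for i
  proof -
    have "xs ! (N - 1) \<in> set xs" using that xs(2) by simp
    then have "xs ! (N - 1) < int N" using xs(1) by auto
    moreover have "xs ! i + int (N - 1 - i) \<le> xs ! (N - 1)" using gap[of i "N - 1"] that by simp
    ultimately show ?thesis using that by simp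
  qed
  define f where "f i = (if i < N then nat (int i - xs ! i) else 0)" for i
  have anti: "f j \<le> f i" if "i \<le> j" for i j
    using gap[of i j] that by (auto simp: f_def)
  \<comment> \<open>Zero parts are cut off, as the list of a partition contains no zeros.\<close>
  define L where "L = (LEAST i. f i = 0)"
  have "f N = 0" by (simp add: f_def)
  then have "f L = 0" unfolding L_def by (rule LeastI)
  have nz: "f i \<noteq> 0" if "i < L" for i using that unfolding L_def by (rule not_less_Least)
  have z: "f i = 0" if "L \<le> i" for i using anti[OF that] \<open>f L = 0\<close> by simp
  define lam where "lam = map f [0..<L]"
  have lam: "is_partition lam"
    unfolding is_partition_def sorted_wrt_iff_nth_less using anti by (auto simp: lam_def dest: nz)
  have part: "part lam (Suc i) = f i" for i
    by (cases "i < L") (auto simp: part_def lam_def z)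
  have "int i - int (f i) = (if i < N then xs ! i else int i)" for i
    using le[of i] by (simp add: f_def)
  then have "shape lam = range (\<lambda>i. if i < N then xs ! i else int i)"
    by (simp add: shape_def part)
  also have "\<dots> = S"
  proof (intro equalityI subsetI)
    fix x assume "x \<in> range (\<lambda>i. if i < N then xs ! i else int i)"
    then obtain i where "x = (if i < N then xs ! i else int i)" by (rule rangeE)
    then show "x \<in> S" using xs(1,2) N by (cases "i < N") (force simp: neutral_at_def)+
  next
    fix x assume "x \<in> S"
    show "x \<in> range (\<lambda>i. if i < N then xs ! i else int i)"
    proof (cases "x < int N")
      case True
      with \<open>x \<in> S\<close> obtain i where "i < N" "x = xs ! i"
        using xs(1,2) by (metis IntI in_set_conv_nth lessThan_iff)
      then show ?thesis by (intro range_eqI[of _ _ i]) simp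
    next
      case False
      then show ?thesis by (intro range_eqI[of _ _ "nat x"]) auto
    qed
  qed
  finally show ?thesis using that lam by blast
qed

lemma shape_inj:
  assumes "is_partition lam" "is_partition mu" "shape lam = shape mu"
  shows "lam = mu"
proof -
  have le: "shape_seq lam i \<le> shape_seq mu i"
    if "is_partition lam" "is_partition mu" "shape lam = shape mu" "\<And>j. j < i \<Longrightarrow> shape_seq lam j = shape_seq mu j"
    for lam mu i
  proof -
    have "shape_seq mu i \<in> shape lam" using that(3) by (auto simp: shape_def shape_seq_def)
    then obtain j where j: "shape_seq mu i = shape_seq lam j" by (auto simp: shape_def shape_seq_def)
    have "\<not> j < i" using that(4)[of j] j shape_seq_less[OF that(2), of j i] by auto
    then show ?thesis using j shape_seq_less[OF that(1), of i j] by (cases "i = j") auto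
  qed
  have eq: "shape_seq lam i = shape_seq mu i" for i
  proof (induction i rule: less_induct)
    case (less i)
    then show ?case using le[of lam mu i] le[of mu lam i] assms by (intro antisym) auto
  qed
  show ?thesis
  proof (rule partition_eqI[OF assms(1,2)])
    fix i :: nat assume "1 \<le> i"
    then show "part lam i = part mu i" using eq[of "i - 1"] by (simp add: shape_seq_def)
  qed
qed

section \<open>Standard kets and bras in the wedge basis\<close>

lemma psi_ket_of:
  assumes "k \<notin> S"
  shows "psi k (ket_of S) = (\<lambda>T. below_sign k S * ket_of (insert k S) T)"
proof
  fix T
  have "{s \<in> insert k S. s < k} = {s \<in> S. s < k}" by auto
  then have "below_sign k (insert k S) = below_sign k S" by (simp add: below_sign_def)
  moreover have "k \<in> T \<and> T - {k} = S \<longleftrightarrow> T = insert k S" using assms by auto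
  ultimately show "psi k (ket_of S) T = below_sign k S * ket_of (insert k S) T"
    by (auto simp: psi_def ket_of_def)
qed

lemma psid_ket_of:
  assumes "- l - 1 \<in> S"
  shows "psid l (ket_of S) = (\<lambda>T. below_sign (- l - 1) S * ket_of (S - {- l - 1}) T)"
proof
  fix T
  define m where "m = - l - 1"
  have "{s \<in> S - {m}. s < m} = {s \<in> S. s < m}" by auto
  then have "below_sign m (S - {m}) = below_sign m S" by (simp add: below_sign_def)
  moreover have "m \<notin> T \<and> insert m T = S \<longleftrightarrow> T = S - {m}" using assms by (auto simp: m_def)
  ultimately show "psid l (ket_of S) T = below_sign (- l - 1) S * ket_of (S - {- l - 1}) T"
    by (auto simp: psid_def ket_of_def simp flip: m_def)
qed

lemma psi_scale: "psi k (\<lambda>T. c * v T) = (\<lambda>T. c * psi k v T)"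
  by (auto simp: psi_def)

lemma le_diag_iff:
  assumes "is_partition lam" "1 \<le> i"
  shows "i \<le> diag lam \<longleftrightarrow> i \<le> part lam i"
proof -
  define A where "A = {i. 1 \<le> i \<and> i \<le> part lam i}"
  have down: "j \<in> A" if "i \<in> A" "1 \<le> j" "j \<le> i" for i j
    using that part_antimono[OF assms(1), of j i] by (auto simp: A_def)
  have sub: "A \<subseteq> {1..length lam}"
  proof
    fix k assume "k \<in> A"
    then show "k \<in> {1..length lam}"
      using part_eq_0[of lam k] by (cases "k \<le> length lam") (auto simp: A_def)
  qed
  then have fin: "finite A" by (rule finite_subset) simp
  show ?thesis
  proof
    assume "i \<le> part lam i"
    then have "{1..i} \<subseteq> A" using down[of i] assms(2) by (auto simp: A_def)
    then have "card {1..i} \<le> card A" using fin by (rule card_mono[rotated])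
    then show "i \<le> diag lam" by (simp add: diag_def A_def)
  next
    assume le: "i \<le> diag lam"
    show "i \<le> part lam i"
    proof (rule ccontr)
      assume "\<not> i \<le> part lam i"
      then have "k < i" if "k \<in> A" for k
        using down[OF that assms(2)] by (cases "k < i") (auto simp: A_def)
      then have "A \<subseteq> {1..<i}" by (auto simp: A_def)
      then have "card A \<le> card {1..<i}" by (rule card_mono[rotated]) simp
      with le assms(2) show False by (simp add: diag_def A_def)
    qed
  qed
qed

text \<open>Step \<open>i\<close> of the fold replaces the mode \<open>a i \<ge> 0\<close> by
  \<open>b i < 0\<close>; up to a reflection of the second one these are the Frobenius coordinates
  of the diagram. The fold starts from the innermost index \<open>d\<close>, and \<open>R i\<close>
  is the occupied set after the steps \<open>d\<close> down to \<open>i\<close>.\<close>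

lemma std_ket_eq:
  assumes "is_partition lam"
  shows "std_ket lam = ket_of (shape (conjugate lam))"
proof -
  define d where "d = diag lam"
  define a where "a i = int (part lam i) - int i" for i
  define b where "b i = int i - int (part (conjugate lam) i) - 1" for i
  have a0: "a i \<ge> 0 \<longleftrightarrow> i \<le> d" if "1 \<le> i" for i
    using le_diag_iff[OF assms that] by (simp add: a_def d_def)
  have b0: "b i < 0 \<longleftrightarrow> i \<le> d" if "1 \<le> i" for i
    using le_diag_iff[OF assms that] le_part_conjugate_iff[OF assms that that]
    by (simp add: b_def d_def) linarith
  have a_less: "a j < a i" if "1 \<le> i" "i < j" for i j
    using part_antimono[OF assms that(1), of j] that by (simp add: a_def)
  have b_less: "b i < b j" if "1 \<le> i" "i < j" for i j
    using part_antimono[OF is_partition_conjugate[OF assms] that(1), of j] that by (simp add: b_def)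
  define R where "R i = ({0..} - a ` {i..d}) \<union> b ` {i..d}" for i
  define F where "F = (\<lambda>i v. (\<lambda>S. (-1) powi (- int (part lam i) + int i) *
        psi (- int (part (conjugate lam) i) + int i - 1)
          (psid (- int (part lam i) + int i - 1) v) S) :: ket)"
  have F_step: "F i (ket_of (R (Suc i))) = ket_of (R i)" if i: "1 \<le> i" "i \<le> d" for i
  proof -
    define S where "S = R (Suc i)"
    define m where "m = a i"
    have m: "m \<ge> 0" using a0[OF i(1)] i(2) by (simp add: m_def)
    have aneg: "a j \<in> {0..<m}" if "j \<in> {Suc i..d}" for j
      using a_less[OF i(1), of j] a0[of j] that i by (auto simp: m_def)
    have bneg: "b j < 0 \<and> b i < b j" if "j \<in> {Suc i..d}" for j
      using b_less[OF i(1), of j] b0[of j] that i by auto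
    have bi: "b i < 0" using b0[OF i(1)] i(2) by simp
    have inj: "inj_on a {Suc i..d}" "inj_on b {Suc i..d}"
      using a_less b_less i(1) by (auto intro!: linorder_inj_onI dest: less_imp_neq) 
        (metis Suc_leD le_trans less_irrefl)+
    have mS: "m \<in> S" using aneg m unfolding S_def R_def by force
    \<comment> \<open>The modes removed so far lie below \<open>m\<close> and are as many as the
      negative modes added, so exactly \<open>m\<close> modes lie below \<open>m\<close>. The
      resulting sign cancels the prefactor of the standard ket; \<open>b i\<close> enters without a
      sign, since nothing lies below it.\<close>
    have "{s \<in> S. s < m} = ({0..<m} - a ` {Suc i..d}) \<union> b ` {Suc i..d}"
      using bneg m unfolding S_def R_def by force
    also have "card \<dots> = card ({0..<m} - a ` {Suc i..d}) + card (b ` {Suc i..d})"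
      using bneg by (intro card_Un_disjoint) force+
    also have "\<dots> = nat m"
    proof -
      have sub: "a ` {Suc i..d} \<subseteq> {0..<m}" using aneg by auto
      then have "card ({0..<m} - a ` {Suc i..d}) = nat m - (d - i)"
        using inj(1) by (subst card_Diff_subset) (auto simp: card_image)
      moreover have "d - i \<le> nat m" using card_mono[OF _ sub] inj(1) by (simp add: card_image)
      ultimately show ?thesis using inj(2) by (simp add: card_image)
    qed
    finally have sm: "below_sign m S = (-1) ^ nat m" by (simp add: below_sign_def)
    have nb: "b i \<notin> S - {m}" and empty: "{s \<in> S - {m}. s < b i} = {}"
      using bneg bi unfolding S_def R_def by force+
    have sb: "below_sign (b i) (S - {m}) = 1"
      unfolding below_sign_def empty by simp
    have Ri: "insert (b i) (S - {m}) = R i"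
    proof -
      have "{i..d} = insert i {Suc i..d}" using i by auto
      moreover have "m \<notin> b ` {Suc i..d}" using bneg m by force
      ultimately show ?thesis unfolding S_def R_def m_def by auto
    qed
    have pm: "- (- int (part lam i) + int i - 1) - 1 = m"
      "- int (part (conjugate lam) i) + int i - 1 = b i" "- int (part lam i) + int i = - m"
      by (simp_all add: m_def a_def b_def)
    have "psid (- int (part lam i) + int i - 1) (ket_of S) =
        (\<lambda>T. below_sign m S * ket_of (S - {m}) T)"
      using psid_ket_of[of "- int (part lam i) + int i - 1" S] mS unfolding pm by simp
    then have "F i (ket_of S) = (\<lambda>T. (-1) powi (- m) * (below_sign m S * (below_sign (b i) (S - {m}) *
        ket_of (insert (b i) (S - {m})) T)))"
      unfolding F_def pm(2) pm(3) by (simp only: psi_scale psi_ket_of[OF nb])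
    also have "\<dots> = ket_of (R i)"
    proof -
      have "(-1) powi (- m) * (-1) ^ nat m = (1 :: complex)"
        using m by (simp add: power_int_def power_mult_distrib[symmetric])
      then show ?thesis by (simp add: sm sb Ri mult.assoc[symmetric])
    qed
    finally show ?thesis by (simp add: S_def)
  qed
  have fold: "foldr F [Suc n..<Suc d] vac = ket_of (R (Suc n))" if "n \<le> d" for n
    using that
  proof (induction n rule: inc_induct)
    case base
    have "R (Suc d) = {0..}" by (simp add: R_def)
    then show ?case by (simp add: vac_eq)
  next
    case (step n)
    then have "[Suc n..<Suc d] = Suc n # [Suc (Suc n)..<Suc d]" by (simp add: upt_conv_Cons del: upt_Suc)
    then show ?case using step.IH F_step[of "Suc n"] \<open>n < d\<close> by simp
  qed
  \<comment> \<open>Nonnegative modes are compared through the missing \<open>a j\<close>, negative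
    ones through the \<open>b j\<close>; by \<open>a0\<close> and \<open>b0\<close> the restriction
    to \<open>j \<le> d\<close> is automatic on either side.\<close>
  have "R 1 = shape (conjugate lam)"
  proof (rule Set.set_eqI)
    fix x
    have memb: "x \<in> shape (conjugate lam) \<longleftrightarrow> (\<exists>j\<ge>1. x = b j)"
    proof
      assume "x \<in> shape (conjugate lam)"
      then obtain j where "x = int j - int (part (conjugate lam) (Suc j))" by (auto simp: shape_def)
      then show "\<exists>j\<ge>1. x = b j" by (intro exI[of _ "Suc j"]) (simp add: b_def)
    next
      assume "\<exists>j\<ge>1. x = b j"
      then obtain j where "j \<ge> 1" "x = b j" by auto
      then show "x \<in> shape (conjugate lam)"
        unfolding shape_def by (intro range_eqI[of _ _ "j - 1"]) (simp add: b_def)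
    qed
    have mema: "x \<in> shape (conjugate lam) \<longleftrightarrow> \<not> (\<exists>j\<ge>1. x = a j)"
    proof -
      have "x \<in> shape (conjugate lam) \<longleftrightarrow> - 1 - x \<notin> shape lam"
        unfolding shape_conjugate[OF assms] by (auto intro!: exI[of _ "- 1 - x"])
      moreover have "- 1 - x \<in> shape lam \<longleftrightarrow> (\<exists>j\<ge>1. x = a j)"
      proof
        assume "- 1 - x \<in> shape lam"
        then obtain j where "- 1 - x = int j - int (part lam (Suc j))" by (auto simp: shape_def)
        then show "\<exists>j\<ge>1. x = a j" by (intro exI[of _ "Suc j"]) (simp add: a_def)
      next
        assume "\<exists>j\<ge>1. x = a j"
        then obtain j where "j \<ge> 1" "x = a j" by auto
        then show "- 1 - x \<in> shape lam"
          unfolding shape_def by (intro range_eqI[of _ _ "j - 1"]) (simp add: a_def)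
      qed
      ultimately show ?thesis by simp
    qed
    show "x \<in> R 1 \<longleftrightarrow> x \<in> shape (conjugate lam)"
    proof (cases "x \<ge> 0")
      case True
      then have "x \<in> R 1 \<longleftrightarrow> \<not> (\<exists>j\<ge>1. x = a j)"
      proof -
        have "x \<notin> b ` {1..d}" using b0 True by force
        moreover have "x \<in> a ` {1..d} \<longleftrightarrow> (\<exists>j\<ge>1. x = a j)" using a0 True by auto
        ultimately show ?thesis using True by (simp add: R_def)
      qed
      then show ?thesis using mema by simp
    next
      case False
      then have "x \<in> R 1 \<longleftrightarrow> (\<exists>j\<ge>1. x = b j)"
        using b0 by (auto simp: R_def not_le)
      then show ?thesis using memb by simp
    qed
  qed
  then show ?thesis
    unfolding std_ket_def using fold[of 0] by (simp add: F_def d_def del: upt_Suc)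
qed

text \<open>Standard kets are distinct indicator functions, so every coefficient sum has at most one
  nonzero term and evaluation at a shape determines the coefficient. Support in charge 0 guarantees
  that an expansion exists at all, so that \<open>THE\<close> denotes.\<close>

lemma std_bra_eq:
  assumes "neutral_supp v" "is_partition lam"
  shows "std_bra lam v = v (shape (conjugate lam))"
proof -
  have single: "Sum_any (\<lambda>nu. if is_partition nu then c nu * std_ket nu (shape (conjugate mu)) else 0) = c mu"
    if "is_partition mu" for c mu
  proof -
    have "(if is_partition nu then c nu * std_ket nu (shape (conjugate mu)) else 0) =
        (if nu = mu then c mu else 0)" for nu
    proof (cases "is_partition nu")
      case True
      have "shape (conjugate mu) = shape (conjugate nu) \<longleftrightarrow> nu = mu"
        using True that shape_inj is_partition_conjugate conjugate_conjugate by metis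
      then show ?thesis using True by (simp add: std_ket_eq ket_of_def)
    qed (use that in auto)
    then show ?thesis by (simp add: Sum_any.expand_superset[of "{mu}"])
  qed
  show ?thesis
    unfolding std_bra_def
  proof (rule the_equality)
    show "\<exists>c. v (shape (conjugate lam)) = c lam \<and>
        (\<forall>S. v S = Sum_any (\<lambda>nu. if is_partition nu then c nu * std_ket nu S else 0))"
    proof (intro exI[of _ "\<lambda>nu. v (shape (conjugate nu))"] conjI refl allI)
      fix S
      show "v S = Sum_any (\<lambda>nu. if is_partition nu then v (shape (conjugate nu)) * std_ket nu S else 0)"
      proof (cases "neutral S")
        case True
        then obtain mu where mu: "is_partition mu" "S = shape mu" using neutral_imp_shape by blast
        then show ?thesis
          using single[OF is_partition_conjugate[OF mu(1)], of "\<lambda>nu. v (shape (conjugate nu))"]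
          unfolding conjugate_conjugate[OF mu(1)] mu(2) by simp
      next
        case False
        then have "v S = 0" using assms(1) by (auto simp: neutral_supp_def)
        moreover have "std_ket nu S = 0" if "is_partition nu" for nu
          using False neutral_shape[OF is_partition_conjugate[OF that]] 
          by (auto simp: std_ket_eq[OF that] ket_of_def)
        then have "(if is_partition nu then v (shape (conjugate nu)) * std_ket nu S else 0) = 0" for nu
          by simp
        ultimately show ?thesis by simp
      qed
    qed
  next
    fix x assume "\<exists>c. x = c lam \<and>
        (\<forall>S. v S = Sum_any (\<lambda>nu. if is_partition nu then c nu * std_ket nu S else 0))"
    then obtain c where "x = c lam"
      "\<And>S. v S = Sum_any (\<lambda>nu. if is_partition nu then c nu * std_ket nu S else 0)" by blast
    then show "x = v (shape (conjugate lam))" using single[OF assms(2), of c] by simp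
  qed
qed

section \<open>Conservation of charge, and pairings as Schur functions\<close>

lemma neutral_supp_shift_op:
  assumes "neutral_supp v"
  shows "neutral_supp (shift_op t v)"
  unfolding neutral_supp_def
proof (intro allI impI)
  fix S assume "shift_op t v S \<noteq> 0"
  then obtain n k where "(n, k) \<in> hops S" "v (hop n k S) \<noteq> 0"
    unfolding shift_op_def by (force elim!: sum.not_neutral_contains_not_neutral)
  then show "neutral S" using assms neutral_hop unfolding neutral_supp_def by blast
qed

lemma neutral_supp_raise_op:
  assumes "neutral_supp v"
  shows "neutral_supp (raise_op t v)"
  unfolding neutral_supp_def
proof (intro allI impI)
  have supp: "maya_supp v" using assms neutral_imp_maya by (auto simp: neutral_supp_def maya_supp_def)
  fix S assume "raise_op t v S \<noteq> 0"
  then obtain n where n: "n > 0" "boson (int n) v S \<noteq> 0"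
    unfolding raise_op_def by (elim Sum_any.not_neutral_obtains_not_neutral) (auto split: if_splits)
  have "boson (int n) v S = - Sum_any (\<lambda>k. psi k (psid (int n - k - 1) v) S)"
    unfolding boson_def using normal_ordered_eq[OF supp, of "int n"] n(1) by simp
  with n(2) obtain k where "psi k (psid (int n - k - 1) v) S \<noteq> 0"
    by (auto elim: Sum_any.not_neutral_obtains_not_neutral)
  then have k: "k \<in> S" "k - int n \<notin> S" "v (insert (k - int n) (S - {k})) \<noteq> 0"
    unfolding psi_psid_raise[OF supp n(1)] by (auto split: if_splits)
  then show "neutral S"
    using hop_unhop[OF n(1) k(1,2)] neutral_hop assms unfolding neutral_supp_def by metis
qed

lemma neutral_supp_op_exp:
  assumes "neutral_supp v" "\<And>w. neutral_supp w \<Longrightarrow> neutral_supp (A w)"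
  shows "neutral_supp (op_exp A v)"
proof -
  have "neutral_supp ((A ^^ m) v)" for m by (induction m) (auto intro: assms)
  then show ?thesis
    unfolding neutral_supp_def op_exp_def
    by (auto elim!: Sum_any.not_neutral_obtains_not_neutral)
qed

lemma neutral_supp_ket_of: "neutral S \<Longrightarrow> neutral_supp (ket_of S)"
  by (simp add: neutral_supp_def ket_of_def)

lemma shape_Nil: "shape [] = {0..}"
  using shape_window[of "[]" 0] by (simp add: window_def)

lemma is_partition_Nil: "is_partition []"
  by (simp add: is_partition_def)

lemma std_bra_op_exp_shift_op:
  assumes "is_partition lam"
  shows "std_bra lam (\<lambda>S. c * op_exp (shift_op t) vac S) = c * schur t (conjugate lam)"
proof -
  have "neutral_supp (op_exp (shift_op t) vac)"
    unfolding vac_eq shape_Nil[symmetric]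
    by (intro neutral_supp_op_exp neutral_supp_shift_op neutral_supp_ket_of neutral_shape is_partition_Nil)
  then have "neutral_supp (\<lambda>S. c * op_exp (shift_op t) vac S)"
    by (auto simp: neutral_supp_def)
  then show ?thesis by (simp add: std_bra_eq[OF _ assms] schur_def)
qed

lemma std_bra_op_exp_raise_op:
  assumes "is_partition mu"
  shows "std_bra [] (op_exp (raise_op p) (std_ket mu)) =
    schur (\<lambda>n. - p n / of_nat n) (conjugate mu)"
proof -
  have mu: "neutral (shape (conjugate mu))"
    by (rule neutral_shape[OF is_partition_conjugate[OF assms]])
  have "conjugate [] = []" by (simp add: conjugate_def part_def)
  have "neutral_supp (op_exp (raise_op p) (ket_of (shape (conjugate mu))))"
    by (intro neutral_supp_op_exp neutral_supp_raise_op neutral_supp_ket_of mu)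
  then have "std_bra [] (op_exp (raise_op p) (std_ket mu)) =
      op_exp (raise_op p) (ket_of (shape (conjugate mu))) {0..}"
    unfolding std_ket_eq[OF assms]
    by (simp add: std_bra_eq is_partition_Nil \<open>conjugate [] = []\<close> shape_Nil)
  then show ?thesis
    using op_exp_raise_op_vacuum[OF neutral_imp_maya[OF mu]] by (simp add: schur_def)
qed

section \<open>Conjugation, homogeneity and continuity of Schur functions\<close>

definition reflect :: "int set \<Rightarrow> int set" where
  "reflect S = {- 1 - k | k. k \<notin> S}"

lemma mem_reflect: "x \<in> reflect S \<longleftrightarrow> - 1 - x \<notin> S"
  unfolding reflect_def by (auto intro!: exI[of _ "- 1 - x"])

lemma hops_reflect: "(n, k) \<in> hops (reflect S) \<longleftrightarrow> (n, - 1 - k - int n) \<in> hops S"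
proof -
  have eq: "- 1 - (k + int n) = - 1 - k - int n" "- 1 - k - int n + int n = - 1 - k" by simp_all
  show ?thesis
    unfolding hops_def mem_Collect_eq case_prod_conv mem_reflect eq by blast
qed

lemma hop_reflect:
  assumes "(n, - 1 - k - int n) \<in> hops S"
  shows "hop n k (reflect S) = reflect (hop n (- 1 - k - int n) S)"
proof (rule Set.set_eqI)
  fix x show "x \<in> hop n k (reflect S) \<longleftrightarrow> x \<in> reflect (hop n (- 1 - k - int n) S)"
    using assms unfolding hops_def hop_def mem_reflect by (auto simp: mem_reflect)
qed

text \<open>Reflection exchanges particles and holes, and a move of length \<open>n\<close> passes
  \<open>n - 1\<close> modes in all, so the two counts have sum \<open>n - 1\<close>.\<close>

lemma hop_sign_reflect:
  assumes "n > 0"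
  shows "hop_sign n k (reflect S) = (-1) ^ (n + 1) * hop_sign n (- 1 - k - int n) S"
proof -
  define k' where "k' = - 1 - k - int n"
  define A where "A = {s \<in> S. k' < s \<and> s < k' + int n}"
  define B where "B = {s. s \<notin> S \<and> k' < s \<and> s < k' + int n}"
  have "{s \<in> reflect S. k < s \<and> s < k + int n} = (\<lambda>s. - 1 - s) ` B"
  proof (intro equalityI subsetI)
    fix s assume "s \<in> {s \<in> reflect S. k < s \<and> s < k + int n}"
    then have "- 1 - s \<in> B" by (auto simp: B_def k'_def mem_reflect)
    then show "s \<in> (\<lambda>s. - 1 - s) ` B" by (rule image_eqI[rotated]) simp
  qed (auto simp: B_def k'_def mem_reflect)
  then have cB: "card {s \<in> reflect S. k < s \<and> s < k + int n} = card B"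
    by (simp add: card_image inj_on_def)
  have fin: "finite A" "finite B"
    by (rule finite_subset[of _ "{k'..k' + int n}"]; auto simp: A_def B_def)+
  have "A \<union> B = {k'<..<k' + int n}" "A \<inter> B = {}" by (auto simp: A_def B_def)
  then have "card A + card B = n - 1"
    using card_Un_disjoint[OF fin] by simp
  then have "(-1) ^ card B = (-1 :: complex) ^ (n + 1) * (-1) ^ card A"
    using assms by (simp add: minus_one_power_iff) presburger
  then show ?thesis by (simp add: hop_sign_def cB A_def k'_def)
qed

lemma shift_op_pow_reflect:
  "(shift_op t ^^ m) vac (reflect S) = (shift_op (\<lambda>n. (-1) ^ (n + 1) * t n) ^^ m) vac S"
proof (induction m arbitrary: S)
  case 0
  have "reflect {0..} = {0..}" by (auto simp: mem_reflect)
  moreover have "reflect (reflect S) = S" by (rule Set.set_eqI) (simp add: mem_reflect)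
  ultimately have "reflect S = {0..} \<longleftrightarrow> S = {0..}" by metis
  then show ?case by (simp add: vac_def)
next
  case (Suc m)
  let ?r = "\<lambda>(n, k). (n, - 1 - k - int n)"
  have "(shift_op t ^^ Suc m) vac (reflect S) = (\<Sum>(n, k)\<in>hops (reflect S).
      t n * hop_sign n k (reflect S) * (shift_op t ^^ m) vac (hop n k (reflect S)))"
    by (simp add: shift_op_def)
  also have "\<dots> = (\<Sum>(n, k)\<in>hops S. (-1) ^ (n + 1) * t n * hop_sign n k S *
      (shift_op (\<lambda>n. (-1) ^ (n + 1) * t n) ^^ m) vac (hop n k S))"
  proof (rule sum.reindex_bij_witness[of _ ?r ?r])
    fix a assume "a \<in> hops (reflect S)"
    then obtain n k where a: "a = (n, k)" "(n, - 1 - k - int n) \<in> hops S" "n > 0"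
      by (cases a) (auto simp: hops_reflect, auto simp: hops_def)
    show "(case ?r a of (n, k) \<Rightarrow> (-1) ^ (n + 1) * t n * hop_sign n k S *
      (shift_op (\<lambda>n. (-1) ^ (n + 1) * t n) ^^ m) vac (hop n k S)) =
      (case a of (n, k) \<Rightarrow> t n * hop_sign n k (reflect S) * (shift_op t ^^ m) vac (hop n k (reflect S)))"
      by (simp add: a(1) hop_reflect[OF a(2)] Suc.IH hop_sign_reflect[OF a(3)])
  qed (auto simp: hops_reflect)
  also have "\<dots> = (shift_op (\<lambda>n. (-1) ^ (n + 1) * t n) ^^ Suc m) vac S"
    by (simp add: shift_op_def)
  finally show ?case .
qed

text \<open>The classical involution that multiplies the power sum of degree \<open>n\<close> by
  \<open>(-1) ^ (n + 1)\<close>, here the effect of particle-hole reflection on each move.\<close>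

lemma schur_conjugate:
  assumes "is_partition lam"
  shows "schur t (conjugate lam) = schur (\<lambda>n. (-1) ^ (n + 1) * t n) lam"
  by (simp add: schur_def op_exp_def shape_conjugate[OF assms] shift_op_pow_reflect flip: reflect_def)

lemma hcoef_homogeneous:
  assumes "c \<noteq> 0"
  shows "hcoef (\<lambda>n. c ^ n * t n) m = c powi m * hcoef t m"
proof -
  have gen: "gen_fps (\<lambda>n. c ^ n * t n) = gen_fps t oo (fps_const c * fps_X)"
    by (rule fps_ext) (simp add: gen_fps_def fps_compose_linear)
  have "gen_fps (\<lambda>n. c ^ n * t n) ^ k = gen_fps t ^ k oo (fps_const c * fps_X)" for k
    unfolding gen by (rule fps_compose_power) simp
  then have "fps_nth (gen_fps (\<lambda>n. c ^ n * t n) ^ k) M = c ^ M * fps_nth (gen_fps t ^ k) M" for k M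
    by (simp add: fps_compose_linear)
  then show ?thesis
    by (simp add: hcoef_def fps_compose_nth sum_distrib_left power_int_def mult_ac)
qed

lemma sum_part_extend:
  assumes "length lam \<le> N" "\<And>i. g i 0 = (0 :: 'a :: comm_monoid_add)"
  shows "(\<Sum>i<N. g i (part lam (Suc i))) = (\<Sum>i<length lam. g i (part lam (Suc i)))"
  by (rule sum.mono_neutral_right) (use assms part_eq_0[of lam] in auto)

lemma psize_eq: "psize lam = (\<Sum>i<length lam. part lam (Suc i))"
  unfolding psize_sum by (rule sum.reindex_bij_witness[of _ Suc "\<lambda>i. i - 1"]) auto

text \<open>Row \<open>i\<close> and column \<open>j\<close> of the Jacobi-Trudi matrix are scaled
  by \<open>c\<close> to the exponents \<open>- shape_seq lam i\<close> and \<open>j\<close>; for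
  \<open>i = j\<close> these add up to the part \<open>Suc i\<close>, so the total exponent is the
  size.\<close>

lemma schur_homogeneous:
  assumes "is_partition lam" "c \<noteq> 0"
  shows "schur (\<lambda>n. c ^ n * t n) lam = c ^ psize lam * schur t lam"
proof -
  define N where "N = length lam"
  have "schur (\<lambda>n. c ^ n * t n) lam =
      ndet N (\<lambda>i j. c powi (- shape_seq lam i) * (c powi int j * hcoef t (int j - shape_seq lam i)))"
    unfolding jacobi_trudi[OF assms(1) order_refl] N_def
  proof (rule ndet_cong)
    fix i j
    have "c powi (int j - shape_seq lam i) = c powi (- shape_seq lam i) * c powi int j"
      using power_int_add[of c "- shape_seq lam i" "int j"] assms(2) by simp
    then show "hcoef (\<lambda>n. c ^ n * t n) (int j - shape_seq lam i) =
        c powi (- shape_seq lam i) * (c powi int j * hcoef t (int j - shape_seq lam i))"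
      unfolding hcoef_homogeneous[OF assms(2)] by simp
  qed
  also have "\<dots> = (\<Prod>i<N. c powi (- shape_seq lam i)) * ((\<Prod>j<N. c powi int j) * schur t lam)"
    unfolding ndet_scale_rows ndet_scale_columns jacobi_trudi[OF assms(1) order_refl] N_def ..
  also have "\<dots> = (\<Prod>i<N. c powi (- shape_seq lam i) * c powi int i) * schur t lam"
    by (simp add: prod.distrib)
  also have "(\<Prod>i<N. c powi (- shape_seq lam i) * c powi int i) = (\<Prod>i<N. c ^ part lam (Suc i))"
  proof (intro prod.cong refl)
    fix i
    have "c powi (- shape_seq lam i) * c powi int i = c powi (- shape_seq lam i + int i)"
      using power_int_add[of c "- shape_seq lam i" "int i"] assms(2) by simp
    also have "- shape_seq lam i + int i = int (part lam (Suc i))" by (simp add: shape_seq_def)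
    finally show "c powi (- shape_seq lam i) * c powi int i = c ^ part lam (Suc i)"
      by (simp only: power_int_of_nat)
  qed
  also have "\<dots> = c ^ psize lam" by (simp add: power_sum psize_eq N_def)
  finally show ?thesis .
qed

lemma schur_cong: "(\<And>n. n > 0 \<Longrightarrow> t n = t' n) \<Longrightarrow> schur t lam = schur t' lam"
proof -
  assume h: "\<And>n. n > 0 \<Longrightarrow> t n = t' n"
  have "shift_op t = shift_op t'"
    unfolding shift_op_def by (intro ext sum.cong) (auto simp: hops_def h)
  then show ?thesis by (simp add: schur_def)
qed

text \<open>By Jacobi-Trudi only finitely many \<open>t n\<close> enter, and polynomially, so
  convergence of each one suffices without uniformity in \<open>n\<close>.\<close>

lemma tendsto_schur:
  assumes "is_partition lam" "\<And>n. n > 0 \<Longrightarrow> ((\<lambda>x. t x n) \<longlongrightarrow> t' n) F"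
  shows "((\<lambda>x. schur (t x) lam) \<longlongrightarrow> schur t' lam) F"
proof -
  have gen: "((\<lambda>x. fps_nth (gen_fps (t x)) m) \<longlongrightarrow> fps_nth (gen_fps t') m) F" for m
    using assms(2)[of m] by (cases "m = 0") (simp_all add: gen_fps_def)
  have pow: "((\<lambda>x. fps_nth (gen_fps (t x) ^ k) m) \<longlongrightarrow> fps_nth (gen_fps t' ^ k) m) F" for k m
    by (induction k arbitrary: m) (auto simp: fps_mult_nth intro!: tendsto_intros gen)
  have "((\<lambda>x. hcoef (t x) m) \<longlongrightarrow> hcoef t' m) F" for m
    unfolding hcoef_def fps_compose_nth by (auto intro!: tendsto_intros pow)
  then show ?thesis
    unfolding jacobi_trudi[OF assms(1) order_refl] ndet_leibniz by (intro tendsto_intros)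
qed

section \<open>The symmetry of principal specializations\<close>

lemma alternant_nonzero:
  assumes "inj_on x {..<N}"
  shows "ndet N (\<lambda>i l. x l ^ (N - 1 - i)) \<noteq> (0 :: 'a :: idom)"
proof -
  have "ndet N (\<lambda>i l. x l ^ (N - 1 - i)) = ndet N (\<lambda>l i. x l ^ (N - 1 - i))"
    by (rule ndet_transpose)
  moreover have "ndet N (\<lambda>l i. x l ^ i) \<noteq> 0"
    unfolding vandermonde using assms by (auto dest: inj_onD)
  ultimately show ?thesis using ndet_reverse_columns_eq_0_iff[of N "\<lambda>l i. x l ^ i"] by simp
qed

text \<open>The finite versions are ratios of alternants in which the denominator of one factor cancels
  the numerator of the other; what remains is the determinant of the symmetric array of the
  \<open>q powi (- b l * c i)\<close>, with \<open>b l = l - lam l\<close> and \<open>c i = i - mu i\<close>.\<close>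

definition spec :: "complex \<Rightarrow> nat list \<Rightarrow> nat \<Rightarrow> complex" where
  "spec q lam l = q powi (int (Suc l) - int (part lam (Suc l)))"

lemma power_int_inj:
  fixes q :: complex
  assumes "0 < norm q" "norm q < 1" "q powi a = q powi b"
  shows "a = b"
proof -
  have "norm q powi a = norm q powi b" using assms(3) by (metis norm_power_int)
  then show ?thesis
    using assms(1,2) power_int_strict_decreasing[of a b "norm q"] power_int_strict_decreasing[of b a "norm q"]
    by (cases a b rule: linorder_cases) auto
qed

lemma inj_on_spec:
  assumes "0 < norm q" "norm q < 1" "is_partition lam"
  shows "inj_on (spec q lam) A"
proof (rule inj_onI)
  fix x y assume "spec q lam x = spec q lam y"
  then have "shape_seq lam x = shape_seq lam y"
    unfolding spec_def using power_int_inj[OF assms(1,2)] by (fastforce simp: shape_seq_def)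
  then show "x = y"
    using shape_seq_less[OF assms(3), of x y] shape_seq_less[OF assms(3), of y x]
    by (cases x y rule: linorder_cases) auto
qed

lemma schur_spec_symmetric_finite:
  assumes "0 < norm q" "norm q < 1" "is_partition lam" "is_partition mu"
    and "length lam \<le> N" "length mu \<le> N"
  defines "s \<equiv> \<lambda>nu rho. schur (\<lambda>n. power_sum N (spec q nu) n / of_nat n) rho"
  shows "s [] lam * s lam mu = s [] mu * s mu lam"
proof -
  define b where "b nu i = int (Suc i) - int (part nu (Suc i))" for nu i
  define E where "E nu = ndet N (\<lambda>i l. q powi (- (int (Suc i) * b nu l)))" for nu
  define D where "D nu rho = ndet N (\<lambda>i l. q powi (- (b nu l * b rho i)))" for nu rho
  \<comment> \<open>The exponents of an alternant are \<open>N - b rho i\<close>; \<open>R\<close>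
    collects the column factors due to \<open>N\<close>, and the symmetric array remains.\<close>
  define R where "R nu = (\<Prod>l<N. q powi (int N * b nu l))" for nu
  define V where "V nu = ndet N (\<lambda>i l. spec q nu l ^ (N - 1 - i))" for nu
  have q0: "q \<noteq> 0" using assms(1) by auto
  have R0: "R nu \<noteq> 0" for nu using q0 by (simp add: R_def)
  have pw: "spec q nu l ^ n = q powi (b nu l * int n)" for nu l n
    by (simp add: spec_def b_def power_int_mult power_int_of_nat)
  have alt: "ndet N (\<lambda>i l. spec q nu l ^ (N - 1 - i + part rho (Suc i))) = R nu * D nu rho"
    if "is_partition rho" for nu rho
  proof -
    have "ndet N (\<lambda>i l. spec q nu l ^ (N - 1 - i + part rho (Suc i))) =
        ndet N (\<lambda>i l. q powi (int N * b nu l) * q powi (- (b nu l * b rho i)))"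
    proof (rule ndet_cong)
      fix i l assume "i < N" "l < N"
      then have "b nu l * int (N - 1 - i + part rho (Suc i)) = int N * b nu l + - (b nu l * b rho i)"
        by (simp add: b_def[of rho] of_nat_diff algebra_simps)
      then show "spec q nu l ^ (N - 1 - i + part rho (Suc i)) =
          q powi (int N * b nu l) * q powi (- (b nu l * b rho i))"
        unfolding pw by (simp only: power_int_add[OF disjI1[OF q0]])
    qed
    then show ?thesis unfolding ndet_scale_columns R_def D_def .
  qed
  have b_Nil: "b [] i = int (Suc i)" for i by (simp add: b_def part_def)
  have "D nu rho = D rho nu" for nu rho
    unfolding D_def by (subst ndet_transpose[symmetric]) (simp add: mult.commute)
  note D_sym = this
  have DE: "D nu [] = E nu" for nu unfolding D_def E_def b_Nil by (simp add: mult.commute)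
  have V: "V nu = R nu * E nu" "V nu \<noteq> 0" if "is_partition nu" for nu
  proof -
    show "V nu = R nu * E nu"
      using alt[OF is_partition_Nil, of nu] by (simp add: V_def DE part_def)
    show "V nu \<noteq> 0"
      unfolding V_def by (rule alternant_nonzero[OF inj_on_spec[OF assms(1,2) that]])
  qed
  have s: "s nu rho * V nu = R nu * D nu rho" if "is_partition rho" "length rho \<le> N" for nu rho
    unfolding s_def V_def alt[OF that(1), symmetric] by (rule bialternant[OF that])
  have key: "s [] nu * s nu rho = R [] * D nu rho / V []"
    if "is_partition nu" "length nu \<le> N" "is_partition rho" "length rho \<le> N" for nu rho
  proof -
    have "s [] nu = R [] * E nu / V []"
      using s[OF that(1,2), of "[]"] V(2)[OF is_partition_Nil] D_sym[of "[]" nu] DE[of nu]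
      by (simp add: field_simps)
    moreover have "s nu rho = D nu rho / E nu"
      using s[OF that(3,4), of nu] V[OF that(1)] R0[of nu] by (simp add: field_simps)
    moreover have "E nu \<noteq> 0" using V[OF that(1)] by auto
    ultimately show ?thesis by simp
  qed
  show ?thesis using key[of lam mu] key[of mu lam] assms(3-6) D_sym[of lam mu] by simp
qed

text \<open>\<open>lam\<close> affects finitely many variables only; from \<open>length lam\<close>
  on the series is geometric.\<close>

lemma summable_spec:
  assumes "norm q < 1" "n > 0"
  shows "summable (\<lambda>l. spec q lam l ^ n)"
proof -
  have "spec q lam (l + length lam) = q ^ (l + Suc (length lam))" for l
    by (simp add: spec_def part_eq_0 power_int_def nat_add_distrib)
  then have "(\<lambda>l. spec q lam (l + length lam) ^ n) = (\<lambda>l. (q ^ n) ^ l * (q ^ n) ^ Suc (length lam))"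
    by (simp add: fun_eq_iff power_mult[symmetric] power_add[symmetric] mult.commute algebra_simps)
  moreover have "norm (q ^ n) < 1" using assms by (simp add: norm_power power_less_one_iff)
  then have "summable (\<lambda>l. (q ^ n) ^ l * (q ^ n) ^ Suc (length lam))"
    by (intro summable_mult2 summable_geometric)
  ultimately have "summable (\<lambda>l. spec q lam (l + length lam) ^ n)" by simp
  then show ?thesis by (rule summable_iff_shift[THEN iffD1])
qed

definition spec_sum :: "complex \<Rightarrow> nat list \<Rightarrow> nat \<Rightarrow> complex" where
  "spec_sum q lam n = suminf (\<lambda>l. spec q lam l ^ n)"

lemma schur_spec_tendsto:
  assumes "norm q < 1" "is_partition mu"
  shows "(\<lambda>N. schur (\<lambda>n. power_sum N (spec q lam) n / of_nat n) mu) \<longlonglongrightarrow>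
    schur (\<lambda>n. spec_sum q lam n / of_nat n) mu"
proof (rule tendsto_schur[OF assms(2)])
  fix n :: nat assume "n > 0"
  have "(\<lambda>N. power_sum N (spec q lam) n) \<longlonglongrightarrow> spec_sum q lam n"
    unfolding power_sum_def spec_sum_def by (rule summable_LIMSEQ[OF summable_spec[OF assms(1) \<open>n > 0\<close>]])
  then show "(\<lambda>N. power_sum N (spec q lam) n / of_nat n) \<longlonglongrightarrow> spec_sum q lam n / of_nat n"
    using \<open>n > 0\<close> by (intro tendsto_intros) auto
qed

lemma schur_spec_symmetric:
  assumes "0 < norm q" "norm q < 1" "is_partition lam" "is_partition mu"
  defines "s \<equiv> \<lambda>nu rho. schur (\<lambda>n. spec_sum q nu n / of_nat n) rho"
  shows "s [] lam * s lam mu = s [] mu * s mu lam"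
proof -
  let ?s = "\<lambda>N nu rho. schur (\<lambda>n. power_sum N (spec q nu) n / of_nat n) rho"
  have lim: "(\<lambda>N. ?s N [] nu * ?s N nu rho) \<longlonglongrightarrow> s [] nu * s nu rho"
    if "is_partition nu" "is_partition rho" for nu rho
    unfolding s_def by (intro tendsto_mult schur_spec_tendsto assms(2) that)
  have "\<forall>\<^sub>F N in sequentially. ?s N [] mu * ?s N mu lam = ?s N [] lam * ?s N lam mu"
    using eventually_ge_at_top[of "max (length lam) (length mu)"]
    by eventually_elim (rule schur_spec_symmetric_finite[OF assms(1,2,4,3)], auto)
  from Lim_transform_eventually[OF lim[OF assms(4,3)] this]
  show ?thesis by (rule LIMSEQ_unique[OF lim[OF assms(3,4)]])
qed

section \<open>The infinite products\<close>

text \<open>A value of \<open>prodinf\<close> rests on a nonzero limit of partial products, so each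
  limit below is proved together with its nonvanishing.\<close>

lemma prodinf_eqI:
  fixes f :: "nat \<Rightarrow> complex"
  assumes "(\<lambda>n. \<Prod>i<n. f i) \<longlonglongrightarrow> p" "p \<noteq> 0"
  shows "prodinf f = p"
proof -
  have "(\<lambda>n. \<Prod>i\<le>n. f i) \<longlonglongrightarrow> p"
    using LIMSEQ_Suc[OF assms(1)] by (simp add: lessThan_Suc_atMost)
  then have "f has_prod p"
    unfolding has_prod_def raw_has_prod_def using assms(2) by simp
  then show ?thesis by (rule has_prod_unique[symmetric])
qed

text \<open>The bounds depend on the radius \<open>r\<close> because the series below are controlled
  locally uniformly only. For a given point, \<open>r\<close> is taken midway between its norm and
  1.\<close>

lemma
  fixes f :: "nat \<Rightarrow> complex \<Rightarrow> complex"
  assumes hol: "\<And>n. f n holomorphic_on ball 0 1"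
    and bound: "\<And>r. 0 < r \<Longrightarrow> r < 1 \<Longrightarrow> summable (b r)"
      "\<And>r n z. 0 < r \<Longrightarrow> r < 1 \<Longrightarrow> norm z \<le> r \<Longrightarrow> norm (f n z) \<le> b r n"
  shows holomorphic_on_suminf_disc: "(\<lambda>z. suminf (\<lambda>n. f n z)) holomorphic_on ball 0 1"
    and summable_disc: "norm z < 1 \<Longrightarrow> summable (\<lambda>n. f n z)"
proof -
  show "(\<lambda>z. suminf (\<lambda>n. f n z)) holomorphic_on ball 0 1"
  proof (rule holomorphic_uniform_sequence[where f = "\<lambda>n z. \<Sum>i<n. f i z"])
    show "(\<lambda>z. \<Sum>i<n. f i z) holomorphic_on ball 0 1" for n by (intro holomorphic_intros hol)
    fix x :: complex assume "x \<in> ball 0 1"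
    then have x: "norm x < 1" by simp
    define d where "d = (1 - norm x) / 2"
    define r where "r = norm x + d"
    have d: "d > 0" and r: "0 < r" "r < 1"
      using x norm_ge_zero[of x] by (simp_all add: d_def r_def field_simps del: norm_ge_zero)
    have le: "norm z \<le> r" if "z \<in> cball x d" for z
    proof -
      have "norm z \<le> norm x + norm (z - x)" by (metis add.commute diff_add_cancel norm_triangle_ineq)
      also have "norm (z - x) \<le> d" using that by (simp add: dist_norm norm_minus_commute)
      finally show ?thesis by (simp add: r_def)
    qed
    have "uniform_limit (cball x d) (\<lambda>n z. \<Sum>i<n. f i z) (\<lambda>z. suminf (\<lambda>i. f i z)) sequentially"
      by (rule Weierstrass_m_test[of _ _ "b r"]) (use bound r le in auto)
    moreover have "cball x d \<subseteq> ball 0 1" using le r(2) by fastforce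
    ultimately show "\<exists>d>0. cball x d \<subseteq> ball 0 1 \<and>
        uniform_limit (cball x d) (\<lambda>n z. \<Sum>i<n. f i z) (\<lambda>z. suminf (\<lambda>i. f i z)) sequentially"
      using d by blast
  qed simp
  assume z: "norm z < 1"
  define r where "r = (1 + norm z) / 2"
  have r: "0 < r" "r < 1" "norm z \<le> r"
    using z norm_ge_zero[of z] by (simp_all add: r_def field_simps del: norm_ge_zero)
  show "summable (\<lambda>n. f n z)"
    by (rule summable_comparison_test'[OF bound(1)[OF r(1,2)], of 0]) (rule bound(2)[OF r])
qed

section \<open>Logarithms of the infinite products\<close>

definition log_factor :: "nat \<Rightarrow> complex \<Rightarrow> complex" where
  "log_factor d z = - Ln (1 - z ^ Suc d)"

text \<open>The logarithm of row \<open>i\<close> of the hook product of the empty diagram. Summed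
  over \<open>i\<close>, the factor \<open>d\<close> occurs \<open>Suc d\<close> times, which gives
  the exponents of the MacMahon function.\<close>

definition log_tail :: "nat \<Rightarrow> complex \<Rightarrow> complex" where
  "log_tail i z = suminf (\<lambda>d. log_factor (d + i) z)"

text \<open>The logarithm of the MacMahon function \<open>\<Prod>n>0. (1 - z ^ n) powi (- n)\<close>; it provides the
  holomorphic square root.\<close>

definition log_macmahon :: "complex \<Rightarrow> complex" where
  "log_macmahon z = suminf (\<lambda>i. log_tail i z)"

lemma power_Suc_norm_less_1: "norm (z :: complex) < 1 \<Longrightarrow> norm (z ^ Suc d) < 1"
  unfolding norm_power by (rule power_less_one_iff[THEN iffD2]) auto

lemma one_minus_power_nonzero: "norm (z :: complex) < 1 \<Longrightarrow> 1 - z ^ Suc d \<noteq> 0"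
  using power_Suc_norm_less_1[of z d] by auto

lemma exp_log_factor: "norm z < 1 \<Longrightarrow> exp (- log_factor d z) = 1 - z ^ Suc d"
  using one_minus_power_nonzero[of z d] by (simp add: log_factor_def)

lemma norm_log_factor:
  assumes "0 < r" "r < 1" "norm z \<le> r"
  shows "norm (log_factor d z) \<le> r ^ Suc d / (1 - r)"
proof -
  define w where "w = - (z ^ Suc d)"
  have wr: "norm w \<le> r ^ Suc d"
    unfolding w_def norm_minus_cancel norm_power using assms by (intro power_mono) auto
  have "r ^ Suc d \<le> r" using assms by (simp add: mult_left_le power_le_one)
  with wr have w: "norm w \<le> r" by (rule order_trans)
  with assms(2) have w1: "norm w < 1" by simp
  have "norm (Ln (1 + w)) \<le> norm (Ln (1 + w) - w) + norm w"
    by (metis diff_add_cancel norm_triangle_ineq)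
  also have "\<dots> \<le> (norm w)\<^sup>2 / (1 - norm w) + norm w" using Ln_approx_linear[OF w1] by simp
  also have "\<dots> = norm w / (1 - norm w)" using w1 by (simp add: field_simps power2_eq_square)
  also have "\<dots> \<le> r ^ Suc d / (1 - r)" by (rule frac_le) (use wr w assms in simp_all)
  finally show ?thesis by (simp add: log_factor_def w_def)
qed

lemma holomorphic_log_factor: "log_factor d holomorphic_on ball 0 1"
proof -
  have "1 - z ^ Suc d \<notin> \<real>\<^sub>\<le>\<^sub>0" if "z \<in> ball 0 1" for z :: complex
  proof -
    have "Re (z ^ Suc d) < 1"
      using complex_Re_le_cmod[of "z ^ Suc d"] power_Suc_norm_less_1[of z d] that by simp
    then have "Re (1 - z ^ Suc d) > 0" by simp
    then show ?thesis using complex_nonpos_Reals_iff by auto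
  qed
  then show ?thesis unfolding log_factor_def by (intro holomorphic_intros) auto
qed

lemma summable_geometric_bound:
  fixes r :: real
  assumes "0 < r" "r < 1"
  shows "summable (\<lambda>d. r ^ Suc (d + i) / c)" "suminf (\<lambda>d. r ^ Suc (d + i) / c) = r ^ Suc i / (1 - r) / c"
proof -
  have eq: "(\<lambda>d. r ^ Suc (d + i) / c) = (\<lambda>d. r ^ d * (r ^ Suc i / c))"
    by (simp add: fun_eq_iff power_add)
  show "summable (\<lambda>d. r ^ Suc (d + i) / c)"
    unfolding eq by (intro summable_mult2 summable_geometric) (use assms in auto)
  show "suminf (\<lambda>d. r ^ Suc (d + i) / c) = r ^ Suc i / (1 - r) / c"
    unfolding eq using assms by (subst suminf_mult2[symmetric]) (auto simp: suminf_geometric intro: summable_geometric)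
qed

lemma summable_log_factor: "norm z < 1 \<Longrightarrow> summable (\<lambda>d. log_factor (d + i) z)"
  by (rule summable_disc[where b = "\<lambda>r d. r ^ Suc (d + i) / (1 - r)"])
    (assumption | intro holomorphic_log_factor summable_geometric_bound norm_log_factor)+

lemma holomorphic_log_tail: "log_tail i holomorphic_on ball 0 1"
  unfolding log_tail_def
  by (rule holomorphic_on_suminf_disc[where b = "\<lambda>r d. r ^ Suc (d + i) / (1 - r)"])
    (assumption | intro holomorphic_log_factor summable_geometric_bound norm_log_factor)+

lemma norm_log_tail:
  assumes "0 < r" "r < 1" "norm z \<le> r"
  shows "norm (log_tail i z) \<le> r ^ Suc i / (1 - r) / (1 - r)"
  unfolding log_tail_def summable_geometric_bound(2)[OF assms(1,2), symmetric]
  by (rule norm_suminf_le) (intro norm_log_factor assms, rule summable_geometric_bound[OF assms(1,2)])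

lemma summable_square_bound:
  fixes r :: real
  assumes "0 < r" "r < 1"
  shows "summable (\<lambda>i. r ^ Suc i / (1 - r) / (1 - r))"
  using summable_divide[OF summable_geometric_bound(1)[OF assms, of 0 "1 - r"], of "1 - r"] by simp

lemma summable_log_tail: "norm z < 1 \<Longrightarrow> summable (\<lambda>i. log_tail i z)"
  by (rule summable_disc[where b = "\<lambda>r i. r ^ Suc i / (1 - r) / (1 - r)"])
    (intro holomorphic_log_tail summable_square_bound norm_log_tail; assumption)+

lemma holomorphic_log_macmahon: "log_macmahon holomorphic_on ball 0 1"
  unfolding log_macmahon_def
  by (rule holomorphic_on_suminf_disc[where b = "\<lambda>r i. r ^ Suc i / (1 - r) / (1 - r)"])
    (intro holomorphic_log_tail summable_square_bound norm_log_tail; assumption)+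

lemma Reals_suminf:
  fixes f :: "nat \<Rightarrow> complex"
  assumes "\<And>n. f n \<in> \<real>" "summable f"
  shows "suminf f \<in> \<real>"
proof -
  have "(\<lambda>n. \<Sum>i<n. f i) \<longlonglongrightarrow> suminf f" by (rule summable_LIMSEQ[OF assms(2)])
  moreover have "(\<Sum>i<n. f i) \<in> \<real>" for n using assms(1) by (rule sum_in_Reals)
  ultimately show ?thesis
    using closed_complex_Reals by (metis closed_sequential_limits)
qed

lemma log_macmahon_real:
  assumes "0 < x" "x < 1"
  shows "log_macmahon (complex_of_real x) \<in> \<real>"
proof -
  have x: "norm (complex_of_real x) < 1" using assms by simp
  have "log_factor d (complex_of_real x) \<in> \<real>" for d
  proof -
    have "x ^ Suc d < 1" by (rule power_Suc_less_one[OF assms])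
    then have "Ln (complex_of_real (1 - x ^ Suc d)) \<in> \<real>"
      by (subst Ln_of_real) auto
    then show ?thesis by (simp add: log_factor_def)
  qed
  then show ?thesis
    unfolding log_macmahon_def log_tail_def
    using summable_log_factor[OF x] summable_log_tail[OF x, unfolded log_tail_def]
    by (intro Reals_suminf) auto
qed

section \<open>The q-Pochhammer symbols (z; z) of finite and infinite length\<close>

definition qfact :: "complex \<Rightarrow> nat \<Rightarrow> complex" where
  "qfact z n = (\<Prod>d<n. 1 - z ^ Suc d)"

lemma qfact_0 [simp]: "qfact z 0 = 1"
  by (simp add: qfact_def)

lemma qfact_Suc: "qfact z (Suc n) = qfact z n * (1 - z ^ Suc n)"
  by (simp add: qfact_def)

lemma qfact_nonzero: "norm z < 1 \<Longrightarrow> qfact z n \<noteq> 0"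
  using one_minus_power_nonzero by (simp add: qfact_def)

definition qinf :: "complex \<Rightarrow> complex" where
  "qinf z = exp (- log_tail 0 z)"

lemma qinf_nonzero [simp]: "qinf z \<noteq> 0"
  by (simp add: qinf_def)

lemma qfact_eq_exp: "norm z < 1 \<Longrightarrow> qfact z n = exp (- (\<Sum>d<n. log_factor d z))"
  by (simp add: qfact_def exp_log_factor exp_sum sum_negf[symmetric])

lemma qfact_tendsto: "norm z < 1 \<Longrightarrow> qfact z \<longlonglongrightarrow> qinf z"
proof -
  assume z: "norm z < 1"
  have "(\<lambda>n. exp (- (\<Sum>d<n. log_factor d z))) \<longlonglongrightarrow> qinf z"
    unfolding qinf_def log_tail_def
    using summable_LIMSEQ[OF summable_log_factor[OF z, of 0]] by (intro tendsto_intros) simp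
  then show "qfact z \<longlonglongrightarrow> qinf z" unfolding qfact_eq_exp[OF z, symmetric] .
qed

lemma qfact_div_qinf:
  assumes "norm z < 1"
  shows "qfact z n / qinf z = exp (log_tail n z)"
proof -
  have "log_tail 0 z = log_tail n z + (\<Sum>d<n. log_factor d z)"
    unfolding log_tail_def
    using suminf_split_initial_segment[OF summable_log_factor[OF assms, of 0], of n] by simp
  then show ?thesis
    by (simp add: qfact_eq_exp[OF assms] qinf_def exp_diff[symmetric])
qed

lemma prod_qfact_tendsto:
  assumes "norm z < 1"
  shows "(\<lambda>N. \<Prod>i<N. qfact z i / qinf z) \<longlonglongrightarrow> exp (log_macmahon z)"
proof -
  have "(\<lambda>N. exp (\<Sum>i<N. log_tail i z)) \<longlonglongrightarrow> exp (log_macmahon z)"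
    unfolding log_macmahon_def by (intro tendsto_intros summable_LIMSEQ summable_log_tail assms)
  then show ?thesis by (simp add: qfact_div_qinf[OF assms] exp_sum)
qed

lemma qfact_ratio_tendsto:
  assumes "norm z < 1"
  shows "(\<lambda>n. qfact z (n + a) / qfact z n) \<longlonglongrightarrow> 1"
proof -
  have "(\<lambda>n. qfact z (n + a) / qfact z n) \<longlonglongrightarrow> qinf z / qinf z"
    by (intro tendsto_divide LIMSEQ_ignore_initial_segment qfact_tendsto assms) simp
  then show ?thesis by simp
qed

text \<open>Two admissible roots agree up to sign at each point of the interval from 0 to 1, and
  positivity excludes the minus sign there. As this interval accumulates at 1/2, the identity
  theorem extends the equality to the disc.\<close>

lemma disc_sqrt_eq:
  assumes hol: "f holomorphic_on ball 0 1"
    and sq: "\<And>z. norm z < 1 \<Longrightarrow> z \<noteq> 0 \<Longrightarrow> (f z)\<^sup>2 = g z"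
    and pos: "\<And>x::real. 0 < x \<Longrightarrow> x < 1 \<Longrightarrow> f (of_real x) \<in> \<real> \<and> 0 < Re (f (of_real x))"
    and q: "norm q < 1"
  shows "disc_sqrt g q = f q"
  unfolding disc_sqrt_def
proof (rule the_equality)
  show "\<exists>f'. f' holomorphic_on ball 0 1 \<and> (\<forall>z\<in>ball 0 1 - {0}. (f' z)\<^sup>2 = g z) \<and>
     (\<forall>x::real. 0 < x \<and> x < 1 \<longrightarrow> f' (of_real x) \<in> \<real> \<and> 0 < Re (f' (of_real x))) \<and> f q = f' q"
    using assms by (intro exI[of _ f]) auto
next
  fix w
  assume "\<exists>f. f holomorphic_on ball 0 1 \<and> (\<forall>z\<in>ball 0 1 - {0}. (f z)\<^sup>2 = g z) \<and>
     (\<forall>x::real. 0 < x \<and> x < 1 \<longrightarrow> f (of_real x) \<in> \<real> \<and> 0 < Re (f (of_real x))) \<and> w = f q"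
  then obtain h where h: "h holomorphic_on ball 0 1" "\<And>z. z \<in> ball 0 1 - {0} \<Longrightarrow> (h z)\<^sup>2 = g z"
    "\<And>x::real. 0 < x \<Longrightarrow> x < 1 \<Longrightarrow> h (of_real x) \<in> \<real> \<and> 0 < Re (h (of_real x))" "w = h q" by blast
  define U where "U = complex_of_real ` {0<..<1}"
  have "h z - f z = 0" if zU: "z \<in> U" for z
  proof -
    obtain x where x: "z = complex_of_real x" "0 < x" "x < 1" using zU by (auto simp: U_def)
    then have "(h z)\<^sup>2 = (f z)\<^sup>2" using h(2)[of z] sq[of z] by simp
    then have "h z = f z \<or> h z = - f z" by (simp add: power2_eq_iff)
    moreover have "h z \<noteq> - f z" using h(3)[OF x(2,3)] pos[OF x(2,3)] unfolding x(1) by auto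
    ultimately show ?thesis by simp
  qed
  moreover have "(1/2 :: complex) islimpt U"
  proof -
    have "(1/2 :: real) islimpt {0<..<1}" by (simp add: islimpt_greaterThanLessThan1 interior_limit_point)
    then have "\<exists>s. (\<forall>n. s n \<in> {0<..<1} - {1/2}) \<and> s \<longlonglongrightarrow> (1/2 :: real)" by (simp add: islimpt_sequential)
    then obtain s where s: "\<And>n. s n \<in> {0<..<1} - {1/2}" "s \<longlonglongrightarrow> (1/2 :: real)" by blast
    have "complex_of_real (s n) \<in> U - {1/2}" for n
    proof -
      have "complex_of_real (s n) \<noteq> complex_of_real (1/2)" using s(1)[of n] by (subst of_real_eq_iff) auto
      then show ?thesis using s(1)[of n] by (auto simp: U_def)
    qed
    moreover have "(\<lambda>n. complex_of_real (s n)) \<longlonglongrightarrow> 1/2" using tendsto_of_real[OF s(2), where 'a = complex] by simp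
    ultimately show ?thesis
      unfolding islimpt_sequential by (intro exI[of _ "\<lambda>n. complex_of_real (s n)"]) simp
  qed
  moreover have "U \<subseteq> ball 0 1" by (auto simp: U_def)
  moreover have "(1/2 :: complex) \<in> ball 0 1" by (simp add: dist_norm)
  ultimately have "h q - f q = 0"
    using analytic_continuation[of "\<lambda>z. h z - f z" "ball 0 1" U "1/2" q] h(1) hol q
    by (auto intro!: holomorphic_on_diff)
  then show "w = f q" using h(4) by simp
qed

section \<open>The Frobenius formula\<close>

text \<open>The Vandermonde product of the numbers \<open>z ^ beta N lam i\<close>, freed of its
  monomial factors. For a partition the truncated subtractions are exact.\<close>

definition vdm_prod :: "complex \<Rightarrow> nat list \<Rightarrow> nat \<Rightarrow> complex" where
  "vdm_prod z lam N = (\<Prod>j<N. \<Prod>k<j. 1 - z ^ (part lam (Suc k) - part lam (Suc j) + (j - k)))"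

text \<open>The beta numbers; for a partition and \<open>N = length lam\<close> they are the hook
  lengths in the first column.\<close>

definition beta :: "nat \<Rightarrow> nat list \<Rightarrow> nat \<Rightarrow> nat" where
  "beta N lam i = N - 1 - i + part lam (Suc i)"

text \<open>By Frobenius' formula, this is the inverse of the product of \<open>1 - z ^ h\<close> over the hook lengths.
  The length may be replaced by any larger number, see \<open>vdm_prod_eq\<close>.\<close>

definition frobenius :: "complex \<Rightarrow> nat list \<Rightarrow> complex" where
  "frobenius z lam = vdm_prod z lam (length lam) /
     (\<Prod>i<length lam. qfact z (beta (length lam) lam i))"

text \<open>In the usual notation n(lam) + |lam|; the summand |lam| is due to variables that start
  with \<open>q\<close> and not with 1.\<close>

definition weight :: "nat list \<Rightarrow> nat" where
  "weight lam = (\<Sum>i<length lam. Suc i * part lam (Suc i))"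

text \<open>A further zero part raises every beta number by one and adds the beta number 0. The new
  factors of the Vandermonde product are precisely those by which the \<open>qfact\<close>
  grow.\<close>

lemma vdm_prod_eq:
  assumes "norm z < 1" "length lam \<le> N"
  shows "vdm_prod z lam N = frobenius z lam * (\<Prod>i<N. qfact z (beta N lam i))"
  using assms(2)
proof (induction N rule: dec_induct)
  case base
  show ?case using qfact_nonzero[OF assms(1)] by (simp add: frobenius_def)
next
  case (step N)
  have "vdm_prod z lam (Suc N) = vdm_prod z lam N * (\<Prod>k<N. 1 - z ^ (part lam (Suc k) + (N - k)))"
    using part_eq_0[of lam "Suc N"] step.hyps by (simp add: vdm_prod_def)
  also have "(\<Prod>k<N. 1 - z ^ (part lam (Suc k) + (N - k))) = (\<Prod>k<N. 1 - z ^ Suc (beta N lam k))"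
    by (intro prod.cong refl) (simp add: beta_def Suc_diff_Suc add.commute Suc_diff_le[symmetric] algebra_simps)
  finally have "vdm_prod z lam (Suc N) = frobenius z lam *
      (\<Prod>k<N. qfact z (beta N lam k) * (1 - z ^ Suc (beta N lam k)))"
    by (simp only: step.IH prod.distrib mult.assoc)
  also have "(\<Prod>k<N. qfact z (beta N lam k) * (1 - z ^ Suc (beta N lam k))) =
      (\<Prod>k<N. qfact z (beta (Suc N) lam k))"
  proof (intro prod.cong refl)
    fix k assume "k \<in> {..<N}"
    then have "beta (Suc N) lam k = Suc (beta N lam k)" by (simp add: beta_def)
    then show "qfact z (beta N lam k) * (1 - z ^ Suc (beta N lam k)) = qfact z (beta (Suc N) lam k)"
      by (simp only: qfact_Suc)
  qed
  also have "\<dots> = (\<Prod>k<Suc N. qfact z (beta (Suc N) lam k))"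
    using part_eq_0[of lam "Suc N"] step.hyps by (simp add: beta_def)
  finally show ?case .
qed

text \<open>An iterated power of \<open>z\<close> is symmetric in its exponents, so the alternant in
  the powers \<open>z ^ Suc l\<close> is also a Vandermonde determinant in the numbers
  \<open>z ^ beta N lam i\<close>, after one factor is taken out of each row.\<close>

lemma alternant_powers:
  assumes "is_partition lam"
  shows "ndet N (\<lambda>i l. (z ^ Suc l) ^ beta N lam i) = (\<Prod>i<N. z ^ (Suc i * beta N lam i)) * vdm_prod z lam N"
proof -
  have "ndet N (\<lambda>i l. (z ^ Suc l) ^ beta N lam i) =
      ndet N (\<lambda>i l. z ^ beta N lam i * (z ^ beta N lam i) ^ l)"
    by (intro ndet_cong) (simp add: power_mult_distrib mult.commute flip: power_mult)
  also have "\<dots> = (\<Prod>i<N. z ^ beta N lam i) * (\<Prod>j<N. \<Prod>k<j. z ^ beta N lam j - z ^ beta N lam k)"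
    unfolding ndet_scale_rows vandermonde ..
  also have "(\<Prod>j<N. \<Prod>k<j. z ^ beta N lam j - z ^ beta N lam k) =
      (\<Prod>j<N. z ^ (j * beta N lam j) * (\<Prod>k<j. 1 - z ^ (part lam (Suc k) - part lam (Suc j) + (j - k))))"
  proof (intro prod.cong refl)
    fix j assume "j \<in> {..<N}"
    have "(\<Prod>k<j. z ^ beta N lam j - z ^ beta N lam k) =
        (\<Prod>k<j. z ^ beta N lam j * (1 - z ^ (part lam (Suc k) - part lam (Suc j) + (j - k))))"
    proof (intro prod.cong refl)
      fix k assume "k \<in> {..<j}"
      then have "beta N lam k = beta N lam j + (part lam (Suc k) - part lam (Suc j) + (j - k))"
        using part_antimono[OF assms, of "Suc k" "Suc j"] \<open>j \<in> {..<N}\<close> by (simp add: beta_def)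
      then show "z ^ beta N lam j - z ^ beta N lam k =
          z ^ beta N lam j * (1 - z ^ (part lam (Suc k) - part lam (Suc j) + (j - k)))"
        by (simp add: power_add algebra_simps)
    qed
    then show "(\<Prod>k<j. z ^ beta N lam j - z ^ beta N lam k) =
        z ^ (j * beta N lam j) * (\<Prod>k<j. 1 - z ^ (part lam (Suc k) - part lam (Suc j) + (j - k)))"
      by (simp add: prod.distrib mult.commute flip: power_mult)
  qed
  finally show ?thesis
    by (simp add: vdm_prod_def prod.distrib power_add mult.assoc)
qed

lemma vdm_prod_Nil: "vdm_prod z [] N = (\<Prod>j<N. qfact z j)"
  unfolding vdm_prod_def qfact_def
proof (rule prod.cong[OF refl])
  fix j
  show "(\<Prod>k<j. 1 - z ^ (part [] (Suc k) - part [] (Suc j) + (j - k))) = (\<Prod>d<j. 1 - z ^ Suc d)"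
    by (rule prod.reindex_bij_witness[of _ "\<lambda>d. j - 1 - d" "\<lambda>k. j - 1 - k"])
      (auto simp: part_def Suc_diff_Suc)
qed

lemma prod_qfact_rev: "(\<Prod>i<N. qfact z (N - 1 - i)) = (\<Prod>i<N. qfact z i)"
  by (rule prod.reindex_bij_witness[of _ "\<lambda>d. N - 1 - d" "\<lambda>k. N - 1 - k"]) auto

lemma schur_principal_finite:
  assumes "0 < norm z" "norm z < 1" "is_partition lam" "length lam \<le> N"
  shows "schur (\<lambda>n. power_sum N (spec z []) n / of_nat n) lam =
    z ^ weight lam * frobenius z lam *
      (\<Prod>i<N. qfact z (beta N lam i) / qfact z (N - 1 - i))"
proof -
  have z0: "z \<noteq> 0" using assms(1) by auto
  define X where "X nu = (\<Prod>i<N. z ^ (Suc i * beta N nu i))" for nu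
  have spec: "spec z [] l = z ^ Suc l" for l
    unfolding spec_def by (simp add: part_def power_int_def nat_add_distrib)
  have alt: "ndet N (\<lambda>i l. spec z [] l ^ (N - 1 - i + part nu (Suc i))) = X nu * vdm_prod z nu N"
    if "is_partition nu" for nu
    using alternant_powers[OF that, where N = N and z = z] by (simp only: spec X_def beta_def)
  have V: "ndet N (\<lambda>i l. spec z [] l ^ (N - 1 - i)) = X [] * vdm_prod z [] N"
    using alt[OF is_partition_Nil] by (simp add: part_def)
  have X: "X lam = X [] * z ^ weight lam"
  proof -
    have "X lam = (\<Prod>i<N. z ^ (Suc i * beta N [] i) * z ^ (Suc i * part lam (Suc i)))"
    proof -
      have "beta N lam i = beta N [] i + part lam (Suc i)" for i
        by (simp add: beta_def part_def[of "[]"])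
      then show ?thesis unfolding X_def by (simp only: distrib_left power_add)
    qed
    also have "\<dots> = X [] * z ^ (\<Sum>i<N. Suc i * part lam (Suc i))"
      unfolding X_def prod.distrib power_sum ..
    also have "(\<Sum>i<N. Suc i * part lam (Suc i)) = weight lam"
      unfolding weight_def by (rule sum_part_extend[OF assms(4)]) simp
    finally show ?thesis .
  qed
  have nz: "X [] \<noteq> 0" "vdm_prod z [] N \<noteq> 0"
    using z0 qfact_nonzero[OF assms(2)] by (simp_all add: X_def vdm_prod_Nil)
  have "schur (\<lambda>n. power_sum N (spec z []) n / of_nat n) lam * (X [] * vdm_prod z [] N) =
      X lam * vdm_prod z lam N"
    using bialternant[OF assms(3,4), of "spec z []"] unfolding V alt[OF assms(3)] .
  then have "schur (\<lambda>n. power_sum N (spec z []) n / of_nat n) lam =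
      z ^ weight lam * (vdm_prod z lam N / vdm_prod z [] N)"
    using nz by (simp add: X field_simps)
  also have "vdm_prod z lam N / vdm_prod z [] N = frobenius z lam *
      (\<Prod>i<N. qfact z (beta N lam i) / qfact z (N - 1 - i))"
    unfolding vdm_prod_eq[OF assms(2,4)] vdm_prod_Nil prod_dividef prod_qfact_rev by simp
  finally show ?thesis by (simp only: mult.assoc)
qed

text \<open>The number of factors grows with \<open>N\<close>, but those from \<open>L\<close> on
  are 1, so no uniformity is required.\<close>

lemma prod_tendsto_1:
  fixes r :: "nat \<Rightarrow> nat \<Rightarrow> complex"
  assumes "\<And>i. (\<lambda>N. r N i) \<longlonglongrightarrow> 1" "\<And>N i. L \<le> i \<Longrightarrow> r N i = 1"
  shows "(\<lambda>N. \<Prod>i<N. r N i) \<longlonglongrightarrow> 1"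
proof -
  have "(\<lambda>N. \<Prod>i<L. r N i) \<longlonglongrightarrow> (\<Prod>i<L. 1)"
    by (intro tendsto_prod assms(1))
  moreover have "\<forall>\<^sub>F N in sequentially. (\<Prod>i<L. r N i) = (\<Prod>i<N. r N i)"
    using eventually_ge_at_top[of L]
    by eventually_elim (rule prod.mono_neutral_left, use assms(2) in auto)
  ultimately show ?thesis by (auto elim: Lim_transform_eventually)
qed

lemma beta_ratio_tendsto:
  assumes "norm z < 1"
  shows "(\<lambda>N. \<Prod>i<N. qfact z (beta N lam i) / qfact z (N - 1 - i)) \<longlonglongrightarrow> 1"
proof (rule prod_tendsto_1[where L = "length lam"])
  fix i
  have "(\<lambda>N. qfact z (beta (N + Suc i) lam i) / qfact z (N + Suc i - 1 - i)) \<longlonglongrightarrow> 1"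
    using qfact_ratio_tendsto[OF assms, of "part lam (Suc i)"] by (simp add: beta_def)
  then show "(\<lambda>N. qfact z (beta N lam i) / qfact z (N - 1 - i)) \<longlonglongrightarrow> 1" by (rule LIMSEQ_offset)
next
  fix N i assume "length lam \<le> i"
  then show "qfact z (beta N lam i) / qfact z (N - 1 - i) = 1"
    using qfact_nonzero[OF assms] part_eq_0[of lam "Suc i"] by (simp add: beta_def)
qed

text \<open>The specialization at \<open>z, z ^ 2, ...\<close>; together with
  \<open>norm_bra_eq\<close> it exhibits the normalization as a Schur function.\<close>

lemma schur_principal:
  assumes "0 < norm z" "norm z < 1" "is_partition lam"
  shows "schur (\<lambda>n. spec_sum z [] n / of_nat n) lam = z ^ weight lam * frobenius z lam"
proof -
  have "(\<lambda>N. z ^ weight lam * frobenius z lam *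
      (\<Prod>i<N. qfact z (beta N lam i) / qfact z (N - 1 - i))) \<longlonglongrightarrow> z ^ weight lam * frobenius z lam * 1"
    by (intro tendsto_intros beta_ratio_tendsto assms)
  moreover have "\<forall>\<^sub>F N in sequentially. z ^ weight lam * frobenius z lam *
      (\<Prod>i<N. qfact z (beta N lam i) / qfact z (N - 1 - i)) =
      schur (\<lambda>n. power_sum N (spec z []) n / of_nat n) lam"
    using eventually_ge_at_top[of "length lam"]
    by eventually_elim (rule schur_principal_finite[OF assms, symmetric])
  ultimately have "(\<lambda>N. schur (\<lambda>n. power_sum N (spec z []) n / of_nat n) lam) \<longlonglongrightarrow>
      z ^ weight lam * frobenius z lam * 1"
    by (rule Lim_transform_eventually)
  then show ?thesis using LIMSEQ_unique[OF schur_spec_tendsto[OF assms(2,3), of "[]"]] by simp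
qed

section \<open>The hook product\<close>

definition hook_factor :: "complex \<Rightarrow> nat list \<Rightarrow> nat \<Rightarrow> nat \<Rightarrow> complex" where
  "hook_factor z lam i j = inverse (1 - z powi (- int (part lam (Suc i)) - int (part (conjugate lam) (Suc j))
        + int (Suc i) + int (Suc j) - 1))"

lemma hook_prod_eq: "hook_prod lam z = prodinf (\<lambda>i. prodinf (hook_factor z lam i))"
  unfolding hook_prod_def hook_factor_def ..

text \<open>The exponents in row \<open>i\<close> are the differences of the \<open>i\<close>-th element of the Maya diagram and
  the elements of its complement.\<close>

lemma hook_factor_shape:
  "hook_factor z lam i j =
    inverse (1 - z powi (shape_seq lam i - (- 1 - shape_seq (conjugate lam) j)))"
  by (simp add: hook_factor_def shape_seq_def algebra_simps)

text \<open>The interval splits into particles and holes. Both images lie in it and are disjoint,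
  and the count \<open>N + M\<close> shows that nothing is missed.\<close>

lemma shape_interval:
  assumes "is_partition lam" "length lam \<le> N" "part lam 1 \<le> M"
  shows "{- int M..<int N} = shape_seq lam ` {..<N} \<union> (\<lambda>j. - 1 - shape_seq (conjugate lam) j) ` {..<M}"
    "shape_seq lam ` {..<N} \<inter> (\<lambda>j. - 1 - shape_seq (conjugate lam) j) ` {..<M} = {}"
    "inj_on (shape_seq lam) {..<N}" "inj_on (\<lambda>j. - 1 - shape_seq (conjugate lam) j) {..<M}"
proof -
  note lam' = is_partition_conjugate[OF assms(1)]
  have inj: "inj_on (shape_seq nu) A" if "is_partition nu" for nu A
    using shape_seq_less[OF that] by (intro linorder_inj_onI) (auto dest: less_imp_neq)
  show i1: "inj_on (shape_seq lam) {..<N}" by (rule inj[OF assms(1)])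
  show i2: "inj_on (\<lambda>j. - 1 - shape_seq (conjugate lam) j) {..<M}"
    using inj[OF lam', of "{..<M}"] by (simp add: inj_on_def)
  show disj: "shape_seq lam ` {..<N} \<inter> (\<lambda>j. - 1 - shape_seq (conjugate lam) j) ` {..<M} = {}"
  proof -
    have "- 1 - shape_seq (conjugate lam) j \<notin> shape lam" for j
    proof -
      have "shape_seq (conjugate lam) j \<in> shape (conjugate lam)" by (simp add: shape_def shape_seq_def)
      then show ?thesis unfolding shape_conjugate[OF assms(1)] by auto
    qed
    moreover have "shape_seq lam i \<in> shape lam" for i by (simp add: shape_def shape_seq_def)
    ultimately have "- 1 - shape_seq (conjugate lam) j \<noteq> shape_seq lam i" for i j by metis
    then show ?thesis by (auto simp: eq_commute)
  qed
  have sub: "shape_seq lam ` {..<N} \<union> (\<lambda>j. - 1 - shape_seq (conjugate lam) j) ` {..<M} \<subseteq> {- int M..<int N}"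
  proof -
    have "shape_seq lam i \<in> {- int M..<int N}" if "i < N" for i
      using that part_antimono[OF assms(1), of 1 "Suc i"] assms(3) by (simp add: shape_seq_def)
    moreover have "- 1 - shape_seq (conjugate lam) j \<in> {- int M..<int N}" if "j < M" for j
    proof -
      have "part (conjugate lam) (Suc j) \<le> N"
      proof (rule ccontr)
        assume "\<not> part (conjugate lam) (Suc j) \<le> N"
        then have "Suc N \<le> part (conjugate lam) (Suc j)" by simp
        then have "Suc j \<le> part lam (Suc N)" using le_part_conjugate_iff[OF assms(1), of "Suc N" "Suc j"] by simp
        then show False using part_eq_0[of lam "Suc N"] assms(2) by simp
      qed
      then show ?thesis using that by (simp add: shape_seq_def)
    qed
    ultimately show ?thesis by auto
  qed
  have "card (shape_seq lam ` {..<N} \<union> (\<lambda>j. - 1 - shape_seq (conjugate lam) j) ` {..<M}) = N + M"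
    using disj i1 i2 by (simp add: card_Un_disjoint card_image)
  also have "N + M = card {- int M..<int N}" by simp
  finally show "{- int M..<int N} = shape_seq lam ` {..<N} \<union> (\<lambda>j. - 1 - shape_seq (conjugate lam) j) ` {..<M}"
    using sub by (intro card_subset_eq[symmetric]) auto
qed

text \<open>The part of row \<open>i\<close> that is independent of the number \<open>M\<close> of
  columns, up to the reciprocal \<open>qfact\<close> split off in
  \<open>row_prod_finite\<close>.\<close>

definition row_const :: "complex \<Rightarrow> nat list \<Rightarrow> nat \<Rightarrow> nat \<Rightarrow> complex" where
  "row_const z lam N i = (\<Prod>k\<in>{..<N} - {i}. 1 - z powi (shape_seq lam i - shape_seq lam k)) /
     (\<Prod>d<beta N lam i. 1 - z powi (- int (Suc d)))"

lemma one_minus_powi_nonzero: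
  fixes z :: complex
  assumes "0 < norm z" "norm z < 1" "e \<noteq> 0"
  shows "1 - z powi e \<noteq> 0"
  using power_int_inj[OF assms(1,2), of e 0] assms(3) by auto

text \<open>The product of \<open>1 - z powi (y - x)\<close> over all \<open>x \<noteq> y\<close> in
  the interval is evaluated twice: by particles and holes, where the holes give the row of the hook
  product, and by the two sides of \<open>y\<close>, which give \<open>qfact\<close> and its
  analogue with negative exponents.\<close>

lemma row_prod_finite:
  assumes "0 < norm z" "norm z < 1" "is_partition lam" "length lam \<le> N" "part lam 1 \<le> M" "i < N"
  shows "(\<Prod>j<M. hook_factor z lam i j) = row_const z lam N i / qfact z (M + i - part lam (Suc i))"
proof -
  define y where "y = shape_seq lam i"
  define c where "c j = - 1 - shape_seq (conjugate lam) j" for j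
  note int = shape_interval[OF assms(3-5), folded c_def]
  have pl: "part lam (Suc i) \<le> M" using part_antimono[OF assms(3), of 1 "Suc i"] assms(5) by simp
  have yM: "y + int M = int (M + i - part lam (Suc i))" using pl by (simp add: y_def shape_seq_def)
  have yN: "int N - 1 - y = int (beta N lam i)" using assms(6) by (simp add: y_def shape_seq_def beta_def)
  have y: "- int M \<le> y" "y < int N" using yM yN by linarith+
  have P: "shape_seq lam ` {..<N} - {y} = shape_seq lam ` ({..<N} - {i})"
    using int(3) assms(6) by (auto simp: y_def dest: inj_onD)
  have ynotin: "y \<notin> c ` {..<M}" using int(2) assms(6) by (auto simp: y_def)
  have "(\<Prod>x\<in>{- int M..<int N} - {y}. 1 - z powi (y - x)) =
      (\<Prod>x\<in>shape_seq lam ` ({..<N} - {i}) \<union> c ` {..<M}. 1 - z powi (y - x))"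
    unfolding int(1) P[symmetric] using ynotin by (intro prod.cong) auto
  also have "\<dots> = (\<Prod>x\<in>shape_seq lam ` ({..<N} - {i}). 1 - z powi (y - x)) * (\<Prod>x\<in>c ` {..<M}. 1 - z powi (y - x))"
    by (rule prod.union_disjoint) (use int(2) in auto)
  also have "(\<Prod>x\<in>shape_seq lam ` ({..<N} - {i}). 1 - z powi (y - x)) =
      (\<Prod>k\<in>{..<N} - {i}. 1 - z powi (y - shape_seq lam k))"
    using inj_on_subset[OF int(3), of "{..<N} - {i}"] by (subst prod.reindex) auto
  also have "(\<Prod>x\<in>c ` {..<M}. 1 - z powi (y - x)) = (\<Prod>j<M. 1 - z powi (y - c j))"
    using int(4) by (subst prod.reindex) auto
  finally have e1: "(\<Prod>x\<in>{- int M..<int N} - {y}. 1 - z powi (y - x)) =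
      (\<Prod>k\<in>{..<N} - {i}. 1 - z powi (y - shape_seq lam k)) * (\<Prod>j<M. 1 - z powi (y - c j))" .
  have split: "{- int M..<int N} - {y} = {- int M..<y} \<union> {y<..<int N}" using y by auto
  have "(\<Prod>x\<in>{- int M..<int N} - {y}. 1 - z powi (y - x)) =
      (\<Prod>x\<in>{- int M..<y}. 1 - z powi (y - x)) * (\<Prod>x\<in>{y<..<int N}. 1 - z powi (y - x))"
    unfolding split by (rule prod.union_disjoint) auto
  also have "(\<Prod>x\<in>{- int M..<y}. 1 - z powi (y - x)) = qfact z (M + i - part lam (Suc i))"
    unfolding qfact_def
  proof (rule prod.reindex_bij_witness[of _ "\<lambda>d. y - 1 - int d" "\<lambda>x. nat (y - 1 - x)"])
    fix x assume x: "x \<in> {- int M..<y}"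
    then show "nat (y - 1 - x) \<in> {..<M + i - part lam (Suc i)}" using yM by simp linarith
    have "y - x = int (Suc (nat (y - 1 - x)))" using x by simp
    then show "1 - z ^ Suc (nat (y - 1 - x)) = 1 - z powi (y - x)" by (simp only: power_int_of_nat)
  next
    fix d assume "d \<in> {..<M + i - part lam (Suc i)}"
    then have "int d < y + int M" unfolding yM by simp
    then show "y - 1 - int d \<in> {- int M..<y}" by simp
  qed auto
  also have "(\<Prod>x\<in>{y<..<int N}. 1 - z powi (y - x)) = (\<Prod>d<beta N lam i. 1 - z powi (- int (Suc d)))"
  proof (rule prod.reindex_bij_witness[of _ "\<lambda>d. y + 1 + int d" "\<lambda>x. nat (x - y - 1)"])
    fix x assume x: "x \<in> {y<..<int N}"
    then show "nat (x - y - 1) \<in> {..<beta N lam i}" using yN by simp linarith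
    have "y - x = - int (Suc (nat (x - y - 1)))" using x by simp
    then show "1 - z powi (- int (Suc (nat (x - y - 1)))) = 1 - z powi (y - x)" by simp
  next
    fix d assume "d \<in> {..<beta N lam i}"
    then have "int d < int N - 1 - y" unfolding yN by simp
    then show "y + 1 + int d \<in> {y<..<int N}" by simp
  qed auto
  finally have e2: "(\<Prod>k\<in>{..<N} - {i}. 1 - z powi (y - shape_seq lam k)) * (\<Prod>j<M. 1 - z powi (y - c j)) =
      qfact z (M + i - part lam (Suc i)) * (\<Prod>d<beta N lam i. 1 - z powi (- int (Suc d)))"
    unfolding e1 .
  have "(\<Prod>d<beta N lam i. 1 - z powi (- int (Suc d))) \<noteq> 0"
    using one_minus_powi_nonzero[OF assms(1,2)] by (auto simp: prod_zero_iff simp del: of_nat_Suc)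
  moreover have "(\<Prod>j<M. 1 - z powi (y - c j)) \<noteq> 0"
  proof -
    have "y - c j \<noteq> 0" if "j < M" for j using ynotin that by auto
    then show ?thesis
      using one_minus_powi_nonzero[OF assms(1,2)] by (simp add: prod_zero_iff)
  qed
  moreover have "(\<Prod>j<M. hook_factor z lam i j) = inverse (\<Prod>j<M. 1 - z powi (y - c j))"
    by (simp add: hook_factor_shape y_def c_def prod_inversef[symmetric] o_def)
  moreover have "inverse B = A / D / C" if "A * B = C * D" "D \<noteq> 0" "B \<noteq> 0" "C \<noteq> 0"
    for A B C D :: complex
    using that by (simp add: field_simps)
  ultimately show ?thesis
    using e2 qfact_nonzero[OF assms(2), of "M + i - part lam (Suc i)"]
    unfolding row_const_def y_def[symmetric] by metis
qed

lemma prod_power_int: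
  fixes z :: "'a :: field"
  assumes "z \<noteq> 0"
  shows "(\<Prod>a\<in>A. z powi f a) = z powi (\<Sum>a\<in>A. f a)"
  by (induction A rule: infinite_finite_induct) (simp_all add: power_int_add assms)

lemma prod_off_diagonal:
  fixes g :: "nat \<Rightarrow> nat \<Rightarrow> 'a :: comm_monoid_mult"
  shows "(\<Prod>i<N. \<Prod>k\<in>{..<N} - {i}. g i k) = (\<Prod>j<N. \<Prod>k<j. g j k * g k j)"
proof (induction N)
  case (Suc N)
  have "(\<Prod>i<N. \<Prod>k\<in>{..<Suc N} - {i}. g i k) = (\<Prod>i<N. g i N * (\<Prod>k\<in>{..<N} - {i}. g i k))"
  proof (rule prod.cong[OF refl])
    fix i assume "i \<in> {..<N}"
    then have "{..<Suc N} - {i} = insert N ({..<N} - {i})" by auto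
    then show "(\<Prod>k\<in>{..<Suc N} - {i}. g i k) = g i N * (\<Prod>k\<in>{..<N} - {i}. g i k)" by simp
  qed
  moreover have "{..<Suc N} - {N} = {..<N}" by auto
  ultimately show ?case using Suc by (simp add: prod.distrib mult_ac)
qed simp

lemma sum_pair_differences:
  fixes y :: "nat \<Rightarrow> int"
  shows "(\<Sum>j<N. \<Sum>k<j. y j - y k) = (\<Sum>i<N. y i * (2 * int i + 1 - int N))"
proof (induction N)
  case (Suc N)
  have "(\<Sum>i<N. y i * (2 * int i + 1 - int (Suc N))) = (\<Sum>i<N. y i * (2 * int i + 1 - int N)) - (\<Sum>i<N. y i)"
    unfolding sum_subtractf[symmetric] by (intro sum.cong refl) (simp add: algebra_simps)
  with Suc show ?case by (simp add: sum_subtractf algebra_simps)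
qed simp

lemma sum_part_square:
  fixes g :: "nat \<Rightarrow> int \<Rightarrow> int"
  assumes "length lam \<le> N" "\<And>i. g i 0 = 0"
  shows "(\<Sum>i<N. g i (int (part lam (Suc i)))) = (\<Sum>i<length lam. g i (int (part lam (Suc i))))"
  using sum_part_extend[OF assms(1), of "\<lambda>i n. g i (int n)"] assms(2) by simp

lemma kappa_eq:
  "kappa lam = (\<Sum>i<length lam. int (part lam (Suc i)) * (int (part lam (Suc i)) - 2 * int (Suc i) + 1))"
  unfolding kappa_def by (rule sum.reindex_bij_witness[of _ Suc "\<lambda>i. i - 1"]) auto

lemma twice_exponent:
  "2 * (kappa lam div 2 - int (psize lam) + 2 * int (weight lam)) =
    (\<Sum>i<length lam. (int (part lam (Suc i)))\<^sup>2 + (2 * int i + 1) * int (part lam (Suc i)))"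
proof -
  have "2 * (kappa lam div 2) = kappa lam" using even_kappa by simp
  then have "2 * (kappa lam div 2 - int (psize lam) + 2 * int (weight lam)) =
      kappa lam - 2 * int (psize lam) + 4 * int (weight lam)" by simp
  also have "\<dots> = (\<Sum>i<length lam. int (part lam (Suc i)) * (int (part lam (Suc i)) - 2 * int (Suc i) + 1)
      - 2 * int (part lam (Suc i)) + 4 * (int (Suc i) * int (part lam (Suc i))))"
    unfolding kappa_eq psize_eq weight_def
    by (simp only: sum.distrib sum_subtractf sum_distrib_left of_nat_sum of_nat_mult)
  also have "\<dots> = (\<Sum>i<length lam. (int (part lam (Suc i)))\<^sup>2 + (2 * int i + 1) * int (part lam (Suc i)))"
    by (intro sum.cong refl) (simp add: algebra_simps power2_eq_square)
  finally show ?thesis .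
qed

text \<open>The left-hand side balances the powers of \<open>z\<close> split off in
  \<open>prod_row_const\<close>. Doubled, it is a sum over rows of expressions quadratic in the
  parts.\<close>

lemma exponent_identity:
  assumes "length lam \<le> N"
  shows "(\<Sum>i<N. \<Sum>d<beta N lam i. int (Suc d)) - (\<Sum>j<N. \<Sum>k<j. shape_seq lam j - shape_seq lam k) =
    kappa lam div 2 - int (psize lam) + 2 * int (weight lam)"
proof -
  have tri: "2 * (\<Sum>d<n. int (Suc d)) = int n * (int n + 1)" for n
    by (induction n) (auto simp: algebra_simps)
  \<comment> \<open>These are the terms that do not involve the parts; their cancellation makes the
    exponent independent of \<open>N\<close>.\<close>
  have const: "(\<Sum>i<N. (int N - 1 - int i) * (int N - int i) - 2 * int i * (2 * int i + 1 - int N)) = 0"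
  proof -
    have s1: "2 * (\<Sum>i<N. int i) = int N * (int N - 1)"
      by (induction N) (auto simp: algebra_simps)
    have s2: "6 * (\<Sum>i<N. int i * int i) = int N * (int N - 1) * (2 * int N - 1)"
      by (induction N) (auto simp: algebra_simps)
    have "(\<Sum>i<N. (int N - 1 - int i) * (int N - int i) - 2 * int i * (2 * int i + 1 - int N)) =
        (\<Sum>i<N. int N * (int N - 1) - int i - 3 * (int i * int i))"
      by (intro sum.cong refl) (simp add: algebra_simps)
    also have "\<dots> = int N * (int N * (int N - 1)) - (\<Sum>i<N. int i) - 3 * (\<Sum>i<N. int i * int i)"
      by (simp add: sum_subtractf sum_distrib_left)
    finally have "2 * (\<Sum>i<N. (int N - 1 - int i) * (int N - int i) - 2 * int i * (2 * int i + 1 - int N)) =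
        2 * (int N * (int N * (int N - 1))) - int N * (int N - 1) - int N * (int N - 1) * (2 * int N - 1)"
      using s1 s2 by linarith
    also have "\<dots> = 0" by (simp add: algebra_simps)
    finally show ?thesis by simp
  qed
  have "2 * ((\<Sum>i<N. \<Sum>d<beta N lam i. int (Suc d)) - (\<Sum>j<N. \<Sum>k<j. shape_seq lam j - shape_seq lam k)) =
      (\<Sum>i<N. int (beta N lam i) * (int (beta N lam i) + 1)) -
      (\<Sum>i<N. 2 * (shape_seq lam i * (2 * int i + 1 - int N)))"
    unfolding sum_pair_differences right_diff_distrib sum_distrib_left[of "2 :: int"]
    by (simp only: tri flip: sum_distrib_left)
  also have "\<dots> = (\<Sum>i<N. int (beta N lam i) * (int (beta N lam i) + 1) -
      2 * (shape_seq lam i * (2 * int i + 1 - int N)))"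
    by (simp only: sum_subtractf)
  also have "\<dots> = (\<Sum>i<N. ((int (part lam (Suc i)))\<^sup>2 + (2 * int i + 1) * int (part lam (Suc i))) +
      ((int N - 1 - int i) * (int N - int i) - 2 * int i * (2 * int i + 1 - int N)))"
  proof (rule sum.cong[OF refl])
    fix i assume "i \<in> {..<N}"
    then have eq: "int (beta N lam i) = int N - 1 - int i + int (part lam (Suc i))"
      by (simp add: beta_def of_nat_diff)
    show "int (beta N lam i) * (int (beta N lam i) + 1) - 2 * (shape_seq lam i * (2 * int i + 1 - int N)) =
      ((int (part lam (Suc i)))\<^sup>2 + (2 * int i + 1) * int (part lam (Suc i))) +
      ((int N - 1 - int i) * (int N - int i) - 2 * int i * (2 * int i + 1 - int N))"
      unfolding eq by (simp add: shape_seq_def algebra_simps power2_eq_square)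
  qed
  also have "\<dots> = (\<Sum>i<N. (int (part lam (Suc i)))\<^sup>2 + (2 * int i + 1) * int (part lam (Suc i)))"
    unfolding sum.distrib[of _ "\<lambda>i. (int N - 1 - int i) * (int N - int i) - 2 * int i * (2 * int i + 1 - int N)"]
      const by simp
  also have "\<dots> = 2 * (kappa lam div 2 - int (psize lam) + 2 * int (weight lam))"
    unfolding twice_exponent
    by (rule sum_part_square[OF assms, of "\<lambda>i n. n\<^sup>2 + (2 * int i + 1) * n"]) simp
  finally show ?thesis by simp
qed

text \<open>The ratio of the hook product of \<open>lam\<close> to that of the empty
  diagram.\<close>

definition hook_const :: "complex \<Rightarrow> nat list \<Rightarrow> complex" where
  "hook_const z lam = (-1) ^ psize lam *
     z powi (kappa lam div 2 - int (psize lam) + 2 * int (weight lam)) * (frobenius z lam)\<^sup>2"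

text \<open>In the product over all rows each pair of particles occurs with both signs of the
  exponent. Negative exponents are removed by
  \<open>1 - z powi (- e) = up e * (1 - z powi e)\<close>, which leaves a squared Vandermonde
  product, a sign and a power of \<open>z\<close>.\<close>

lemma prod_row_const:
  assumes "0 < norm z" "norm z < 1" "is_partition lam" "length lam \<le> N"
  shows "(\<Prod>i<N. row_const z lam N i) = hook_const z lam * (\<Prod>i<N. qfact z (beta N lam i))"
proof -
  have z0: "z \<noteq> 0" using assms(1) by auto
  define up where "up e = - (z powi (- e))" for e :: int
  have up: "1 - z powi (- e) = up e * (1 - z powi e)" for e
    using z0 by (simp add: up_def power_int_minus field_simps)
  have prod_up: "(\<Prod>a\<in>A. up (e a)) = (-1) ^ card A * z powi (- (\<Sum>a\<in>A. e a))"
    for A :: "nat set" and e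
  proof -
    have "(\<Prod>a\<in>A. up (e a)) = (\<Prod>a\<in>A. (-1) * z powi (- e a))" by (simp add: up_def)
    also have "\<dots> = (-1) ^ card A * z powi (\<Sum>a\<in>A. - e a)"
      by (simp only: prod.distrib prod_power_int[OF z0] prod_constant)
    finally show ?thesis by (simp add: sum_negf)
  qed
  define y where "y = shape_seq lam"
  define s where "s = (\<Sum>j<N. j)"
  define E1 where "E1 = (\<Sum>j<N. \<Sum>k<j. y j - y k)"
  define E2 where "E2 = (\<Sum>i<N. \<Sum>d<beta N lam i. int (Suc d))"
  define Q where "Q = (\<Prod>i<N. qfact z (beta N lam i))"
  have Q: "Q \<noteq> 0" using qfact_nonzero[OF assms(2)] by (simp add: Q_def)
  have num: "(\<Prod>i<N. \<Prod>k\<in>{..<N} - {i}. 1 - z powi (y i - y k)) =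
      (frobenius z lam * Q)\<^sup>2 * ((-1) ^ s * z powi (- E1))"
  proof -
    have "(\<Prod>i<N. \<Prod>k\<in>{..<N} - {i}. 1 - z powi (y i - y k)) =
        (\<Prod>j<N. \<Prod>k<j. (1 - z powi (y j - y k)) * (1 - z powi (y k - y j)))"
      by (rule prod_off_diagonal)
    also have "\<dots> = (\<Prod>j<N. \<Prod>k<j. (1 - z ^ (part lam (Suc k) - part lam (Suc j) + (j - k)))\<^sup>2 * up (y j - y k))"
    proof (rule prod.cong[OF refl], rule prod.cong[OF refl])
      fix j k :: nat assume "k \<in> {..<j}"
      then have "y j - y k = int (part lam (Suc k) - part lam (Suc j) + (j - k))"
        using part_antimono[OF assms(3), of "Suc k" "Suc j"] by (simp add: y_def shape_seq_def of_nat_diff)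
      then have "z powi (y j - y k) = z ^ (part lam (Suc k) - part lam (Suc j) + (j - k))"
        by (simp only: power_int_of_nat)
      moreover have "1 - z powi (y k - y j) = up (y j - y k) * (1 - z powi (y j - y k))"
        using up[of "y j - y k"] by simp
      ultimately show "(1 - z powi (y j - y k)) * (1 - z powi (y k - y j)) =
          (1 - z ^ (part lam (Suc k) - part lam (Suc j) + (j - k)))\<^sup>2 * up (y j - y k)"
        by (simp add: power2_eq_square mult_ac)
    qed
    also have "\<dots> = (vdm_prod z lam N)\<^sup>2 * (\<Prod>j<N. \<Prod>k<j. up (y j - y k))"
      by (simp add: vdm_prod_def prod.distrib prod_power_distrib)
    also have "(\<Prod>j<N. \<Prod>k<j. up (y j - y k)) = (-1) ^ s * z powi (- E1)"
      by (simp add: prod_up prod.distrib prod_power_int[OF z0] s_def E1_def power_sum sum_negf)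
    finally show ?thesis by (simp add: vdm_prod_eq[OF assms(2,4)] Q_def)
  qed
  \<comment> \<open>The numerator yields \<open>s\<close> signs and the denominator one for each
    unit of the beta numbers; the difference is the size, whence the sign in
    \<open>hook_const\<close>.\<close>
  have sb: "(\<Sum>i<N. beta N lam i) = s + psize lam"
  proof -
    have "(\<Sum>i<N. beta N lam i) = (\<Sum>i<N. N - 1 - i) + (\<Sum>i<N. part lam (Suc i))"
      unfolding beta_def sum.distrib ..
    also have "(\<Sum>i<N. N - 1 - i) = s"
      unfolding s_def by (rule sum.reindex_bij_witness[of _ "\<lambda>d. N - 1 - d" "\<lambda>k. N - 1 - k"]) auto
    also have "(\<Sum>i<N. part lam (Suc i)) = psize lam"
      unfolding psize_eq by (rule sum_part_extend[OF assms(4)]) simp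
    finally show ?thesis .
  qed
  have den: "(\<Prod>i<N. \<Prod>d<beta N lam i. 1 - z powi (- int (Suc d))) =
      Q * ((-1) ^ (s + psize lam) * z powi (- E2))"
  proof -
    have "(\<Prod>i<N. \<Prod>d<beta N lam i. 1 - z powi (- int (Suc d))) =
        (\<Prod>i<N. \<Prod>d<beta N lam i. up (int (Suc d)) * (1 - z ^ Suc d))"
      by (simp only: up power_int_of_nat)
    also have "\<dots> = (\<Prod>i<N. \<Prod>d<beta N lam i. up (int (Suc d))) * Q"
      by (simp only: prod.distrib Q_def qfact_def)
    also have "(\<Prod>i<N. \<Prod>d<beta N lam i. up (int (Suc d))) = (-1) ^ (s + psize lam) * z powi (- E2)"
      unfolding prod_up prod.distrib prod_power_int[OF z0] sum_negf E2_def[symmetric] card_lessThan sb[symmetric]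
      by (simp only: power_sum)
    finally show ?thesis by (simp only: mult.commute)
  qed
  have E: "z powi (- E1) = z powi (- E2) * z powi (kappa lam div 2 - int (psize lam) + 2 * int (weight lam))"
  proof -
    have "- E1 = - E2 + (kappa lam div 2 - int (psize lam) + 2 * int (weight lam))"
      using exponent_identity[OF assms(4)] unfolding E1_def E2_def y_def by linarith
    then show ?thesis by (simp only: power_int_add[OF disjI1[OF z0]])
  qed
  have "(\<Prod>i<N. row_const z lam N i) =
      ((frobenius z lam * Q)\<^sup>2 * ((-1) ^ s * z powi (- E1))) / (Q * ((-1) ^ (s + psize lam) * z powi (- E2)))"
    unfolding row_const_def prod_dividef y_def[symmetric] num den ..
  also have "\<dots> = hook_const z lam * Q"
  proof -
    have gen: "((F * Q)\<^sup>2 * (a * (Z * T))) / (Q * ((a * b) * Z)) = b * T * F\<^sup>2 * Q"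
      if "Q \<noteq> 0" "Z \<noteq> 0" "a \<noteq> 0" "b * b = 1" for F Q a b Z T :: complex
    proof -
      have "((F * Q)\<^sup>2 * (a * (Z * T))) / (Q * ((a * b) * Z)) = F\<^sup>2 * Q * T * (1 / b)"
        using that(1-3) by (simp add: power2_eq_square)
      also have "1 / b = b" using that(4) by (metis div_by_0 eq_divide_imp mult_zero_left zero_neq_one)
      finally show ?thesis by (simp only: mult_ac)
    qed
    have "(-1 :: complex) ^ psize lam * (-1) ^ psize lam = 1" by (simp flip: power_mult_distrib)
    then show ?thesis
      unfolding hook_const_def E power_add using Q z0 by (intro gen) auto
  qed
  finally show ?thesis by (simp add: Q_def)
qed

lemma frobenius_nonzero:
  assumes "norm z < 1"
  shows "frobenius z lam \<noteq> 0"
proof -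
  have "1 - z ^ (a + (j - k)) \<noteq> 0" if "k < j" for a j k
  proof -
    have "a + (j - k) = Suc (a + (j - k) - 1)" using that by simp
    then show ?thesis using one_minus_power_nonzero[OF assms] by metis
  qed
  then have "vdm_prod z lam N \<noteq> 0" for N by (simp add: vdm_prod_def)
  then show ?thesis using qfact_nonzero[OF assms] by (simp add: frobenius_def)
qed

lemma hook_const_nonzero: "0 < norm z \<Longrightarrow> norm z < 1 \<Longrightarrow> hook_const z lam \<noteq> 0"
  using frobenius_nonzero[of z lam] by (auto simp: hook_const_def)

lemma row_const_nonzero:
  assumes "0 < norm z" "norm z < 1" "is_partition lam" "length lam \<le> N" "i < N"
  shows "row_const z lam N i \<noteq> 0"
proof
  assume "row_const z lam N i = 0"
  then have "(\<Prod>i<N. row_const z lam N i) = 0" using assms(5) by (auto simp: prod_zero_iff)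
  then show False
    using prod_row_const[OF assms(1-4)] hook_const_nonzero[OF assms(1,2)] qfact_nonzero[OF assms(2)] by simp
qed

lemma prodinf_row:
  assumes "0 < norm z" "norm z < 1" "is_partition lam" "length lam \<le> N" "i < N"
  shows "prodinf (hook_factor z lam i) = row_const z lam N i / qinf z"
proof (rule prodinf_eqI)
  let ?p = "part lam (Suc i)"
  \<comment> \<open>The shift of \<open>M\<close> by \<open>?p\<close> makes the truncated
    subtraction exact.\<close>
  have "(\<lambda>M. qfact z (M + ?p + i - ?p)) \<longlonglongrightarrow> qinf z"
    using LIMSEQ_ignore_initial_segment[OF qfact_tendsto[OF assms(2)], of i] by simp
  then have "(\<lambda>M. qfact z (M + i - ?p)) \<longlonglongrightarrow> qinf z" by (rule LIMSEQ_offset)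
  then have "(\<lambda>M. row_const z lam N i / qfact z (M + i - ?p)) \<longlonglongrightarrow> row_const z lam N i / qinf z"
    by (intro tendsto_intros) auto
  moreover have "\<forall>\<^sub>F M in sequentially. row_const z lam N i / qfact z (M + i - ?p) = (\<Prod>j<M. hook_factor z lam i j)"
    using eventually_ge_at_top[of "part lam 1"]
    by eventually_elim (use row_prod_finite[OF assms(1-4) _ assms(5)] in simp)
  ultimately show "(\<lambda>M. \<Prod>j<M. hook_factor z lam i j) \<longlonglongrightarrow> row_const z lam N i / qinf z"
    by (rule Lim_transform_eventually)
  show "row_const z lam N i / qinf z \<noteq> 0" using row_const_nonzero[OF assms] by simp
qed

text \<open>Each row contributes \<open>row_const\<close> divided by \<open>qinf\<close>. Comparison
  with the empty diagram isolates \<open>hook_const\<close>, a correction that tends to 1, and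
  partial products of the MacMahon function.\<close>

theorem hook_prod_formula:
  assumes "0 < norm z" "norm z < 1" "is_partition lam"
  shows "hook_prod lam z = exp (log_macmahon z) * hook_const z lam"
  unfolding hook_prod_eq
proof (rule prodinf_eqI)
  have "(\<lambda>N. hook_const z lam * (\<Prod>i<N. qfact z (beta N lam i) / qfact z (N - 1 - i)) *
      (\<Prod>i<N. qfact z i / qinf z)) \<longlonglongrightarrow> hook_const z lam * 1 * exp (log_macmahon z)"
    by (intro tendsto_intros beta_ratio_tendsto prod_qfact_tendsto assms)
  moreover have "\<forall>\<^sub>F N in sequentially. hook_const z lam *
      (\<Prod>i<N. qfact z (beta N lam i) / qfact z (N - 1 - i)) * (\<Prod>i<N. qfact z i / qinf z) =
      (\<Prod>i<N. prodinf (hook_factor z lam i))"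
    using eventually_ge_at_top[of "length lam"]
  proof eventually_elim
    case (elim N)
    have "(\<Prod>i<N. prodinf (hook_factor z lam i)) = (\<Prod>i<N. row_const z lam N i) / (\<Prod>i<N. qinf z)"
      unfolding prod_dividef[symmetric] by (intro prod.cong refl) (simp add: prodinf_row[OF assms elim])
    also have "\<dots> = hook_const z lam * (\<Prod>i<N. qfact z (beta N lam i)) / (\<Prod>i<N. qinf z)"
      unfolding prod_row_const[OF assms elim] ..
    finally have *: "(\<Prod>i<N. prodinf (hook_factor z lam i)) =
        hook_const z lam * (\<Prod>i<N. qfact z (beta N lam i)) / (\<Prod>i<N. qinf z)" .
    show ?case
    proof -
      have "h * (B / Q) * (Q / R) = h * B / R" if "Q \<noteq> 0" for h B Q R :: complex
        using that by simp
      moreover have "(\<Prod>i<N. qfact z i) \<noteq> 0" using qfact_nonzero[OF assms(2)] by simp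
      ultimately show ?thesis unfolding prod_dividef prod_qfact_rev * by blast
    qed
  qed
  ultimately show "(\<lambda>N. \<Prod>i<N. prodinf (hook_factor z lam i)) \<longlonglongrightarrow> exp (log_macmahon z) * hook_const z lam"
    by (simp add: Lim_transform_eventually mult.commute)
  show "exp (log_macmahon z) * hook_const z lam \<noteq> 0" using hook_const_nonzero[OF assms(1,2)] by simp
qed

text \<open>Both sides are limits of the products over squares, which are symmetric under conjugation.\<close>

lemma hook_const_conjugate:
  assumes "0 < norm z" "norm z < 1" "is_partition lam"
  shows "hook_const z (conjugate lam) = hook_const z lam"
proof -
  \<comment> \<open>The reciprocal of the square product for the empty diagram, so that the limit is
    \<open>hook_const\<close> alone.\<close>
  define K where "K N = (\<Prod>i<N. qfact z (N + i) / qfact z (N - 1 - i))" for N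
  have lim: "(\<lambda>N. (\<Prod>i<N. \<Prod>j<N. hook_factor z nu i j) * K N) \<longlonglongrightarrow> hook_const z nu"
    if "is_partition nu" for nu
  proof -
    have "(\<lambda>N. \<Prod>i<N. qfact z (N + i) / qfact z (N + i - part nu (Suc i))) \<longlonglongrightarrow> 1"
    proof (rule prod_tendsto_1[where L = "length nu"])
      fix i
      let ?p = "part nu (Suc i)"
      have "(\<lambda>N. qfact z (N + i + ?p) / qfact z (N + i)) \<longlonglongrightarrow> 1"
        using LIMSEQ_ignore_initial_segment[OF qfact_ratio_tendsto[OF assms(2), of ?p], of i] .
      then have "(\<lambda>N. qfact z (N + ?p + i) / qfact z (N + ?p + i - ?p)) \<longlonglongrightarrow> 1"
        by (simp add: add_ac)
      then show "(\<lambda>N. qfact z (N + i) / qfact z (N + i - ?p)) \<longlonglongrightarrow> 1" by (rule LIMSEQ_offset)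
    next
      fix N i assume "length nu \<le> i"
      then show "qfact z (N + i) / qfact z (N + i - part nu (Suc i)) = 1"
        using qfact_nonzero[OF assms(2)] part_eq_0[of nu "Suc i"] by simp
    qed
    then have "(\<lambda>N. hook_const z nu * (\<Prod>i<N. qfact z (beta N nu i) / qfact z (N - 1 - i)) *
        (\<Prod>i<N. qfact z (N + i) / qfact z (N + i - part nu (Suc i)))) \<longlonglongrightarrow> hook_const z nu * 1 * 1"
      by (intro tendsto_intros beta_ratio_tendsto assms)
    moreover have "\<forall>\<^sub>F N in sequentially. hook_const z nu *
        (\<Prod>i<N. qfact z (beta N nu i) / qfact z (N - 1 - i)) *
        (\<Prod>i<N. qfact z (N + i) / qfact z (N + i - part nu (Suc i))) =
        (\<Prod>i<N. \<Prod>j<N. hook_factor z nu i j) * K N"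
      using eventually_ge_at_top[of "max (length nu) (part nu 1)"]
    proof eventually_elim
      case (elim N)
      then have le: "length nu \<le> N" "part nu 1 \<le> N" by auto
      have "(\<Prod>i<N. \<Prod>j<N. hook_factor z nu i j) =
          (\<Prod>i<N. row_const z nu N i) / (\<Prod>i<N. qfact z (N + i - part nu (Suc i)))"
        unfolding prod_dividef[symmetric]
        by (intro prod.cong refl) (simp add: row_prod_finite[OF assms(1,2) that le])
      then show ?case
        using qfact_nonzero[OF assms(2)]
        unfolding prod_row_const[OF assms(1,2) that le(1)] K_def
        by (simp add: prod_dividef field_simps)
    qed
    ultimately show ?thesis by (simp add: Lim_transform_eventually)
  qed
  have "hook_factor z (conjugate lam) i j = hook_factor z lam j i" for i j
    by (simp add: hook_factor_shape conjugate_conjugate[OF assms(3)] algebra_simps)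
  then have "(\<Prod>i<N. \<Prod>j<N. hook_factor z (conjugate lam) i j) = (\<Prod>i<N. \<Prod>j<N. hook_factor z lam i j)" for N
    by (simp only:) (rule prod.swap)
  with lim[OF is_partition_conjugate[OF assms(3)]]
  have "(\<lambda>N. (\<Prod>i<N. \<Prod>j<N. hook_factor z lam i j) * K N) \<longlonglongrightarrow> hook_const z (conjugate lam)"
    by simp
  then show ?thesis by (rule LIMSEQ_unique[OF _ lim[OF assms(3)]])
qed

section \<open>The normalization constants\<close>

definition pos_real :: "complex \<Rightarrow> bool" where
  "pos_real w \<longleftrightarrow> w \<in> \<real> \<and> 0 < Re w"

lemma pos_real_iff: "pos_real w \<longleftrightarrow> (\<exists>r>0. w = complex_of_real r)"
  by (auto simp: pos_real_def elim!: Reals_cases)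

lemma pos_real_mult: "pos_real a \<Longrightarrow> pos_real b \<Longrightarrow> pos_real (a * b)"
  unfolding pos_real_iff by (metis mult_pos_pos of_real_mult)

lemma pos_real_divide: "pos_real a \<Longrightarrow> pos_real b \<Longrightarrow> pos_real (a / b)"
  unfolding pos_real_iff by (metis divide_pos_pos of_real_divide)

lemma pos_real_prod: "(\<And>i. i \<in> A \<Longrightarrow> pos_real (f i)) \<Longrightarrow> pos_real (prod f A)"
proof (induction A rule: infinite_finite_induct)
  case (insert a A)
  then show ?case by (simp add: pos_real_mult)
qed (simp_all add: pos_real_def)

lemma pos_real_power: "0 < x \<Longrightarrow> pos_real (complex_of_real x ^ n)"
  unfolding pos_real_iff by (metis of_real_power zero_less_power)

lemma pos_real_one_minus_power:
  assumes "0 < x" "x < 1" "n > 0"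
  shows "pos_real (1 - complex_of_real x ^ n)"
  unfolding pos_real_iff
  by (rule exI[of _ "1 - x ^ n"]) (use assms in \<open>simp add: power_less_one_iff\<close>)

lemma pos_real_exp: "w \<in> \<real> \<Longrightarrow> pos_real (exp w)"
  unfolding pos_real_iff by (metis Reals_cases exp_gt_zero exp_of_real)

lemma pos_real_frobenius:
  assumes "0 < x" "x < 1"
  shows "pos_real (frobenius (complex_of_real x) lam)"
  unfolding frobenius_def vdm_prod_def qfact_def
  by (intro pos_real_divide pos_real_prod pos_real_one_minus_power assms) auto

lemma holomorphic_frobenius: "(\<lambda>z. frobenius z lam) holomorphic_on ball 0 1"
proof -
  have "(\<Prod>i<length lam. qfact z (beta (length lam) lam i)) \<noteq> 0" if "z \<in> ball 0 1" for z
    using qfact_nonzero[of z] that by simp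
  moreover have "(\<lambda>z. qfact z n) holomorphic_on A" for n A
    unfolding qfact_def by (intro holomorphic_intros)
  ultimately show ?thesis
    unfolding frobenius_def vdm_prod_def by (intro holomorphic_intros) auto
qed

text \<open>Half of \<open>log_macmahon\<close> provides the root of the first factor. Since
  \<open>n\<close> is a natural number, the candidate is holomorphic at 0 as well, where the
  condition on \<open>g\<close> says nothing.\<close>

lemma disc_sqrt_frobenius:
  assumes q: "norm q < 1"
    and g: "\<And>z. 0 < norm z \<Longrightarrow> norm z < 1 \<Longrightarrow>
      g z = exp (log_macmahon z) * (z ^ n * frobenius z lam)\<^sup>2"
  shows "disc_sqrt g q = exp (log_macmahon q / 2) * (q ^ n * frobenius q lam)"
proof (rule disc_sqrt_eq[where f = "\<lambda>z. exp (log_macmahon z / 2) * (z ^ n * frobenius z lam)", OF _ _ _ q])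
  show "(\<lambda>z. exp (log_macmahon z / 2) * (z ^ n * frobenius z lam)) holomorphic_on ball 0 1"
    by (intro holomorphic_intros holomorphic_frobenius holomorphic_log_macmahon) auto
next
  fix z :: complex assume "norm z < 1" "z \<noteq> 0"
  moreover have "(exp (log_macmahon z / 2))\<^sup>2 = exp (log_macmahon z)"
    by (simp flip: exp_double)
  ultimately show "(exp (log_macmahon z / 2) * (z ^ n * frobenius z lam))\<^sup>2 = g z"
    by (simp add: g power_mult_distrib)
next
  fix x :: real assume x: "0 < x" "x < 1"
  have "log_macmahon (complex_of_real x) / 2 \<in> \<real>"
    using log_macmahon_real[OF x] by (intro Reals_divide) auto
  then have "pos_real (exp (log_macmahon (complex_of_real x) / 2) *
      (complex_of_real x ^ n * frobenius (complex_of_real x) lam))"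
    using x by (intro pos_real_mult pos_real_exp pos_real_power pos_real_frobenius)
  then show "exp (log_macmahon (complex_of_real x) / 2) *
      (complex_of_real x ^ n * frobenius (complex_of_real x) lam) \<in> \<real> \<and>
      0 < Re (exp (log_macmahon (complex_of_real x) / 2) *
      (complex_of_real x ^ n * frobenius (complex_of_real x) lam))"
    by (simp add: pos_real_def)
qed

lemma sign_square: "(-1 :: complex) ^ n * ((-1) ^ n * a) = a"
  by (simp add: mult.assoc[symmetric] flip: power_mult_distrib)

text \<open>The exponent of \<open>z\<close> under the root cancels that of
  \<open>hook_const\<close> except for \<open>2 * weight lam\<close>, so a perfect square
  remains.\<close>

lemma norm_bra_eq:
  assumes "norm q < 1" "is_partition lam"
  shows "norm_bra lam q = (-1) ^ psize lam * (exp (log_macmahon q / 2) * (q ^ weight lam * frobenius q lam))"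
  unfolding norm_bra_def
proof (rule arg_cong[where f = "(*) _"], rule disc_sqrt_frobenius[OF assms(1)])
  fix z :: complex assume z: "0 < norm z" "norm z < 1"
  then have z0: "z \<noteq> 0" by auto
  let ?e = "kappa lam div 2 - int (psize lam)"
  have "z powi (- ?e) * z powi (?e + 2 * int (weight lam)) = z powi (- ?e + (?e + 2 * int (weight lam)))"
    by (rule power_int_add[OF disjI1[OF z0], symmetric])
  also have "\<dots> = (z ^ weight lam)\<^sup>2"
    by (simp add: power_int_mult power_int_of_nat flip: power_mult) (simp add: power_int_def nat_mult_distrib mult.commute)
  finally have "z powi (- ?e) * z powi (?e + 2 * int (weight lam)) = (z ^ weight lam)\<^sup>2" .
  then have e: "z powi (- (kappa lam div 2) + int (psize lam)) *
      z powi (?e + 2 * int (weight lam)) = (z ^ weight lam)\<^sup>2" by simp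
  have "(-1) ^ psize lam * z powi (- (kappa lam div 2) + int (psize lam)) * hook_prod lam z =
      exp (log_macmahon z) * ((-1) ^ psize lam * ((-1) ^ psize lam *
        ((z powi (- (kappa lam div 2) + int (psize lam)) * z powi (?e + 2 * int (weight lam))) *
         (frobenius z lam)\<^sup>2)))"
    unfolding hook_prod_formula[OF z assms(2)] hook_const_def by (simp only: mult_ac)
  also have "\<dots> = exp (log_macmahon z) * (z ^ weight lam * frobenius z lam)\<^sup>2"
    unfolding sign_square e power_mult_distrib ..
  finally show "(-1) ^ psize lam * z powi (- (kappa lam div 2) + int (psize lam)) * hook_prod lam z =
      exp (log_macmahon z) * (z ^ weight lam * frobenius z lam)\<^sup>2" .
qed

text \<open>Twice this number is the sum of the products \<open>part * (part - 1)\<close>.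
  Nonnegativity is what makes the root in \<open>norm_ket\<close> holomorphic at 0.\<close>

lemma ket_exponent_nonneg:
  "0 \<le> kappa lam div 2 - int (psize lam) + int (weight lam)"
proof -
  have "2 * (kappa lam div 2 - int (psize lam) + int (weight lam)) =
      2 * (kappa lam div 2 - int (psize lam) + 2 * int (weight lam)) - 2 * int (weight lam)" by simp
  also have "\<dots> = (\<Sum>i<length lam. (int (part lam (Suc i)))\<^sup>2 + (2 * int i + 1) * int (part lam (Suc i))
      - 2 * (int (Suc i) * int (part lam (Suc i))))"
  proof -
    have "2 * int (weight lam) = (\<Sum>i<length lam. 2 * (int (Suc i) * int (part lam (Suc i))))"
      by (simp only: weight_def sum_distrib_left of_nat_sum of_nat_mult)
    then show ?thesis unfolding twice_exponent sum_subtractf by (rule arg_cong)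
  qed
  also have "\<dots> = (\<Sum>i<length lam. int (part lam (Suc i)) * (int (part lam (Suc i)) - 1))"
    by (intro sum.cong refl) (simp add: algebra_simps power2_eq_square)
  also have "\<dots> \<ge> 0"
  proof (rule sum_nonneg)
    fix i show "0 \<le> int (part lam (Suc i)) * (int (part lam (Suc i)) - 1)"
      by (cases "part lam (Suc i)") auto
  qed
  finally show ?thesis by simp
qed

text \<open>Conjugation preserves the hook product and negates \<open>kappa\<close>, so the two
  radicands differ by \<open>q ^ (2 * psize lam)\<close> only. \<open>main\<close> treats both, with
  \<open>M = n\<close> for the ket and \<open>M = n + psize lam\<close> for the bra.\<close>

lemma norm_bra_conjugate:
  assumes "0 < norm q" "norm q < 1" "is_partition lam"
  shows "norm_bra (conjugate lam) q = (- q) ^ psize lam * norm_ket lam q"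
proof -
  define n where "n = nat (kappa lam div 2 - int (psize lam) + int (weight lam))"
  have n: "int n = kappa lam div 2 - int (psize lam) + int (weight lam)"
    using ket_exponent_nonneg by (simp add: n_def)
  have hook: "hook_prod lam z = exp (log_macmahon z) * ((-1) ^ psize lam *
      (z powi (int n + int (weight lam)) * (frobenius z lam)\<^sup>2))"
    if "0 < norm z" "norm z < 1" for z
    unfolding hook_prod_formula[OF that assms(3)] hook_const_def n
    by (simp add: mult.assoc add.assoc)
  have conj: "hook_prod (conjugate lam) z = hook_prod lam z" if "0 < norm z" "norm z < 1" for z
    unfolding hook_prod_formula[OF that assms(3)]
      hook_prod_formula[OF that is_partition_conjugate[OF assms(3)]]
    by (simp only: hook_const_conjugate[OF that assms(3)])
  have main: "(-1) ^ psize lam * z powi m * hook_prod lam z =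
      exp (log_macmahon z) * (z ^ M * frobenius z lam)\<^sup>2"
    if "0 < norm z" "norm z < 1" "m + int n + int (weight lam) = 2 * int M" for z m M
  proof -
    have z0: "z \<noteq> 0" using that by auto
    have "z powi m * z powi (int n + int (weight lam)) = z powi (m + (int n + int (weight lam)))"
      by (rule power_int_add[OF disjI1[OF z0], symmetric])
    also have "m + (int n + int (weight lam)) = int (M * 2)" using that(3) by simp
    also have "z powi int (M * 2) = (z ^ M)\<^sup>2" by (simp only: power_int_of_nat power_mult)
    finally have e: "z powi m * z powi (int n + int (weight lam)) = (z ^ M)\<^sup>2" .
    have "(-1) ^ psize lam * z powi m * hook_prod lam z =
        exp (log_macmahon z) * ((-1) ^ psize lam * ((-1) ^ psize lam *
          ((z powi m * z powi (int n + int (weight lam))) * (frobenius z lam)\<^sup>2)))"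
      unfolding hook[OF that(1,2)] by (simp only: mult_ac)
    then show ?thesis unfolding sign_square e power_mult_distrib .
  qed
  have "norm_ket lam q = exp (log_macmahon q / 2) * (q ^ n * frobenius q lam)"
    unfolding norm_ket_def by (rule disc_sqrt_frobenius[OF assms(2)], rule main) (use n in auto)
  moreover have "norm_bra (conjugate lam) q = (-1) ^ psize lam *
      (exp (log_macmahon q / 2) * (q ^ (n + psize lam) * frobenius q lam))"
    unfolding norm_bra_def psize_conjugate[OF assms(3)] kappa_conjugate[OF assms(3)]
  proof (rule arg_cong[where f = "(*) _"], rule disc_sqrt_frobenius[OF assms(2)])
    fix z :: complex assume z: "0 < norm z" "norm z < 1"
    have "- (- kappa lam div 2) = kappa lam div 2" using even_kappa[of lam] by (auto elim: evenE)
    then show "(-1) ^ psize lam * z powi (- (- kappa lam div 2) + int (psize lam)) *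
        hook_prod (conjugate lam) z =
        exp (log_macmahon z) * (z ^ (n + psize lam) * frobenius z lam)\<^sup>2"
      unfolding conj[OF z] by (intro main z) (use n in simp)
  qed
  ultimately show ?thesis
    by (simp add: power_minus[of q] power_add mult_ac)
qed

section \<open>The pairings\<close>

text \<open>The minus sign from transposition and the signs \<open>(-1) ^ (n + 1)\<close> from
  undoing the conjugation in the shape of the standard ket combine to \<open>(-1) ^ n\<close>, which
  homogeneity with \<open>c = -1\<close> turns into the sign in front.\<close>

lemma sdual_bra_std_ket:
  assumes "is_partition mu"
  shows "sdual_bra q lam (std_ket mu) = norm_bra lam q *
    ((-1) ^ psize mu * schur (\<lambda>n. spec_sum q lam n / of_nat n) mu)"
proof -
  have pw: "q powi ((- int (part lam (Suc l)) + int (Suc l)) * int n) = spec q lam l ^ n" for l n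
    by (simp add: spec_def power_int_mult power_int_of_nat)
  have "sdual_bra q lam (std_ket mu) =
      norm_bra lam q * std_bra [] (op_exp (raise_op (spec_sum q lam)) (std_ket mu))"
    unfolding sdual_bra_def raise_op_def spec_sum_def pw ..
  also have "std_bra [] (op_exp (raise_op (spec_sum q lam)) (std_ket mu)) =
      schur (\<lambda>n. (-1) ^ n * (spec_sum q lam n / of_nat n)) mu"
    unfolding std_bra_op_exp_raise_op[OF assms] schur_conjugate[OF assms] by simp
  also have "\<dots> = (-1) ^ psize mu * schur (\<lambda>n. spec_sum q lam n / of_nat n) mu"
    by (rule schur_homogeneous[OF assms]) simp
  finally show ?thesis .
qed

text \<open>The additional -1 in the exponents of the ket divides every variable by
  \<open>q\<close>; by homogeneity this is the factor \<open>inverse q ^ psize mu\<close>.\<close>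

lemma std_bra_sdual_ket:
  assumes "0 < norm q" "norm q < 1" "is_partition mu"
  shows "std_bra mu (sdual_ket q lam) = norm_ket lam q *
    (inverse q ^ psize mu * schur (\<lambda>n. spec_sum q (conjugate lam) n / of_nat n) (conjugate mu))"
proof -
  have q0: "q \<noteq> 0" using assms(1) by auto
  define p where "p n = suminf (\<lambda>l. q powi ((- int (part (conjugate lam) (Suc l)) + int (Suc l) - 1) * int n))"
    for n :: nat
  have p: "p n = inverse q ^ n * spec_sum q (conjugate lam) n" if "n > 0" for n
  proof -
    have "q powi ((- int (part (conjugate lam) (Suc l)) + int (Suc l) - 1) * int n) =
        inverse q ^ n * spec q (conjugate lam) l ^ n" for l
    proof -
      have "q powi (- int (part (conjugate lam) (Suc l)) + int (Suc l) - 1) = inverse q * spec q (conjugate lam) l"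
        using power_int_add[of q "-1" "int (Suc l) - int (part (conjugate lam) (Suc l))"] q0
        by (simp add: spec_def power_int_minus)
      then show ?thesis by (simp add: power_int_mult power_int_of_nat power_mult_distrib)
    qed
    then show ?thesis
      unfolding p_def spec_sum_def by (simp add: suminf_mult[OF summable_spec[OF assms(2) that]])
  qed
  have "std_bra mu (sdual_ket q lam) = norm_ket lam q * schur (\<lambda>n. p n / of_nat n) (conjugate mu)"
    unfolding sdual_ket_def op_exp_ket p_def[symmetric]
    by (rule std_bra_op_exp_shift_op[OF assms(3)])
  also have "schur (\<lambda>n. p n / of_nat n) (conjugate mu) =
      schur (\<lambda>n. inverse q ^ n * (spec_sum q (conjugate lam) n / of_nat n)) (conjugate mu)"
    by (rule schur_cong) (simp add: p)
  also have "\<dots> = inverse q ^ psize mu * schur (\<lambda>n. spec_sum q (conjugate lam) n / of_nat n) (conjugate mu)"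
    unfolding psize_conjugate[OF assms(3), symmetric]
    by (rule schur_homogeneous[OF is_partition_conjugate[OF assms(3)]]) (use q0 in simp)
  finally show ?thesis .
qed

lemma sdual_bra_symmetric:
  assumes "0 < norm q" "norm q < 1" "is_partition lam" "is_partition mu"
  shows "sdual_bra q lam (std_ket mu) = sdual_bra q mu (std_ket lam)"
proof -
  let ?s = "\<lambda>nu rho. schur (\<lambda>n. spec_sum q nu n / of_nat n) rho"
  have bra: "sdual_bra q nu (std_ket rho) = (-1) ^ psize nu * (-1) ^ psize rho *
      exp (log_macmahon q / 2) * (?s [] nu * ?s nu rho)"
    if "is_partition nu" "is_partition rho" for nu rho
    unfolding sdual_bra_std_ket[OF that(2)] norm_bra_eq[OF assms(2) that(1)]
      schur_principal[OF assms(1,2) that(1)] by (simp only: mult_ac)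
  show ?thesis
    unfolding bra[OF assms(3,4)] bra[OF assms(4,3)] schur_spec_symmetric[OF assms]
    by (simp only: mult_ac)
qed

text \<open>The part of the prefactor with \<open>lam\<close> is the quotient of the normalizations.
  The part with \<open>mu\<close> combines the division of the variables by \<open>q\<close> with
  the sign in the bra pairing.\<close>

lemma std_bra_sdual_ket_conjugate:
  assumes "0 < norm q" "norm q < 1" "is_partition lam" "is_partition mu"
  shows "std_bra mu (sdual_ket q lam) = (- q) powi (- int (psize lam) - int (psize mu)) *
    sdual_bra q (conjugate lam) (std_ket (conjugate mu))"
proof -
  have q0: "q \<noteq> 0" using assms(1) by auto
  let ?s = "schur (\<lambda>n. spec_sum q (conjugate lam) n / of_nat n) (conjugate mu)"
  have "sdual_bra q (conjugate lam) (std_ket (conjugate mu)) =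
      (- q) ^ psize lam * norm_ket lam q * ((-1) ^ psize mu * ?s)"
    unfolding sdual_bra_std_ket[OF is_partition_conjugate[OF assms(4)]]
      norm_bra_conjugate[OF assms(1-3)] psize_conjugate[OF assms(4)] ..
  moreover have "(- q) powi (- int (psize lam) - int (psize mu)) =
      inverse ((- q) ^ psize lam) * inverse ((- q) ^ psize mu)"
  proof -
    have "(- q) powi (- int (psize lam) + - int (psize mu)) =
        (- q) powi (- int (psize lam)) * (- q) powi (- int (psize mu))"
      by (rule power_int_add) (use q0 in simp)
    then show ?thesis by (simp add: power_int_minus power_int_of_nat)
  qed
  ultimately have "(- q) powi (- int (psize lam) - int (psize mu)) *
      sdual_bra q (conjugate lam) (std_ket (conjugate mu)) =
      (inverse ((- q) ^ psize lam) * (- q) ^ psize lam) *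
      (norm_ket lam q * ((inverse ((- q) ^ psize mu) * (-1) ^ psize mu) * ?s))"
    by (simp only: mult_ac)
  also have "inverse ((- q) ^ psize mu) * (-1) ^ psize mu = inverse q ^ psize mu"
    unfolding power_minus[of q] using q0 by (simp add: power_inverse field_simps)
  also have "inverse ((- q) ^ psize lam) * (- q) ^ psize lam = 1" using q0 by simp
  finally show ?thesis unfolding std_bra_sdual_ket[OF assms(1,2,4)] by simp
qed

theorem proposition4p3:
  fixes q :: complex and lam mu :: "nat list"
  assumes "0 < norm q" and "norm q < 1"
    and "is_partition lam" and "is_partition mu"
  shows "sdual_bra q lam (std_ket mu) = sdual_bra q mu (std_ket lam)
    \<and> std_bra lam (sdual_ket q mu) = std_bra mu (sdual_ket q lam)
    \<and> std_bra mu (sdual_ket q lam) =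
        (- q) powi (- int (psize lam) - int (psize mu)) *
        sdual_bra q (conjugate lam) (std_ket (conjugate mu))"
proof (intro conjI)
  show "sdual_bra q lam (std_ket mu) = sdual_bra q mu (std_ket lam)"
    by (rule sdual_bra_symmetric[OF assms])
  show "std_bra lam (sdual_ket q mu) = std_bra mu (sdual_ket q lam)"
    unfolding std_bra_sdual_ket_conjugate[OF assms]
      std_bra_sdual_ket_conjugate[OF assms(1,2,4,3)]
      sdual_bra_symmetric[OF assms(1,2) is_partition_conjugate[OF assms(4)] is_partition_conjugate[OF assms(3)]]
    by (rule arg_cong[where f = "\<lambda>n. (- q) powi n * _"]) simp
  show "std_bra mu (sdual_ket q lam) = (- q) powi (- int (psize lam) - int (psize mu)) *
        sdual_bra q (conjugate lam) (std_ket (conjugate mu))"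
    by (rule std_bra_sdual_ket_conjugate[OF assms])
qed

end
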